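(* Let $\sigma=1+m/2$ with $m\in\mathbb{N}_{+}$ and $n=2\sigma+2$. For any $k\in\mathbb{N}_{+}$ and any $k$ distinct points $q^{(1)},\dots,q^{(k)}\in\mathbb{S}^n$, there exists a sequence of Morse functions $\{K_i\}\subset\mathscr{A}$ such that for some $v_i\in\mathscr{M}_{K_i}$, $\{v_i\}$ blows up at precisely the $k$ points $q^{(1)},\dots,q^{(k)}$.
   Context: $\mathbb{S}^n\subset\mathbb{R}^{n+1}$ is the unit sphere with standard metric $g_0$, $\Delta_{g_0}$ its Laplace–Beltrami operator, $d(\cdot,\cdot)$ its geodesic distance. The operator $P_\sigma$ is $$P_\sigma=\frac{\Gamma(B+\frac12+\sigma)}{\Gamma(B+\frac12-\sigma)},\quad B=\sqrt{-\Delta_{g_0}+\Big(\frac{n-1}{2}\Big)^2},$$ and $c(n,\sigma)=\Gamma(\frac n2+\sigma)/\Gamma(\frac n2-\sigma)$. Since $n-2\sigma=2$, $\frac{n+2\sigma}{n-2\sigma}=n-1$. For $K\in C^2(\mathbb{S}^n)$, $\mathscr{M}_K$ is the set of positive $v\in C^{2\sigma}(\mathbb{S}^n)$ with $P_\sigma v=c(n,\sigma)Kv^{\frac{n+2\sigma}{n-2\sigma}}$ on $\mathbb{S}^n$, and $\mathscr{K}=\{q:\nabla_{g_0}K(q)=0\}$, $\mathscr{K}^{+}=\{q\in\mathscr{K}:\Delta_{g_0}K(q)>0\}$, $\mathscr{K}^{-}=\{q\in\mathscr{K}:\Delta_{g_0}K(q)<0\}$. For $k\ge1$ distinct points $q^{(1)},\dots,q^{(k)}\in\mathscr{K}\setminus\mathscr{K}^{+}$,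 $M=M(q^{(1)},\dots,q^{(k)})$ is the symmetric $k\times k$ matrix $$M_{ii}=-\frac{\Delta_{g_0}K(q^{(i)})}{K(q^{(i)})^{n/2\sigma}},\qquad M_{ij}=-n(n-1)\frac{G_{q^{(i)}}(q^{(j)})}{(K(q^{(i)})K(q^{(j)}))^{1/2\sigma}}\ (i\ne j),\qquad G_{q}(q')=\frac1{1-\cos d(q,q')},$$ and $\mu(M)$ is its smallest eigenvalue. $C^2(\mathbb{S}^n)^*$ is the set of $K\in C^2(\mathbb{S}^n)$ with $K>0$ having only non-degenerate critical points, and $$\mathscr{A}=\{K\in C^2(\mathbb{S}^n)^*:\ \Delta_{g_0}K\ne0\text{ on }\mathscr{K},\ \mu(M(q^{(1)},\dots,q^{(k)}))\neq0\ \text{for all distinct } q^{(1)},\dots,q^{(k)}\in\mathscr{K}^-,\ k\ge2\}.$$ A point $\bar q\in\mathbb{S}^n$ is a blow up point of $\{v_i\}$ if there is a sequence $q_i\to\bar q$ with $v_i(q_i)\to\infty$; $\{v_i\}$ blows up at precisely given points if its set of blow up points is exactly that set. *)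

theory Defs
  imports "HOL-Analysis.Analysis" "Jordan_Normal_Form.Char_Poly"
begin

text \<open>
  The sphere \<open>S\<^sup>n\<close> is \<open>sphere 0 1\<close> in a Euclidean space of dimension \<open>n + 1\<close>.  A function on
  \<open>S\<^sup>n\<close> is a total function of which only the values on \<open>sphere 0 1\<close> are used.

  Differentiation on \<open>S\<^sup>n\<close> goes through the extension \<open>F x = f (x / \<bar>x\<bar>)\<close>, constant along rays:
  \<open>f\<close> is \<open>C\<^sup>k\<close> on \<open>S\<^sup>n\<close> iff \<open>F\<close> is \<open>C\<^sup>k\<close> off the origin.  For a unit vector \<open>u\<close> tangent
  at \<open>q\<close>, \<open>t \<mapsto> F (q + t u)\<close> is \<open>f\<close> along the great circle through \<open>q\<close> in direction \<open>u\<close>, taken at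
  arc length \<open>arctan t = t + O(t\<^sup>3)\<close>.  Hence the first two derivatives of \<open>F\<close> at \<open>q\<close>,
  restricted to tangent vectors, are the differential and the covariant Hessian of \<open>f\<close> for the
  standard metric \<open>g\<^sub>0\<close>; in the normal direction \<open>q\<close> the derivatives \<open>dF(q)\<close> and \<open>d\<^sup>2F(q,q)\<close>
  vanish, so the Euclidean gradient and Laplacian of \<open>F\<close> at \<open>q\<close> are the gradient and the
  Laplace--Beltrami operator of \<open>f\<close>.
\<close>

definition radial_ext :: "('a::real_normed_vector \<Rightarrow> real) \<Rightarrow> 'a \<Rightarrow> real" where
  "radial_ext f x = f (x /\<^sub>R norm x)"

text \<open>For open \<open>S\<close>.\<close>

primrec Ck_on :: "nat \<Rightarrow> 'a::real_normed_vector set \<Rightarrow> ('a \<Rightarrow> real) \<Rightarrow> bool" where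
  "Ck_on 0 S f \<longleftrightarrow> continuous_on S f"
| "Ck_on (Suc k) S f \<longleftrightarrow>
     f differentiable_on S \<and> (\<forall>u. Ck_on k S (\<lambda>x. frechet_derivative f (at x) u))"

definition sphere_Ck :: "nat \<Rightarrow> ('a::euclidean_space \<Rightarrow> real) set" where
  "sphere_Ck k = {f. Ck_on k (- {0}) (radial_ext f)}"

definition sphere_grad :: "('a::euclidean_space \<Rightarrow> real) \<Rightarrow> 'a \<Rightarrow> 'a" where
  "sphere_grad f q = (\<Sum>b\<in>Basis. frechet_derivative (radial_ext f) (at q) b *\<^sub>R b)"

text \<open>The covariant Hessian at \<open>q\<close>; meaningful for \<open>u\<close>, \<open>w\<close> tangent at \<open>q\<close>.\<close>

definition sphere_hess :: "('a::euclidean_space \<Rightarrow> real) \<Rightarrow> 'a \<Rightarrow> 'a \<Rightarrow> 'a \<Rightarrow> real" where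
  "sphere_hess f q u w =
     frechet_derivative (\<lambda>x. frechet_derivative (radial_ext f) (at x) u) (at q) w"

definition sphere_lap :: "('a::euclidean_space \<Rightarrow> real) \<Rightarrow> 'a \<Rightarrow> real" where
  "sphere_lap f q = (\<Sum>b\<in>Basis. sphere_hess f q b b)"

definition sphere_dist :: "'a::euclidean_space \<Rightarrow> 'a \<Rightarrow> real" where
  "sphere_dist q q' = arccos (q \<bullet> q')"

text \<open>The integral for the volume measure of \<open>g\<^sub>0\<close>, in polar coordinates:
  \<open>\<integral>\<^sub>B f(x/\<bar>x\<bar>) dx = (\<integral>\<^sub>0\<^sup>1 r\<^sup>n dr) \<integral>\<^sub>S f\<close>, where \<open>B\<close> is the unit ball of dimension \<open>n + 1\<close>.\<close>

definition sphere_integral :: "('a::euclidean_space \<Rightarrow> real) \<Rightarrow> real" where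
  "sphere_integral f = real DIM('a) * (LINT x:ball 0 1|lborel. f (x /\<^sub>R norm x))"

text \<open>Functional calculus of \<open>-\<Delta>\<close>.  This operator has discrete spectrum on \<open>L\<^sup>2(S\<^sup>n)\<close>, so
  \<open>\<phi>(-\<Delta>) v\<close> is the \<open>L\<^sup>2\<close>-convergent sum of \<open>\<phi>(\<nu>) \<pi>\<^sub>\<nu> v\<close> over the eigenvalues \<open>\<nu>\<close>, where \<open>\<pi>\<^sub>\<nu>\<close> is
  the orthogonal projection onto the eigenspace.  The result is a class in \<open>L\<^sup>2\<close>; the relation below
  says that the continuous function \<open>w\<close> represents it.\<close>

definition lap_eigenspace :: "real \<Rightarrow> ('a::euclidean_space \<Rightarrow> real) set" where
  "lap_eigenspace \<nu> = {Y \<in> sphere_Ck 2. \<forall>x\<in>sphere 0 1. - sphere_lap Y x = \<nu> * Y x}"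

definition lap_eigenvalues :: "'a::euclidean_space itself \<Rightarrow> real set" where
  "lap_eigenvalues _ = {\<nu>. \<exists>Y\<in>lap_eigenspace \<nu>. \<exists>x\<in>sphere (0::'a) 1. Y x \<noteq> 0}"

definition is_eigenprojection ::
    "real \<Rightarrow> ('a::euclidean_space \<Rightarrow> real) \<Rightarrow> ('a \<Rightarrow> real) \<Rightarrow> bool" where
  "is_eigenprojection \<nu> v p \<longleftrightarrow>
     p \<in> lap_eigenspace \<nu> \<and>
     (\<forall>Y\<in>lap_eigenspace \<nu>. sphere_integral (\<lambda>x. (v x - p x) * Y x) = 0)"

definition has_lap_calculus ::
    "(real \<Rightarrow> real) \<Rightarrow> ('a::euclidean_space \<Rightarrow> real) \<Rightarrow> ('a \<Rightarrow> real) \<Rightarrow> bool" where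
  "has_lap_calculus \<phi> v w \<longleftrightarrow>
     continuous_on (sphere 0 1) w \<and>
     (\<exists>p. (\<forall>\<nu>\<in>lap_eigenvalues TYPE('a). is_eigenprojection \<nu> v (p \<nu>)) \<and>
          ((\<lambda>F. sphere_integral (\<lambda>x. (w x - (\<Sum>\<nu>\<in>F. \<phi> \<nu> * p \<nu> x))\<^sup>2)) \<longlongrightarrow> 0)
            (finite_subsets_at_top (lap_eigenvalues TYPE('a))))"

definition P_symbol :: "nat \<Rightarrow> real \<Rightarrow> real \<Rightarrow> real" where
  "P_symbol n \<sigma> \<nu> =
     (let b = sqrt (\<nu> + ((real n - 1) / 2)\<^sup>2)
      in Gamma (b + 1/2 + \<sigma>) / Gamma (b + 1/2 - \<sigma>))"

text \<open>\<open>has_P n \<sigma> v w\<close> means \<open>P\<^sub>\<sigma> v = w\<close> on \<open>S\<^sup>n\<close>.\<close>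

definition has_P ::
    "nat \<Rightarrow> real \<Rightarrow> ('a::euclidean_space \<Rightarrow> real) \<Rightarrow> ('a \<Rightarrow> real) \<Rightarrow> bool" where
  "has_P n \<sigma> = has_lap_calculus (P_symbol n \<sigma>)"

definition c_const :: "nat \<Rightarrow> real \<Rightarrow> real" where
  "c_const n \<sigma> = Gamma (real n / 2 + \<sigma>) / Gamma (real n / 2 - \<sigma>)"

text \<open>The space \<open>C\<^sup>2\<^sup>\<sigma>\<close> is used only for integer \<open>2 \<sigma>\<close>, where it needs no Hoelder condition.\<close>

definition solutions ::
    "nat \<Rightarrow> real \<Rightarrow> ('a::euclidean_space \<Rightarrow> real) \<Rightarrow> ('a \<Rightarrow> real) set" where
  "solutions n \<sigma> K =
     {v \<in> sphere_Ck (nat \<lfloor>2 * \<sigma>\<rfloor>).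
        (\<forall>x\<in>sphere 0 1. v x > 0) \<and>
        has_P n \<sigma> v
          (\<lambda>x. c_const n \<sigma> * K x * v x powr ((real n + 2 * \<sigma>) / (real n - 2 * \<sigma>)))}"

definition crit :: "('a::euclidean_space \<Rightarrow> real) \<Rightarrow> 'a set" where
  "crit K = {q \<in> sphere 0 1. sphere_grad K q = 0}"

definition crit_minus :: "('a::euclidean_space \<Rightarrow> real) \<Rightarrow> 'a set" where
  "crit_minus K = {q \<in> crit K. sphere_lap K q < 0}"

definition nondegenerate_at :: "('a::euclidean_space \<Rightarrow> real) \<Rightarrow> 'a \<Rightarrow> bool" where
  "nondegenerate_at K q \<longleftrightarrow>
     (\<forall>u. u \<bullet> q = 0 \<and> u \<noteq> 0 \<longrightarrow> (\<exists>w. w \<bullet> q = 0 \<and> sphere_hess K q u w \<noteq> 0))"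

definition morse :: "('a::euclidean_space \<Rightarrow> real) \<Rightarrow> bool" where
  "morse K \<longleftrightarrow> K \<in> sphere_Ck 2 \<and> (\<forall>q\<in>crit K. nondegenerate_at K q)"

definition C2_star :: "('a::euclidean_space \<Rightarrow> real) set" where
  "C2_star = {K \<in> sphere_Ck 2. (\<forall>x\<in>sphere 0 1. K x > 0) \<and> (\<forall>q\<in>crit K. nondegenerate_at K q)}"

definition G_fun :: "'a::euclidean_space \<Rightarrow> 'a \<Rightarrow> real" where
  "G_fun q q' = 1 / (1 - cos (sphere_dist q q'))"

definition M_matrix ::
    "nat \<Rightarrow> real \<Rightarrow> ('a::euclidean_space \<Rightarrow> real) \<Rightarrow> 'a list \<Rightarrow> real mat" where
  "M_matrix n \<sigma> K qs = Matrix.mat (length qs) (length qs) (\<lambda>(i, j).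
     if i = j then - sphere_lap K (qs ! i) / K (qs ! i) powr (real n / (2 * \<sigma>))
     else - real n * (real n - 1) * G_fun (qs ! i) (qs ! j) /
            (K (qs ! i) * K (qs ! j)) powr (1 / (2 * \<sigma>)))"

definition smallest_eigenvalue :: "real mat \<Rightarrow> real" where
  "smallest_eigenvalue A = Min {e. eigenvalue A e}"

definition A_set :: "nat \<Rightarrow> real \<Rightarrow> ('a::euclidean_space \<Rightarrow> real) set" where
  "A_set n \<sigma> =
     {K \<in> C2_star.
        (\<forall>q\<in>crit K. sphere_lap K q \<noteq> 0) \<and>
        (\<forall>qs. length qs \<ge> 2 \<and> distinct qs \<and> set qs \<subseteq> crit_minus K \<longrightarrow>
              smallest_eigenvalue (M_matrix n \<sigma> K qs) \<noteq> 0)}"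

definition blow_up_points :: "(nat \<Rightarrow> 'a::euclidean_space \<Rightarrow> real) \<Rightarrow> 'a set" where
  "blow_up_points v =
     {q \<in> sphere 0 1. \<exists>y. (\<forall>i. y i \<in> sphere 0 1) \<and> y \<longlonglongrightarrow> q \<and>
        filterlim (\<lambda>i. v i (y i)) at_top sequentially}"

end

theory Submission imports Defs begin

text \<open>
  Rather than solving for \<open>v\<close>, choose \<open>v\<close> and \<open>f = P\<^sub>\<sigma> v\<close> as positive finite sums of spherical
  harmonics and set \<open>K = f / (c v\<^sup>n\<^sup>-\<^sup>1)\<close>; blow up is then a matter of choosing \<open>v\<close>, and since
  \<open>P\<^sub>\<sigma>\<close> has a positive inverse, truncated Newton kernels with poles near the prescribed points will
  do.  It remains to put \<open>K\<close> into the class \<open>A\<close> by a small perturbation of \<open>v\<close>.  Adding planar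
  harmonics of high degree makes \<open>K\<close> Morse by Sard's lemma.  At its finitely many critical points, a
  further harmonic sum (obtained by jet interpolation) changes \<open>\<Delta>K\<close> by \<open>t K\<close> without moving these
  points or their values of \<open>K\<close>; this shifts each matrix \<open>M\<close> by \<open>-t\<close> times a positive diagonal
  matrix, so all but finitely many \<open>t\<close> avoid zero Laplacians and singular matrices.
\<close>

text \<open>The relation n = 2 \<sigma> + 2 acts twice: the exponent of v becomes the integer n - 1,
  and on harmonics of degree l the operator becomes multiplication by the polynomial (l + 1) ... (l
  + n - 2). The obstacle is that v and f cannot be varied independently, being built from the same
  harmonics. Two features of this polynomial decouple them. For Sard's lemma its growth is enough: a
  harmonic of high degree acts on f much more strongly than on v, so its first order effect on the
  gradient of K reaches every tangent direction. For the interpolation its degree matters: value,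
  gradient and Laplacian of v weigh degree l by polynomials of degree 0, 1, 2, those of f by
  polynomials of degree n - 2, n - 1, n, so that an n-th order difference in l sees only the
  Laplacian of f. Blow up at other points is excluded because the bound on v away from a pole does
  not depend on the height of v at the pole; the final perturbation changes v by less than 1 and
  disturbs neither.\<close>

no_notation scalar_prod (infix "\<bullet>" 70)
no_notation vec_index (infixl "$" 100)

section \<open>Functions of class \<open>C\<^sup>k\<close>\<close>

definition pd :: "'a::real_normed_vector \<Rightarrow> ('a \<Rightarrow> real) \<Rightarrow> 'a \<Rightarrow> real" where
  "pd u f x = frechet_derivative f (at x) u"

lemma pd_eq: "(f has_derivative f') (at x) \<Longrightarrow> pd u f x = f' u"
  unfolding pd_def using frechet_derivative_at by metis

lemma has_derivative_pd: "f differentiable at x \<Longrightarrow> (f has_derivative (\<lambda>u. pd u f x)) (at x)"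
  unfolding pd_def using frechet_derivative_works by blast

lemma bounded_linear_pd: "f differentiable at x \<Longrightarrow> bounded_linear (\<lambda>u. pd u f x)"
  using has_derivative_pd has_derivative_bounded_linear by blast

lemma pd_cong_open:
  assumes "open S" "x \<in> S" "\<And>y. y \<in> S \<Longrightarrow> f y = g y"
  shows "pd u f x = pd u g x"
proof -
  have "(f has_derivative D) (at x) \<longleftrightarrow> (g has_derivative D) (at x)" for D
    using assms by (metis has_derivative_transform_within_open)
  then show ?thesis unfolding pd_def frechet_derivative_def by simp
qed

lemma pd_add:
  "f differentiable at x \<Longrightarrow> g differentiable at x \<Longrightarrow> pd u (\<lambda>x. f x + g x) x = pd u f x + pd u g x"
  by (rule pd_eq) (intro has_derivative_add has_derivative_pd)

lemma pd_mult:
  "f differentiable at x \<Longrightarrow> g differentiable at x \<Longrightarrow>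
    pd u (\<lambda>x. f x * g x) x = f x * pd u g x + pd u f x * g x"
  by (rule pd_eq) (rule has_derivative_mult[OF has_derivative_pd has_derivative_pd])

lemma pd_cmult: "f differentiable at x \<Longrightarrow> pd u (\<lambda>x. c * f x) x = c * pd u f x"
  by (rule pd_eq) (intro has_derivative_mult_right has_derivative_pd)

lemma pd_const [simp]: "pd u (\<lambda>x. c) x = 0"
  by (rule pd_eq) simp

lemma pd_bounded_linear: "bounded_linear f \<Longrightarrow> pd u f x = f u"
  by (rule pd_eq) (simp add: bounded_linear_imp_has_derivative)

lemma pd_inverse:
  assumes "f differentiable at x" "f x \<noteq> 0"
  shows "pd u (\<lambda>x. inverse (f x)) x = - (pd u f x * (inverse (f x) * inverse (f x)))"
  by (rule pd_eq) (auto intro!: derivative_eq_intros has_derivative_pd assms simp: algebra_simps)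

lemma pd_sum:
  assumes "\<And>i. i \<in> I \<Longrightarrow> f i differentiable at x"
  shows "pd u (\<lambda>x. \<Sum>i\<in>I. f i x) x = (\<Sum>i\<in>I. pd u (f i) x)"
  by (rule pd_eq) (intro has_derivative_sum has_derivative_pd assms)

lemma pd_arg_add: "f differentiable at x \<Longrightarrow> pd (u + w) f x = pd u f x + pd w f x"
  using bounded_linear_pd[of f x] by (rule linear_add[OF bounded_linear.linear])

lemma pd_arg_scaleR: "f differentiable at x \<Longrightarrow> pd (c *\<^sub>R u) f x = c * pd u f x"
  using linear_scale[OF bounded_linear.linear[OF bounded_linear_pd[of f x]]] by simp

lemma pd_arg_sum:
  "f differentiable at x \<Longrightarrow> pd (\<Sum>i\<in>I. u i) f x = (\<Sum>i\<in>I. pd (u i) f x)"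
  using linear_sum[OF bounded_linear.linear[OF bounded_linear_pd[of f x]]] by simp

lemma pd_euclidean:
  fixes f :: "'a::euclidean_space \<Rightarrow> real"
  assumes "f differentiable at x"
  shows "pd u f x = (\<Sum>b\<in>Basis. (u \<bullet> b) * pd b f x)"
proof -
  have "pd u f x = pd (\<Sum>b\<in>Basis. (u \<bullet> b) *\<^sub>R b) f x"
    by (simp add: euclidean_representation)
  then show ?thesis
    by (simp add: pd_arg_sum pd_arg_scaleR assms)
qed

lemma Ck_on_Suc: "Ck_on (Suc k) S f \<longleftrightarrow> f differentiable_on S \<and> (\<forall>u. Ck_on k S (pd u f))"
  by (simp add: pd_def[abs_def])

declare Ck_on.simps(2) [simp del]

lemma Ck_on_differentiable:
  assumes "Ck_on (Suc k) S f" "open S" "x \<in> S" shows "f differentiable at x"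
  using assms by (metis Ck_on_Suc at_within_open differentiable_on_def)

lemma Ck_on_cong:
  assumes "open S" "\<And>x. x \<in> S \<Longrightarrow> f x = g x"
  shows "Ck_on k S f \<longleftrightarrow> Ck_on k S g"
  using assms(2)
proof (induction k arbitrary: f g)
  case 0
  then show ?case by (simp cong: continuous_on_cong)
next
  case (Suc k)
  have "f differentiable_on S \<longleftrightarrow> g differentiable_on S"
    unfolding differentiable_on_def using Suc.prems
    by (auto intro: differentiable_transform_within[where d = 1])
  moreover have "Ck_on k S (pd u f) \<longleftrightarrow> Ck_on k S (pd u g)" for u
    by (intro Suc.IH) (use assms(1) Suc.prems pd_cong_open in metis)
  ultimately show ?case by (simp add: Ck_on_Suc)
qed

lemma Ck_on_SucD: "Ck_on (Suc k) S f \<Longrightarrow> Ck_on k S f"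
proof (induction k arbitrary: f)
  case 0
  then show ?case by (simp add: Ck_on_Suc differentiable_imp_continuous_on)
next
  case (Suc k)
  then show ?case by (simp add: Ck_on_Suc)
qed

lemma Ck_on_le: "Ck_on k S f \<Longrightarrow> j \<le> k \<Longrightarrow> Ck_on j S f"
  by (induction k) (auto simp: le_Suc_eq dest: Ck_on_SucD)

lemma Ck_on_continuous: "Ck_on k S f \<Longrightarrow> continuous_on S f"
  using Ck_on_le[of k S f 0] by simp

lemma Ck_on_subset: "Ck_on k S f \<Longrightarrow> T \<subseteq> S \<Longrightarrow> Ck_on k T f"
proof (induction k arbitrary: f)
  case 0
  then show ?case by (auto intro: continuous_on_subset)
next
  case (Suc k)
  then show ?case by (auto simp: Ck_on_Suc intro: differentiable_on_subset)
qed

lemma Ck_on_const: "Ck_on k S (\<lambda>x. c)"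
  by (induction k arbitrary: c) (simp_all add: Ck_on_Suc[abs_def] pd_const[abs_def])

lemma Ck_on_bounded_linear: "bounded_linear f \<Longrightarrow> Ck_on k S f"
proof (cases k)
  case 0
  assume "bounded_linear f"
  then show ?thesis using 0 by (simp add: linear_continuous_on)
next
  case (Suc j)
  assume "bounded_linear f"
  moreover from this have "pd u f = (\<lambda>x. f u)" for u
    using pd_bounded_linear by blast
  ultimately show ?thesis using Suc
    by (simp add: Ck_on_Suc Ck_on_const bounded_linear_imp_differentiable_on)
qed

lemma Ck_on_add:
  assumes "open S"
  shows "Ck_on k S f \<Longrightarrow> Ck_on k S g \<Longrightarrow> Ck_on k S (\<lambda>x. f x + g x)"
proof (induction k arbitrary: f g)
  case 0
  then show ?case by (simp add: continuous_on_add)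
next
  case (Suc k)
  have "Ck_on k S (pd u (\<lambda>x. f x + g x))" for u
  proof -
    have "Ck_on k S (\<lambda>x. pd u f x + pd u g x)"
      using Suc by (simp add: Ck_on_Suc)
    then show ?thesis
      by (subst Ck_on_cong[OF assms, where g = "\<lambda>x. pd u f x + pd u g x"])
        (use Suc.prems assms Ck_on_differentiable pd_add in \<open>metis+\<close>)
  qed
  then show ?case using Suc.prems by (simp add: Ck_on_Suc)
qed

lemma Ck_on_mult:
  assumes "open S"
  shows "Ck_on k S f \<Longrightarrow> Ck_on k S g \<Longrightarrow> Ck_on k S (\<lambda>x. f x * g x)"
proof (induction k arbitrary: f g)
  case 0
  then show ?case by (simp add: continuous_on_mult)
next
  case (Suc k)
  have "Ck_on k S (pd u (\<lambda>x. f x * g x))" for u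
  proof -
    have "Ck_on k S (\<lambda>x. f x * pd u g x + pd u f x * g x)"
      by (intro Ck_on_add assms Suc.IH) (use Suc.prems Ck_on_SucD Ck_on_Suc in blast)+
    then show ?thesis
      by (subst Ck_on_cong[OF assms, where g = "\<lambda>x. f x * pd u g x + pd u f x * g x"])
        (use Suc.prems assms Ck_on_differentiable pd_mult in \<open>metis+\<close>)
  qed
  then show ?case using Suc.prems by (simp add: Ck_on_Suc)
qed

lemma Ck_on_sum:
  assumes "open S"
  shows "(\<And>i. i \<in> I \<Longrightarrow> Ck_on k S (f i)) \<Longrightarrow> Ck_on k S (\<lambda>x. \<Sum>i\<in>I. f i x)"
  by (induction I rule: infinite_finite_induct) (auto simp: Ck_on_const intro: Ck_on_add[OF assms])

lemma Ck_on_power: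
  assumes "open S" "Ck_on k S f"
  shows "Ck_on k S (\<lambda>x. f x ^ j)"
  by (induction j) (auto simp: Ck_on_const intro: Ck_on_mult[OF assms(1)] assms(2))

lemma Ck_on_inverse:
  assumes "open S" "Ck_on k S f" "\<And>x. x \<in> S \<Longrightarrow> f x \<noteq> 0"
  shows "Ck_on k S (\<lambda>x. inverse (f x))"
  using assms(2)
proof (induction k)
  case 0
  then show ?case using assms(3) by (simp add: continuous_on_inverse)
next
  case (Suc k)
  have inv: "Ck_on k S (\<lambda>x. inverse (f x))" using Suc Ck_on_SucD by blast
  have "Ck_on k S (pd u (\<lambda>x. inverse (f x)))" for u
  proof -
    have "Ck_on k S (\<lambda>x. (- 1) * (pd u f x * (inverse (f x) * inverse (f x))))"
      using Suc.prems inv by (intro Ck_on_mult assms(1) Ck_on_const) (auto simp: Ck_on_Suc)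
    then show ?thesis
      by (subst Ck_on_cong[OF assms(1),
            where g = "\<lambda>x. (- 1) * (pd u f x * (inverse (f x) * inverse (f x)))"])
        (use Ck_on_differentiable[OF Suc.prems assms(1)] pd_inverse[of f] assms(3) in auto)
  qed
  moreover have "(\<lambda>x. inverse (f x)) differentiable_on S"
    using Suc.prems assms(3) by (simp add: Ck_on_Suc differentiable_on_inverse)
  ultimately show ?case by (simp add: Ck_on_Suc)
qed

lemma pd_norm: "x \<noteq> 0 \<Longrightarrow> pd u norm x = (x \<bullet> u) * inverse (norm x)"
  for x :: "'a::real_inner"
  by (subst pd_eq[OF has_derivative_norm]) (auto simp: sgn_div_norm inner_commute)

text \<open>The gradient x / |x| is again expressed through \<open>norm\<close>, so the induction
  closes with the product and inverse rules alone.\<close>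

lemma Ck_on_norm: "Ck_on k (- {0}) (norm :: 'a::real_inner \<Rightarrow> real)"
proof (induction k)
  case 0
  then show ?case by (simp add: continuous_on_norm_id)
next
  case (Suc k)
  have op: "open (- {0::'a})" by auto
  have "Ck_on k (- {0}) (pd u (norm :: 'a \<Rightarrow> real))" for u
  proof -
    have "Ck_on k (- {0}) (\<lambda>x::'a. (x \<bullet> u) * inverse (norm x))"
      by (intro Ck_on_mult Ck_on_inverse Suc op Ck_on_bounded_linear bounded_linear_inner_left) auto
    then show ?thesis
      by (subst Ck_on_cong[OF op, where g = "\<lambda>x::'a. (x \<bullet> u) * inverse (norm x)"])
         (use pd_norm in auto)
  qed
  moreover have "(norm :: 'a \<Rightarrow> real) differentiable_on - {0}"
    unfolding differentiable_on_def differentiable_def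
    by (metis ComplD has_derivative_at_withinI has_derivative_norm singletonI)
  ultimately show ?case by (simp add: Ck_on_Suc)
qed

definition Cinf_on :: "'a::real_normed_vector set \<Rightarrow> ('a \<Rightarrow> real) \<Rightarrow> bool" where
  "Cinf_on S f \<longleftrightarrow> (\<forall>k. Ck_on k S f)"

lemma Cinf_on_Ck_on: "Cinf_on S f \<Longrightarrow> Ck_on k S f"
  by (simp add: Cinf_on_def)

lemma Cinf_on_differentiable: "Cinf_on S f \<Longrightarrow> open S \<Longrightarrow> x \<in> S \<Longrightarrow> f differentiable at x"
  using Ck_on_differentiable Cinf_on_def by metis

lemma Cinf_on_pd: "Cinf_on S f \<Longrightarrow> Cinf_on S (pd u f)"
  unfolding Cinf_on_def by (metis Ck_on_Suc)

lemma Cinf_on_continuous: "Cinf_on S f \<Longrightarrow> continuous_on S f"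
  unfolding Cinf_on_def by (metis Ck_on.simps(1))

lemma Cinf_on_subset: "Cinf_on S f \<Longrightarrow> T \<subseteq> S \<Longrightarrow> Cinf_on T f"
  unfolding Cinf_on_def using Ck_on_subset by metis

lemma Cinf_on_const: "Cinf_on S (\<lambda>x. c)"
  by (simp add: Cinf_on_def Ck_on_const)

lemma Cinf_on_bounded_linear: "bounded_linear f \<Longrightarrow> Cinf_on S f"
  by (simp add: Cinf_on_def Ck_on_bounded_linear)

lemma Cinf_on_add: "open S \<Longrightarrow> Cinf_on S f \<Longrightarrow> Cinf_on S g \<Longrightarrow> Cinf_on S (\<lambda>x. f x + g x)"
  by (simp add: Cinf_on_def Ck_on_add)

lemma Cinf_on_mult: "open S \<Longrightarrow> Cinf_on S f \<Longrightarrow> Cinf_on S g \<Longrightarrow> Cinf_on S (\<lambda>x. f x * g x)"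
  by (simp add: Cinf_on_def Ck_on_mult)

lemma Cinf_on_cmult: "open S \<Longrightarrow> Cinf_on S f \<Longrightarrow> Cinf_on S (\<lambda>x. c * f x)"
  by (intro Cinf_on_mult Cinf_on_const)

lemma Cinf_on_minus: "open S \<Longrightarrow> Cinf_on S f \<Longrightarrow> Cinf_on S g \<Longrightarrow> Cinf_on S (\<lambda>x. f x - g x)"
  using Cinf_on_add[of S f "\<lambda>x. - 1 * g x"] Cinf_on_cmult[of S g "-1"] by simp

lemma Cinf_on_sum: "open S \<Longrightarrow> (\<And>i. i \<in> I \<Longrightarrow> Cinf_on S (f i)) \<Longrightarrow> Cinf_on S (\<lambda>x. \<Sum>i\<in>I. f i x)"
  by (simp add: Cinf_on_def Ck_on_sum)

lemma Cinf_on_power: "open S \<Longrightarrow> Cinf_on S f \<Longrightarrow> Cinf_on S (\<lambda>x. f x ^ j)"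
  by (simp add: Cinf_on_def Ck_on_power)

lemma Cinf_on_inverse:
  "open S \<Longrightarrow> Cinf_on S f \<Longrightarrow> (\<And>x. x \<in> S \<Longrightarrow> f x \<noteq> 0) \<Longrightarrow> Cinf_on S (\<lambda>x. inverse (f x))"
  by (simp add: Cinf_on_def Ck_on_inverse)

lemma Cinf_on_norm: "Cinf_on (- {0}) (norm :: 'a::real_inner \<Rightarrow> real)"
  by (simp add: Cinf_on_def Ck_on_norm)

section \<open>Spherical harmonics\<close>

lemma open_minus_zero [simp]: "open (- {0::'a::real_normed_vector})"
  by (simp add: open_Compl)

lemma pd_const_fun [simp]: "pd u (\<lambda>x. c) = (\<lambda>x. 0)"
  by (rule ext) simp

lemma pd_diff: "f differentiable at x \<Longrightarrow> g differentiable at x \<Longrightarrow>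
    pd u (\<lambda>x. f x - g x) x = pd u f x - pd u g x"
  by (rule pd_eq) (intro has_derivative_diff has_derivative_pd)

lemma has_derivative_along_ray:
  assumes "f differentiable at (t *\<^sub>R x)"
  shows "((\<lambda>t. f (t *\<^sub>R x)) has_real_derivative pd x f (t *\<^sub>R x)) (at t)"
proof -
  have "((\<lambda>t. f (t *\<^sub>R x)) has_derivative (\<lambda>h. pd (h *\<^sub>R x) f (t *\<^sub>R x))) (at t)"
    by (rule has_derivative_compose[of "\<lambda>t. t *\<^sub>R x" "\<lambda>h. h *\<^sub>R x", OF _ has_derivative_pd[OF assms]])
      (auto intro!: derivative_eq_intros)
  then show ?thesis
    by (simp add: has_field_derivative_def pd_arg_scaleR assms mult_commute_abs)
qed

text \<open>Chain rule for y -> f (t y): differentiation lowers the degree of homogeneity by one.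
  The homogeneity hypothesis leaves out the origin, where radial extensions are singular.\<close>

lemma pd_at_scaleR:
  assumes "f differentiable at x" "f differentiable at (t *\<^sub>R x)" "t > 0" "x \<noteq> 0"
    and "\<And>y. y \<noteq> 0 \<Longrightarrow> f (t *\<^sub>R y) = c * f y"
  shows "t * pd u f (t *\<^sub>R x) = c * pd u f x"
proof -
  have "((\<lambda>y. f (t *\<^sub>R y)) has_derivative (\<lambda>h. pd (t *\<^sub>R h) f (t *\<^sub>R x))) (at x)"
    by (rule has_derivative_compose[of "\<lambda>y. t *\<^sub>R y" "\<lambda>h. t *\<^sub>R h", OF _ has_derivative_pd[OF assms(2)]])
      (auto intro!: derivative_eq_intros)
  then have "pd u (\<lambda>y. f (t *\<^sub>R y)) x = t * pd u f (t *\<^sub>R x)"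
    by (subst pd_eq) (auto simp: pd_arg_scaleR assms)
  moreover have "pd u (\<lambda>y. f (t *\<^sub>R y)) x = pd u (\<lambda>y. c * f y) x"
    using assms by (intro pd_cong_open[of "- {0}"]) auto
  ultimately show ?thesis using assms by (simp add: pd_cmult)
qed

text \<open>Both sides are the derivative of t -> f (t x) at t = 1, so only the ray through x
  enters. The real exponent covers the degrees 0 and -1 of a radial extension and of its first
  derivatives.\<close>

lemma euler_homogeneous:
  assumes "f differentiable at x" "\<And>t. t > 0 \<Longrightarrow> f (t *\<^sub>R x) = t powr a * f x"
  shows "pd x f x = a * f x"
proof -
  have "((\<lambda>t. f (t *\<^sub>R x)) has_real_derivative pd x f (1 *\<^sub>R x)) (at 1)"
    by (rule has_derivative_along_ray) (simp add: assms)
  moreover have "((\<lambda>t. f (t *\<^sub>R x)) has_real_derivative a * f x) (at 1)"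
  proof (rule DERIV_cong_ev[THEN iffD2, OF refl _ refl])
    show "\<forall>\<^sub>F t in nhds 1. f (t *\<^sub>R x) = t powr a * f x"
      using eventually_nhds_in_open[of "{0<..}" "1::real"] assms(2) by (auto elim: eventually_mono)
    show "((\<lambda>t. t powr a * f x) has_real_derivative a * f x) (at 1)"
      by (auto intro!: derivative_eq_intros)
  qed
  ultimately show ?thesis using DERIV_unique by force
qed

lemma radial_ext_on_sphere [simp]: "norm q = 1 \<Longrightarrow> radial_ext f q = f q"
  by (simp add: radial_ext_def)

lemma radial_ext_scaleR:
  assumes "t > 0" shows "radial_ext f (t *\<^sub>R x) = radial_ext f x"
proof -
  have "(t *\<^sub>R x) /\<^sub>R norm (t *\<^sub>R x) = x /\<^sub>R norm x"
    using assms by (cases "x = 0") (auto simp: field_simps)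
  then show ?thesis by (simp only: radial_ext_def)
qed

lemma radial_ext_differentiable:
  assumes "Ck_on (Suc k) (- {0}) (radial_ext f)" "x \<noteq> 0"
  shows "radial_ext f differentiable at x"
  using Ck_on_differentiable[OF assms(1)] assms(2) by simp

lemma radial_ext_pd_differentiable:
  assumes "Ck_on 2 (- {0}) (radial_ext f)" "x \<noteq> 0"
  shows "pd u (radial_ext f) differentiable at x"
proof -
  have "Ck_on (Suc 0) (- {0}) (pd u (radial_ext f))"
    using assms(1) by (simp add: numeral_2_eq_2 Ck_on_Suc)
  then show ?thesis using Ck_on_differentiable assms(2) by fastforce
qed

lemma pd_radial_ext_radial:
  assumes "Ck_on (Suc k) (- {0}) (radial_ext f)" "x \<noteq> 0"
  shows "pd x (radial_ext f) x = 0"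
  using euler_homogeneous[OF radial_ext_differentiable[OF assms], of 0]
  by (simp add: radial_ext_scaleR)

lemma pd_radial_ext_scaleR:
  assumes "Ck_on (Suc k) (- {0}) (radial_ext f)" "x \<noteq> 0" "t > 0"
  shows "pd u (radial_ext f) (t *\<^sub>R x) = inverse t * pd u (radial_ext f) x"
  using pd_at_scaleR[OF radial_ext_differentiable[OF assms(1)] radial_ext_differentiable[OF assms(1)],
      of x t 1 u] assms radial_ext_scaleR[of t f]
  by (simp add: field_simps)

lemma pd_pd_radial_ext_radial:
  assumes "Ck_on 2 (- {0}) (radial_ext f)" "x \<noteq> 0"
  shows "pd x (pd u (radial_ext f)) x = - pd u (radial_ext f) x"
proof -
  have "Ck_on (Suc 1) (- {0}) (radial_ext f)" using assms by (simp add: numeral_2_eq_2)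
  then show ?thesis
    using euler_homogeneous[OF radial_ext_pd_differentiable[OF assms], where a = "-1" and u1 = u] assms
    by (simp add: pd_radial_ext_scaleR powr_minus)
qed

lemma pd_pd_radial_ext_scaleR:
  assumes "Ck_on 2 (- {0}) (radial_ext f)" "x \<noteq> 0" "t > 0"
  shows "pd w (pd u (radial_ext f)) (t *\<^sub>R x) = inverse (t\<^sup>2) * pd w (pd u (radial_ext f)) x"
proof -
  have "Ck_on (Suc 1) (- {0}) (radial_ext f)" using assms by (simp add: numeral_2_eq_2)
  then have "t * pd w (pd u (radial_ext f)) (t *\<^sub>R x) = inverse t * pd w (pd u (radial_ext f)) x"
    using assms by (intro pd_at_scaleR radial_ext_pd_differentiable pd_radial_ext_scaleR) auto
  then show ?thesis using assms(3) by (simp add: field_simps power2_eq_square)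
qed

lemma sphere_Ck_iff: "f \<in> sphere_Ck k \<longleftrightarrow> Ck_on k (- {0}) (radial_ext f)"
  by (simp add: sphere_Ck_def)

lemma sphere_hess_eq: "sphere_hess f q u w = pd w (pd u (radial_ext f)) q"
  by (simp add: sphere_hess_def pd_def[abs_def])

lemma sphere_lap_eq: "sphere_lap f q = (\<Sum>b\<in>Basis. pd b (pd b (radial_ext f)) q)"
  by (simp add: sphere_lap_def sphere_hess_eq)

lemma sphere_grad_eq_0_iff:
  "sphere_grad f q = 0 \<longleftrightarrow> (\<forall>b\<in>Basis. pd b (radial_ext f) q = 0)"
proof -
  have "sphere_grad f q \<bullet> b = pd b (radial_ext f) q" if "b \<in> Basis" for b
    using that by (simp add: sphere_grad_def inner_sum_left pd_def inner_Basis if_distrib sum.delta' cong: if_cong)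
  then show ?thesis by (metis euclidean_eqI inner_zero_left)
qed

section \<open>Solid harmonics and their restrictions to the sphere\<close>

definition lap :: "('a::euclidean_space \<Rightarrow> real) \<Rightarrow> 'a \<Rightarrow> real" where
  "lap f x = (\<Sum>b\<in>Basis. pd b (pd b f) x)"

text \<open>These are the homogeneous harmonic polynomials, characterised by smoothness at the
  origin instead of by coefficients. The zero function belongs to every degree, so families indexed
  by all l are available.\<close>

definition solid_harm :: "nat \<Rightarrow> ('a::euclidean_space \<Rightarrow> real) \<Rightarrow> bool" where
  "solid_harm l Y \<longleftrightarrow> Cinf_on UNIV Y \<and> (\<forall>t x. Y (t *\<^sub>R x) = t ^ l * Y x) \<and> (\<forall>x. lap Y x = 0)"

lemma Cinf_on_UNIV_differentiable: "Cinf_on UNIV f \<Longrightarrow> f differentiable at x"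
  using Cinf_on_differentiable by blast

lemma lap_add:
  assumes "Cinf_on UNIV f" "Cinf_on UNIV g"
  shows "lap (\<lambda>x. f x + g x) x = lap f x + lap g x"
proof -
  have "pd u (\<lambda>x. f x + g x) = (\<lambda>x. pd u f x + pd u g x)" for u
    using assms by (intro ext pd_add Cinf_on_UNIV_differentiable)
  then show ?thesis
    using assms by (simp add: lap_def pd_add Cinf_on_UNIV_differentiable Cinf_on_pd sum.distrib)
qed

lemma lap_cmult:
  assumes "Cinf_on UNIV f"
  shows "lap (\<lambda>x. c * f x) x = c * lap f x"
proof -
  have "pd u (\<lambda>x. c * f x) = (\<lambda>x. c * pd u f x)" for u
    using assms by (intro ext pd_cmult Cinf_on_UNIV_differentiable)
  then show ?thesis
    using assms by (simp add: lap_def pd_cmult Cinf_on_UNIV_differentiable Cinf_on_pd sum_distrib_left)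
qed

lemma solid_harm_add: "solid_harm l Y \<Longrightarrow> solid_harm l Z \<Longrightarrow> solid_harm l (\<lambda>x. Y x + Z x)"
  by (auto simp: solid_harm_def lap_add Cinf_on_add algebra_simps)

lemma solid_harm_cmult: "solid_harm l Y \<Longrightarrow> solid_harm l (\<lambda>x. c * Y x)"
  by (auto simp: solid_harm_def lap_cmult Cinf_on_cmult algebra_simps)

lemma solid_harm_zero: "solid_harm l (\<lambda>x. 0)"
  by (auto simp: solid_harm_def lap_def Cinf_on_const pd_const_fun)

lemma solid_harm_differentiable: "solid_harm l Y \<Longrightarrow> Y differentiable at x"
  by (simp add: solid_harm_def Cinf_on_UNIV_differentiable)

lemma solid_harm_euler: "solid_harm l Y \<Longrightarrow> pd x Y x = real l * Y x"
  by (rule euler_homogeneous) (auto simp: solid_harm_def Cinf_on_UNIV_differentiable powr_realpow)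

lemma radial_ext_solid_harm: "solid_harm l Y \<Longrightarrow> radial_ext Y x = inverse (norm x) ^ l * Y x"
  by (simp add: radial_ext_def solid_harm_def)

lemma solid_harm_sphere_Cinf: "solid_harm l Y \<Longrightarrow> Cinf_on (- {0}) (radial_ext Y)"
proof -
  assume Y: "solid_harm l Y"
  have "Cinf_on (- {0}) (\<lambda>x. inverse (norm x) ^ l * Y x)"
    using Y Cinf_on_subset[of UNIV Y]
    by (intro Cinf_on_mult Cinf_on_power Cinf_on_inverse Cinf_on_norm) (auto simp: solid_harm_def)
  then show ?thesis by (simp add: radial_ext_solid_harm[OF Y, abs_def])
qed

lemma inverse_norm_differentiable:
  "x \<noteq> 0 \<Longrightarrow> (\<lambda>x. inverse (norm x) ^ j) differentiable at (x :: 'a::real_inner)"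
  by (intro Cinf_on_differentiable[of "- {0}"] Cinf_on_power Cinf_on_inverse Cinf_on_norm) auto

lemma pd_inverse_norm_power:
  fixes x :: "'a::real_inner"
  assumes "x \<noteq> 0"
  shows "pd u (\<lambda>x. inverse (norm x) ^ j) x = - (real j * ((x \<bullet> u) * inverse (norm x) ^ (j + 2)))"
proof (induction j)
  case (Suc j)
  have d: "(norm :: 'a \<Rightarrow> real) differentiable at x"
    using Cinf_on_differentiable[OF Cinf_on_norm] assms by simp
  have "pd u (\<lambda>x. inverse (norm x)) x = - ((x \<bullet> u) * inverse (norm x) ^ 3)"
    using assms by (simp add: pd_inverse[OF d] pd_norm power3_eq_cube)
  moreover have "pd u (\<lambda>x. inverse (norm x) * inverse (norm x) ^ j) x
      = inverse (norm x) * pd u (\<lambda>x. inverse (norm x) ^ j) x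
        + pd u (\<lambda>x. inverse (norm x)) x * inverse (norm x) ^ j"
    using inverse_norm_differentiable[OF assms, of 1] inverse_norm_differentiable[OF assms, of j]
    by (subst pd_mult) simp_all
  ultimately show ?case using Suc by (simp add: algebra_simps power3_eq_cube)
qed simp

lemma pd_radial_ext_solid_harm:
  fixes x :: "'a::euclidean_space"
  assumes Y: "solid_harm l Y" and "x \<noteq> 0"
  shows "pd u (radial_ext Y) x = inverse (norm x) ^ l * pd u Y x
    + (- real l) * ((x \<bullet> u) * (inverse (norm x) ^ (l + 2) * Y x))"
proof -
  have "pd u (radial_ext Y) x = pd u (\<lambda>x. inverse (norm x) ^ l * Y x) x"
    by (simp add: radial_ext_solid_harm[OF Y, abs_def])
  then show ?thesis
    using assms by (simp add: pd_mult inverse_norm_differentiable solid_harm_differentiable pd_inverse_norm_power)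
qed

lemma inner_differentiable: "(\<lambda>x. x \<bullet> u) differentiable at x"
  by (rule bounded_linear_imp_differentiable) (rule bounded_linear_inner_left)

lemma pd_inner: "pd w (\<lambda>x. x \<bullet> u) x = w \<bullet> u"
  by (rule pd_bounded_linear) (rule bounded_linear_inner_left)

lemma sphere_hess_solid_harm:
  fixes q :: "'a::euclidean_space"
  assumes Y: "solid_harm l Y" and q: "norm q = 1"
  shows "sphere_hess Y q u w = pd w (pd u Y) q - real l * (q \<bullet> w) * pd u Y q
    - real l * ((w \<bullet> u) * Y q + (q \<bullet> u) * pd w Y q - real (l + 2) * (q \<bullet> u) * (q \<bullet> w) * Y q)"
proof -
  have q0: "q \<noteq> 0" using q by auto
  have dY: "Y differentiable at x" "pd u Y differentiable at x" for x
    using Y by (auto simp: solid_harm_def Cinf_on_UNIV_differentiable Cinf_on_pd)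
  note d = dY inverse_norm_differentiable[OF q0] inner_differentiable
  have "pd w (pd u (radial_ext Y)) q = pd w (\<lambda>x. inverse (norm x) ^ l * pd u Y x
      + (- real l) * ((x \<bullet> u) * (inverse (norm x) ^ (l + 2) * Y x))) q"
    using q0 by (intro pd_cong_open[of "- {0}"]) (simp_all add: pd_radial_ext_solid_harm[OF Y])
  also have "\<dots> = pd w (\<lambda>x. inverse (norm x) ^ l * pd u Y x) q
     + pd w (\<lambda>x. (- real l) * ((x \<bullet> u) * (inverse (norm x) ^ (l + 2) * Y x))) q"
    by (intro pd_add differentiable_mult d differentiable_const)
  also have "pd w (\<lambda>x. inverse (norm x) ^ l * pd u Y x) q
     = pd w (pd u Y) q - real l * (q \<bullet> w) * pd u Y q"
    using q by (subst pd_mult[OF d(3) d(2)]) (simp add: pd_inverse_norm_power[OF q0])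
  also have "pd w (\<lambda>x. (- real l) * ((x \<bullet> u) * (inverse (norm x) ^ (l + 2) * Y x))) q
     = - real l * pd w (\<lambda>x. (x \<bullet> u) * (inverse (norm x) ^ (l + 2) * Y x)) q"
    by (intro pd_cmult differentiable_mult d)
  also have "pd w (\<lambda>x. (x \<bullet> u) * (inverse (norm x) ^ (l + 2) * Y x)) q
     = (q \<bullet> u) * pd w (\<lambda>x. inverse (norm x) ^ (l + 2) * Y x) q
       + (w \<bullet> u) * (inverse (norm q) ^ (l + 2) * Y q)"
    by (subst pd_mult) (intro differentiable_mult d, intro differentiable_mult d, simp add: pd_inner)
  also have "pd w (\<lambda>x. inverse (norm x) ^ (l + 2) * Y x) q
     = pd w Y q - real (l + 2) * (q \<bullet> w) * Y q"
    unfolding pd_mult[OF d(3) d(1)] pd_inverse_norm_power[OF q0] using q by simp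
  finally show ?thesis
    by (simp add: sphere_hess_eq q algebra_simps)
qed

text \<open>Trace of the Hessian formula: harmonicity removes the second derivatives of Y, Euler's
  relation turns the mixed terms into multiples of l Y, and the coefficients add up as - 2 l^2 - l N
  + l (l + 2) with N the dimension of the space.\<close>

lemma sphere_lap_solid_harm:
  fixes q :: "'a::euclidean_space"
  assumes Y: "solid_harm l Y" and q: "norm q = 1"
  shows "sphere_lap Y q = - (real l * (real l + real DIM('a) - 2)) * Y q"
proof -
  have e: "(\<Sum>b\<in>Basis. (q \<bullet> b) * pd b Y q) = real l * Y q"
    using pd_euclidean[of Y q q] solid_harm_euler[OF Y] solid_harm_differentiable[OF Y] by simp
  have n: "(\<Sum>b\<in>Basis. (q \<bullet> b) * (q \<bullet> b)) = 1"
    using euclidean_inner[of q q] q by (simp add: norm_eq_1)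
  have h: "(\<Sum>b\<in>Basis. pd b (pd b Y) q) = 0"
    using Y by (simp add: solid_harm_def lap_def)
  have "sphere_lap Y q = (\<Sum>b\<in>Basis. pd b (pd b Y) q
    + (- 2 * real l) * ((q \<bullet> b) * pd b Y q) + (- real l * Y q) * 1
    + (real l * (real l + 2) * Y q) * ((q \<bullet> b) * (q \<bullet> b)))"
    unfolding sphere_lap_def sphere_hess_solid_harm[OF Y q]
    by (rule sum.cong) (auto simp: algebra_simps)
  also have "\<dots> = - (real l * (real l + real DIM('a) - 2)) * Y q"
    unfolding sum.distrib sum_distrib_left[symmetric] e n h by (simp add: algebra_simps)
  finally show ?thesis .
qed

section \<open>Orthogonality of the eigenspaces\<close>

lemma borel_measurable_punctured:
  "continuous_on (- {0::'a::euclidean_space}) f \<Longrightarrow> (f :: 'a \<Rightarrow> real) \<in> borel_measurable borel"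
  by (rule borel_measurable_continuous_countable_exceptions[of "{0}"]) auto

lemma continuous_on_radial_ext:
  "continuous_on (sphere 0 1) f \<Longrightarrow> continuous_on (- {0}) (radial_ext f)"
  unfolding radial_ext_def
  by (rule continuous_on_compose2[of "sphere 0 1" f])
    (auto intro!: continuous_intros simp: field_simps split: if_splits)

lemma integrable_radial_ext:
  fixes f :: "'a::euclidean_space \<Rightarrow> real"
  assumes "continuous_on (sphere 0 1) f"
  shows "set_integrable lborel (ball 0 1) (\<lambda>x. f (x /\<^sub>R norm x))"
proof -
  have "bounded (f ` sphere 0 1)"
    by (intro compact_imp_bounded compact_continuous_image assms) simp
  then obtain C where C: "\<And>x. norm x = 1 \<Longrightarrow> \<bar>f x\<bar> \<le> C"
    by (force simp: bounded_iff)
  have m: "(\<lambda>x. f (x /\<^sub>R norm x)) \<in> borel_measurable borel"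
    using borel_measurable_punctured[OF continuous_on_radial_ext[OF assms]]
    by (simp add: radial_ext_def[abs_def])
  \<comment> \<open>At the origin \<open>x /\<^sub>R norm x\<close> is 0, so the dominating constant
    must also cover the value \<open>f 0\<close>.\<close>
  have "integrable lborel (\<lambda>x. indicator (ball (0::'a) 1) x *\<^sub>R max C \<bar>f 0\<bar>)"
    using emeasure_lborel_ball_finite[of "0::'a" 1]
    by (intro integrable_scaleR_left integrable_real_indicator) simp_all
  then show ?thesis
    unfolding set_integrable_def
  proof (rule Bochner_Integration.integrable_bound)
    show "AE x in lborel. norm (indicat_real (ball 0 1) x *\<^sub>R f (x /\<^sub>R norm x))
        \<le> norm (indicat_real (ball 0 1) x *\<^sub>R max C \<bar>f 0\<bar>)"
    proof (rule AE_I2)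
      fix x :: 'a
      show "norm (indicat_real (ball 0 1) x *\<^sub>R f (x /\<^sub>R norm x))
        \<le> norm (indicat_real (ball 0 1) x *\<^sub>R max C \<bar>f 0\<bar>)"
        using C[of "x /\<^sub>R norm x"] by (cases "x = 0") (auto simp: indicator_def)
    qed
  qed (use m in \<open>auto intro!: borel_measurable_times borel_measurable_indicator\<close>)
qed

lemma sphere_integral_cong:
  fixes f g :: "'a::euclidean_space \<Rightarrow> real"
  assumes "\<And>x. norm x = 1 \<Longrightarrow> f x = g x" "continuous_on (sphere 0 1) f"
  shows "sphere_integral f = sphere_integral g"
proof -
  have g: "continuous_on (sphere 0 1) g"
    using continuous_on_eq[OF assms(2), of g] assms(1) by simp
  have mf: "(\<lambda>x. f (x /\<^sub>R norm x)) \<in> borel_measurable borel"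
    using borel_measurable_punctured[OF continuous_on_radial_ext[OF assms(2)]]
    by (simp add: radial_ext_def[abs_def])
  have mg: "(\<lambda>x. g (x /\<^sub>R norm x)) \<in> borel_measurable borel"
    using borel_measurable_punctured[OF continuous_on_radial_ext[OF g]]
    by (simp add: radial_ext_def[abs_def])
  have "(LINT x:ball 0 1|lborel. f (x /\<^sub>R norm x)) = (LINT x:ball 0 1|lborel. g (x /\<^sub>R norm x))"
    unfolding set_lebesgue_integral_def
  proof (rule integral_cong_AE)
    have "AE x in lborel. x \<noteq> (0::'a)"
      by (rule AE_lborel_singleton)
    then show "AE x in lborel. indicat_real (ball 0 1) x *\<^sub>R f (x /\<^sub>R norm x)
        = indicat_real (ball 0 1) x *\<^sub>R g (x /\<^sub>R norm x)"
      by eventually_elim (simp add: assms(1))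
  qed (use mf mg in \<open>auto intro!: borel_measurable_times borel_measurable_indicator\<close>)
  then show ?thesis by (simp add: sphere_integral_def)
qed

lemma sphere_integral_sum:
  fixes f :: "'i \<Rightarrow> 'a::euclidean_space \<Rightarrow> real"
  assumes "\<And>i. i \<in> I \<Longrightarrow> continuous_on (sphere 0 1) (f i)"
  shows "sphere_integral (\<lambda>x. \<Sum>i\<in>I. f i x) = (\<Sum>i\<in>I. sphere_integral (f i))"
proof -
  have "(LINT x:ball 0 1|lborel. (\<Sum>i\<in>I. f i (x /\<^sub>R norm x)))
      = (\<Sum>i\<in>I. LINT x:ball 0 1|lborel. f i (x /\<^sub>R norm x))"
    using integrable_radial_ext[OF assms]
    by (simp add: set_lebesgue_integral_def set_integrable_def sum_distrib_left)
  then show ?thesis by (simp add: sphere_integral_def sum_distrib_left)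
qed

text \<open>Difference quotients have integral zero by translation invariance of Lebesgue measure;
  the mean value theorem supplies a dominating function for the passage to the derivative.\<close>

lemma integral_pd_compact_support:
  fixes f :: "'a::euclidean_space \<Rightarrow> real"
  assumes d: "\<And>x. f differentiable at x" and c: "continuous_on UNIV (pd b f)"
    and supp: "\<And>x. norm x \<ge> 1 \<Longrightarrow> f x = 0"
  shows "(LINT x|lborel. pd b f x) = 0"
proof -
  \<comment> \<open>The divisor keeps every shift \<open>t k *\<^sub>R b\<close> of length at most
    1, also for b = 0. So all quotients vanish outside radius 2, and the intermediate points of the
    mean value theorem stay within radius 3.\<close>
  define t where "t k = inverse (real (Suc k)) / (1 + norm b)" for k
  have t: "t k > 0" "t k * norm b \<le> 1" for k
  proof -
    show "t k > 0" by (simp add: t_def add_pos_nonneg)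
    have "t k * norm b \<le> (1 / (1 + norm b)) * norm b"
      unfolding t_def by (intro mult_right_mono divide_right_mono) (auto simp: field_simps)
    also have "\<dots> \<le> 1" by (simp add: field_simps add_pos_nonneg)
    finally show "t k * norm b \<le> 1" .
  qed
  have t0: "t \<longlonglongrightarrow> 0"
    unfolding t_def[abs_def] using tendsto_divide[OF LIMSEQ_inverse_real_of_nat tendsto_const, of "1 + norm b"]
    by (simp add: add_nonneg_eq_0_iff)
  define g where "g k x = (f (x + t k *\<^sub>R b) - f x) / t k" for k x
  have fc: "continuous_on S f" for S
    using d by (simp add: continuous_at_imp_continuous_on differentiable_imp_continuous_within)
  have fint: "integrable lborel f"
  proof -
    have "(\<lambda>x. indicator (cball 0 1) x *\<^sub>R f x) = f"
      using supp by (auto simp: indicator_def fun_eq_iff)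
    then show ?thesis
      using borel_integrable_compact[of "cball 0 1" f] fc by simp
  qed
  have shift: "integrable lborel (\<lambda>x. f (x + y)) \<and> (LINT x|lborel. f (x + y)) = (LINT x|lborel. f x)" for y
  proof -
    have m: "(+) y \<in> lborel \<rightarrow>\<^sub>M lborel" by simp
    have "integrable (distr lborel lborel ((+) y)) f"
      using fint lborel_distr_plus[of y] by (simp cong: distr_cong)
    then have 1: "integrable lborel (\<lambda>x. f (y + x))"
      using integrable_distr_eq[OF m, of f] fint by simp
    have "(LINT x|lborel. f (y + x)) = (LINT x|distr lborel lborel ((+) y). f x)"
      using fint by (subst integral_distr[OF m]) auto
    also have "\<dots> = (LINT x|lborel. f x)"
      using lborel_distr_plus[of y] by (simp cong: distr_cong)
    finally show ?thesis using 1 by (simp add: add.commute)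
  qed
  have g0: "(LINT x|lborel. g k x) = 0" for k
    using shift[of "t k *\<^sub>R b"] fint by (simp add: g_def)
  obtain M where M: "\<And>x. norm x \<le> 3 \<Longrightarrow> \<bar>pd b f x\<bar> \<le> M"
  proof -
    have "bounded (pd b f ` cball 0 3)"
      by (intro compact_imp_bounded compact_continuous_image continuous_on_subset[OF c]) auto
    then show ?thesis using that by (force simp: bounded_iff)
  qed
  have "(\<lambda>k. LINT x|lborel. g k x) \<longlonglongrightarrow> (LINT x|lborel. pd b f x)"
  proof (rule integral_dominated_convergence[where w = "\<lambda>x. indicator (cball 0 2) x *\<^sub>R M"])
    show "integrable lborel (\<lambda>x. indicat_real (cball 0 2) x *\<^sub>R M)"
      using borel_integrable_compact[of "cball 0 2" "\<lambda>x. M"] by simp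
    show "AE x in lborel. (\<lambda>k. g k x) \<longlonglongrightarrow> pd b f x"
    proof (rule AE_I2)
      fix x
      have "((\<lambda>s. f (x + s *\<^sub>R b)) has_derivative (\<lambda>h. pd (h *\<^sub>R b) f (x + 0 *\<^sub>R b))) (at 0)"
        by (rule has_derivative_compose[of "\<lambda>s. x + s *\<^sub>R b" "\<lambda>h. h *\<^sub>R b", OF _ has_derivative_pd[OF d]])
          (auto intro!: derivative_eq_intros)
      then have "((\<lambda>s. f (x + s *\<^sub>R b)) has_real_derivative pd b f x) (at 0)"
        by (simp add: has_field_derivative_def pd_arg_scaleR d mult_commute_abs)
      then have lim: "((\<lambda>s. (f (x + s *\<^sub>R b) - f x) / s) \<longlongrightarrow> pd b f x) (at 0)"
        by (simp add: has_field_derivative_iff)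
      show "(\<lambda>k. g k x) \<longlonglongrightarrow> pd b f x"
        unfolding g_def
        by (rule filterlim_compose[OF lim]) (simp add: filterlim_at t0 order_less_imp_not_eq2[OF t(1)])
    qed
    show "AE x in lborel. norm (g k x) \<le> indicat_real (cball 0 2) x *\<^sub>R M" for k
    proof (rule AE_I2)
      fix x
      have tb: "norm (s *\<^sub>R b) \<le> 1" if "0 \<le> s" "s \<le> t k" for s
        using that t[of k] by (simp, meson mult_right_mono norm_ge_zero order_trans)
      show "norm (g k x) \<le> indicat_real (cball 0 2) x *\<^sub>R M"
      proof (cases "norm x \<le> 2")
        case True
        have "\<exists>z>0. z < t k \<and> f (x + t k *\<^sub>R b) - f (x + 0 *\<^sub>R b) = (t k - 0) * pd b f (x + z *\<^sub>R b)"
        proof (rule MVT2[OF t(1)])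
          fix s :: real
          have "((\<lambda>s. f (x + s *\<^sub>R b)) has_derivative (\<lambda>h. pd (h *\<^sub>R b) f (x + s *\<^sub>R b))) (at s)"
            by (rule has_derivative_compose[of "\<lambda>s. x + s *\<^sub>R b" "\<lambda>h. h *\<^sub>R b", OF _ has_derivative_pd[OF d]])
              (auto intro!: derivative_eq_intros)
          then show "((\<lambda>s. f (x + s *\<^sub>R b)) has_real_derivative pd b f (x + s *\<^sub>R b)) (at s)"
            by (simp add: has_field_derivative_def pd_arg_scaleR d mult_commute_abs)
        qed
        then obtain z where z: "0 < z" "z < t k" "f (x + t k *\<^sub>R b) - f x = t k * pd b f (x + z *\<^sub>R b)"
          by auto
        have "norm (x + z *\<^sub>R b) \<le> 3"
          using norm_triangle_ineq[of x "z *\<^sub>R b"] tb[of z] z True by simp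
        then show ?thesis
          using M z True t(1)[of k] by (simp add: g_def)
      next
        case False
        have "norm (x + t k *\<^sub>R b) \<ge> 1"
          using norm_triangle_ineq4[of "x + t k *\<^sub>R b" "t k *\<^sub>R b"] tb[of "t k"] t(1)[of k] False by simp
        then show ?thesis using False supp by (simp add: g_def)
      qed
    qed
    show "pd b f \<in> borel_measurable lborel"
      using borel_measurable_continuous_onI[OF c] by simp
    show "g k \<in> borel_measurable lborel" for k
      using shift[of "t k *\<^sub>R b"] fint unfolding g_def[abs_def] by (intro borel_measurable_integrable) simp
  qed
  then show ?thesis using g0 LIMSEQ_unique by (simp add: LIMSEQ_const_iff)
qed

text \<open>Integration by parts on annuli: \<open>\<omega>(\<bar>x\<bar>\<^sup>2)\<close> is a radial cut-off, whose gradient is orthogonal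
  to the gradients of functions constant along rays.\<close>

lemma green_weighted:
  fixes F G :: "'a::euclidean_space \<Rightarrow> real"
  assumes F: "F \<in> lap_eigenspace \<nu>" and G: "G \<in> lap_eigenspace \<mu>"
    and w: "\<And>s. (\<omega> has_real_derivative \<omega>' s) (at s)" "continuous_on UNIV \<omega>'"
    and w0: "a > 0" "\<And>s. s \<le> a \<Longrightarrow> \<omega> s = 0" "\<And>s. s \<ge> 1 \<Longrightarrow> \<omega> s = 0"
  shows "(\<nu> - \<mu>) * (LINT x|lborel. \<omega> (x \<bullet> x) * inverse (x \<bullet> x) * (radial_ext F x * radial_ext G x)) = 0"
proof -
  let ?F = "radial_ext F" and ?G = "radial_ext G"
  have F2: "Ck_on 2 (- {0}) ?F" and G2: "Ck_on 2 (- {0}) ?G"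
    using F G by (simp_all add: lap_eigenspace_def sphere_Ck_iff)
  \<comment> \<open>Second derivatives of a radial extension are homogeneous of degree -2, which
    extends the eigenvalue equation from the sphere to the punctured space with the factor 1 /
    |x|^2.\<close>
  have lapx: "(\<Sum>b\<in>Basis. pd b (pd b (radial_ext H)) x) = - \<kappa> * inverse (x \<bullet> x) * radial_ext H x"
    if H: "H \<in> lap_eigenspace \<kappa>" and x: "x \<noteq> 0" for H :: "'a \<Rightarrow> real" and \<kappa> x
  proof -
    have H2: "Ck_on 2 (- {0}) (radial_ext H)"
      using H by (simp add: lap_eigenspace_def sphere_Ck_iff)
    define q where "q = x /\<^sub>R norm x"
    have q: "norm q = 1" "x = norm x *\<^sub>R q" "q \<noteq> 0" using x by (auto simp: q_def)
    have "(\<Sum>b\<in>Basis. pd b (pd b (radial_ext H)) x)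
        = inverse ((norm x)\<^sup>2) * (\<Sum>b\<in>Basis. pd b (pd b (radial_ext H)) q)"
      unfolding sum_distrib_left
    proof (rule sum.cong[OF refl])
      fix b
      show "pd b (pd b (radial_ext H)) x = inverse ((norm x)\<^sup>2) * pd b (pd b (radial_ext H)) q"
        using pd_pd_radial_ext_scaleR[OF H2 q(3), of "norm x" b b] q(2) x by simp
    qed
    also have "(\<Sum>b\<in>Basis. pd b (pd b (radial_ext H)) q) = - \<kappa> * H q"
    proof -
      have "- sphere_lap H q = \<kappa> * H q" using H q(1) by (simp add: lap_eigenspace_def)
      then show ?thesis by (simp add: sphere_lap_eq)
    qed
    also have "H q = radial_ext H x" by (simp add: radial_ext_def q_def)
    finally show ?thesis by (simp add: dot_square_norm)
  qed
  have nz: "\<omega> (x \<bullet> x) = 0" if "x \<bullet> x < a \<or> norm x \<ge> 1" for x :: 'a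
    using that
  proof
    assume "norm x \<ge> 1"
    then have "1 \<le> x \<bullet> x" by (simp add: dot_square_norm)
    then show ?thesis by (rule w0)
  qed (simp add: w0(2))
  \<comment> \<open>\<open>P\<close> is a component of the flux \<omega> (F grad G - G grad F), and
    \<open>Q\<close> is its derivative away from the origin.\<close>
  define P where "P b x = \<omega> (x \<bullet> x) * (?F x * pd b ?G x - ?G x * pd b ?F x)" for b x
  define Q where "Q b x = \<omega> (x \<bullet> x) * (?F x * pd b (pd b ?G) x - ?G x * pd b (pd b ?F) x)
      + \<omega>' (x \<bullet> x) * (2 * (x \<bullet> b)) * (?F x * pd b ?G x - ?G x * pd b ?F x)" for b x
  \<comment> \<open>Near the origin the weight vanishes, so the flux is zero there and the
    singularity of the radial extensions does no harm.\<close>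
  define U where "U = {x::'a. x \<bullet> x < a}"
  have opU: "open U" unfolding U_def by (intro open_Collect_less continuous_intros)
  have cov: "U \<union> - {0} = UNIV" using w0(1) by (auto simp: U_def)
  have dw: "((\<lambda>x. \<omega> (x \<bullet> x)) has_derivative (\<lambda>h. \<omega>' (x \<bullet> x) * (2 * (x \<bullet> h)))) (at x)" for x :: 'a
  proof -
    have "((\<lambda>x. x \<bullet> x) has_derivative (\<lambda>h. 2 * (x \<bullet> h))) (at x)"
      by (auto intro!: derivative_eq_intros simp: inner_commute)
    moreover have "(\<omega> has_derivative (*) (\<omega>' (x \<bullet> x))) (at (x \<bullet> x))"
      using w(1)[of "x \<bullet> x"] by (simp add: has_field_derivative_def)
    ultimately show ?thesis by (rule has_derivative_compose)
  qed
  have dF: "?F differentiable at x" "?G differentiable at x"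
    "pd b ?F differentiable at x" "pd b ?G differentiable at x" if "x \<noteq> 0" for b x
    using that F2 G2 radial_ext_differentiable[of 1] radial_ext_pd_differentiable
    by (auto simp: numeral_2_eq_2)
  have PQ: "P b differentiable at x \<and> pd b (P b) x = (if x = 0 then 0 else Q b x)" for b x
  proof (cases "x = 0")
    case True
    have "P b y = 0" if "y \<in> U" for y using that nz by (simp add: U_def P_def)
    then have "(P b has_derivative (\<lambda>h. 0)) (at 0)"
      using has_derivative_transform_within_open[of "\<lambda>x. 0" "\<lambda>h. 0" 0 UNIV U "P b"] opU w0(1)
      by (auto simp: U_def)
    then show ?thesis using True by (simp add: differentiableI pd_eq)
  next
    case False
    have "(P b has_derivative (\<lambda>h. \<omega> (x \<bullet> x) * ((?F x * pd h (pd b ?G) x + pd h ?F x * pd b ?G x)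
        - (?G x * pd h (pd b ?F) x + pd h ?G x * pd b ?F x))
       + \<omega>' (x \<bullet> x) * (2 * (x \<bullet> h)) * (?F x * pd b ?G x - ?G x * pd b ?F x))) (at x)"
      unfolding P_def
      by (intro has_derivative_mult has_derivative_diff dw has_derivative_pd dF False)
    then show ?thesis using False pd_eq[of "P b" _ x b]
      by (auto simp: differentiable_def Q_def algebra_simps)
  qed
  have cQ: "continuous_on UNIV (pd b (P b))" for b
  proof -
    have "continuous_on (- {0}) (Q b)"
    proof -
      have c: "continuous_on (- {0}) ?F" "continuous_on (- {0}) ?G"
        "continuous_on (- {0}) (pd b ?F)" "continuous_on (- {0}) (pd b ?G)"
        "continuous_on (- {0}) (pd b (pd b ?F))" "continuous_on (- {0}) (pd b (pd b ?G))"
        using F2 G2 by (auto simp: numeral_2_eq_2 Ck_on_Suc differentiable_imp_continuous_on)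
      have "continuous_on UNIV \<omega>" using w(1) DERIV_continuous_on has_field_derivative_at_within by metis
      then have c': "continuous_on (- {0}) (\<lambda>x::'a. \<omega> (x \<bullet> x))" "continuous_on (- {0}) (\<lambda>x::'a. \<omega>' (x \<bullet> x))"
        using w(2) by (auto intro!: continuous_on_compose2[of UNIV _ "- {0}" "\<lambda>x::'a. x \<bullet> x"] continuous_intros)
      show ?thesis unfolding Q_def by (intro continuous_intros c c')
    qed
    then have 1: "continuous_on (- {0}) (pd b (P b))"
      by (rule continuous_on_eq) (simp add: PQ)
    have "pd b (P b) x = 0" if "x \<in> U" for x
    proof -
      have "P b y = 0" if "y \<in> U" for y using that nz by (simp add: U_def P_def)
      then have "pd b (P b) x = pd b (\<lambda>x. 0) x" using opU that by (intro pd_cong_open[of U]) auto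
      then show ?thesis by simp
    qed
    then have 2: "continuous_on U (pd b (P b))" by (simp cong: continuous_on_cong)
    show ?thesis using continuous_on_open_Un[OF opU open_minus_zero 2 1] cov by simp
  qed
  have "(LINT x|lborel. pd b (P b) x) = 0" for b
    by (rule integral_pd_compact_support) (use PQ cQ nz in \<open>auto simp: P_def\<close>)
  moreover have "integrable lborel (pd b (P b))" for b
  proof -
    have "pd b (P b) x = 0" if "norm x > 1" for x
    proof -
      have op: "open {x::'a. norm x > 1}" by (intro open_Collect_less continuous_intros)
      have "pd b (P b) x = pd b (\<lambda>x. 0) x"
        using op that nz by (intro pd_cong_open[of "{x. norm x > 1}"]) (auto simp: P_def)
      then show ?thesis by simp
    qed
    then have "(\<lambda>x. indicator (cball 0 1) x *\<^sub>R pd b (P b) x) = pd b (P b)"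
      by (force simp: indicator_def fun_eq_iff)
    then show ?thesis
      using borel_integrable_compact[of "cball 0 1" "pd b (P b)"] continuous_on_subset[OF cQ] by simp
  qed
  ultimately have "(LINT x|lborel. (\<Sum>b\<in>Basis. pd b (P b) x)) = 0" by simp
  moreover have "(\<Sum>b\<in>Basis. pd b (P b) x)
      = (\<nu> - \<mu>) * (\<omega> (x \<bullet> x) * inverse (x \<bullet> x) * (?F x * ?G x))" for x
  proof (cases "x = 0")
    case True
    then show ?thesis using PQ nz[of 0] w0(1) by simp
  next
    case False
    \<comment> \<open>The gradient of the weight is radial and radial derivatives of F and G vanish,
      so the terms with \<omega>' drop out of the divergence.\<close>
    have rad: "(\<Sum>b\<in>Basis. (x \<bullet> b) * pd b ?F x) = 0" "(\<Sum>b\<in>Basis. (x \<bullet> b) * pd b ?G x) = 0"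
      using pd_euclidean[of ?F x x] pd_euclidean[of ?G x x] dF False
        pd_radial_ext_radial[of 1 F x] pd_radial_ext_radial[of 1 G x] F2 G2
      by (simp_all add: numeral_2_eq_2)
    have "(\<Sum>b\<in>Basis. pd b (P b) x) = (\<Sum>b\<in>Basis.
        \<omega> (x \<bullet> x) * (?F x * pd b (pd b ?G) x) - \<omega> (x \<bullet> x) * (?G x * pd b (pd b ?F) x)
      + (2 * \<omega>' (x \<bullet> x) * ?F x * ((x \<bullet> b) * pd b ?G x) - 2 * \<omega>' (x \<bullet> x) * ?G x * ((x \<bullet> b) * pd b ?F x)))"
      using PQ False by (intro sum.cong) (auto simp: Q_def algebra_simps)
    also have "\<dots> = \<omega> (x \<bullet> x) * (?F x * (\<Sum>b\<in>Basis. pd b (pd b ?G) x))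
        - \<omega> (x \<bullet> x) * (?G x * (\<Sum>b\<in>Basis. pd b (pd b ?F) x))"
      unfolding sum.distrib sum_subtractf sum_distrib_left[symmetric] rad by simp
    also have "\<dots> = (\<nu> - \<mu>) * (\<omega> (x \<bullet> x) * inverse (x \<bullet> x) * (?F x * ?G x))"
      unfolding lapx[OF F False] lapx[OF G False] by (simp add: algebra_simps)
    finally show ?thesis .
  qed
  ultimately show ?thesis by simp
qed

text \<open>\<open>green_weighted\<close> is applied to the weights s \<psi>(s): the factor s
  cancels the 1 / |x|^2, and as the cut-offs \<psi> tend to 1 inside the ball the integrals tend to
  the ball integral that defines \<open>sphere_integral\<close>.\<close>

lemma eigenfunctions_orthogonal:
  fixes F G :: "'a::euclidean_space \<Rightarrow> real"
  assumes F: "F \<in> lap_eigenspace \<nu>" and G: "G \<in> lap_eigenspace \<mu>" and ne: "\<nu> \<noteq> \<mu>"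
  shows "sphere_integral (\<lambda>x. F x * G x) = 0"
proof -
  let ?H = "\<lambda>x. radial_ext F x * radial_ext G x"
  have F2: "Ck_on 2 (- {0}) (radial_ext F)" and G2: "Ck_on 2 (- {0}) (radial_ext G)"
    using F G by (simp_all add: lap_eigenspace_def sphere_Ck_iff)
  have cH: "continuous_on (- {0}) ?H"
    using F2 G2 by (intro continuous_intros) (simp_all add: Ck_on_continuous)
  have mH: "?H \<in> borel_measurable borel" by (rule borel_measurable_punctured[OF cH])
  have cont: "continuous_on (sphere 0 1) (\<lambda>x. F x * G x)"
  proof -
    have "continuous_on (sphere 0 1) ?H" by (rule continuous_on_subset[OF cH]) auto
    then show ?thesis by (rule continuous_on_eq) simp
  qed
  then have int: "integrable lborel (\<lambda>x. indicator (ball 0 1) x *\<^sub>R ?H x)"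
    using integrable_radial_ext[OF cont] by (simp add: set_integrable_def radial_ext_def)
  \<comment> \<open>The squared positive part is a C^1 function with an explicit derivative, enough
    regularity for the weights.\<close>
  define m where "m t = (max 0 t)\<^sup>2" for t :: real
  have m: "(m has_real_derivative 2 * max 0 t) (at t)" for t
  proof -
    consider "t < 0" | "t = 0" | "t > 0" by linarith
    then show ?thesis
    proof cases
      case 1
      have "((\<lambda>t. 0) has_real_derivative 2 * max 0 t) (at t)" using 1 by simp
      then show ?thesis
        by (rule has_field_derivative_transform_within_open[of _ _ _ "{..<0}"]) (use 1 in \<open>auto simp: m_def\<close>)
    next
      case 2
      have "((\<lambda>h. (m (0 + h) - m 0) / h) \<longlongrightarrow> 0) (at 0)"
      proof (rule Lim_null_comparison[of _ "\<lambda>h. \<bar>h\<bar>"])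
        show "\<forall>\<^sub>F h in at 0. norm ((m (0 + h) - m 0) / h) \<le> \<bar>h\<bar>"
          by (rule always_eventually) (auto simp: m_def max_def power2_eq_square abs_mult)
        show "((\<lambda>h::real. \<bar>h\<bar>) \<longlongrightarrow> 0) (at 0)" by (auto intro!: tendsto_eq_intros)
      qed
      then show ?thesis using 2 by (simp add: DERIV_def)
    next
      case 3
      have "((\<lambda>t. t\<^sup>2) has_real_derivative 2 * max 0 t) (at t)"
        using 3 by (auto intro!: derivative_eq_intros)
      then show ?thesis
        by (rule has_field_derivative_transform_within_open[of _ _ _ "{0<..}"]) (use 3 in \<open>auto simp: m_def\<close>)
    qed
  qed
  have mc: "continuous_on UNIV m" using m DERIV_isCont continuous_at_imp_continuous_on by blast
  have m_ge: "m t \<ge> 0" for t by (simp add: m_def)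
  define e where "e k = inverse (real (Suc k))" for k
  have e: "e k > 0" "e k \<le> 1" for k by (auto simp: e_def field_simps)
  have e0: "e \<longlonglongrightarrow> 0" unfolding e_def using LIMSEQ_inverse_real_of_nat by simp
  \<comment> \<open>The product (s - e)(1 - s) is nonpositive outside the interval from e to 1,
    where \<open>m\<close> kills it. The summand \<open>e k\<close> keeps the denominator positive
    and disappears in the limit.\<close>
  define \<psi> where "\<psi> k s = m ((s - e k) * (1 - s)) / (m ((s - e k) * (1 - s)) + e k)" for k s
  have den: "m t + e k > 0" for t k using m_ge[of t] e(1)[of k] by linarith
  have psi_01: "0 \<le> \<psi> k s" "\<psi> k s \<le> 1" for k s
    using m_ge e(1)[of k] den by (auto simp: \<psi>_def field_simps add_nonneg_pos)
  have psi_0: "\<psi> k s = 0" if "s \<le> e k \<or> s \<ge> 1" for k s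
  proof -
    have "(s - e k) * (1 - s) \<le> 0" using that e[of k] by (auto simp: mult_le_0_iff)
    then show ?thesis by (simp add: \<psi>_def m_def)
  qed
  have psi_lim: "(\<lambda>k. \<psi> k s) \<longlonglongrightarrow> 1" if "0 < s" "s < 1" for s
  proof -
    have "(\<lambda>k. m ((s - e k) * (1 - s))) \<longlonglongrightarrow> m ((s - 0) * (1 - s))"
      using mc e0 by (intro continuous_on_tendsto_compose[of UNIV m] tendsto_intros) auto
    then have "(\<lambda>k. \<psi> k s) \<longlonglongrightarrow> m (s * (1 - s)) / (m (s * (1 - s)) + 0)"
      unfolding \<psi>_def using that e0 by (intro tendsto_intros) (auto simp: m_def)
    then show ?thesis using that by (simp add: m_def)
  qed
  have cc: "continuous_on UNIV (\<lambda>s. m ((s - e k) * (1 - s)))" for k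
    by (rule continuous_on_compose2[OF mc]) (auto intro!: continuous_intros)
  have zero: "(LINT x|lborel. \<psi> k (x \<bullet> x) * ?H x) = 0" for k
  proof -
    define d where "d s = 2 * max 0 ((s - e k) * (1 - s)) * ((1 - s) - (s - e k))" for s
    have dm: "((\<lambda>s. m ((s - e k) * (1 - s))) has_real_derivative d s) (at s)" for s
    proof -
      have "((\<lambda>s. (s - e k) * (1 - s)) has_real_derivative ((1 - s) - (s - e k))) (at s)"
        by (auto intro!: derivative_eq_intros)
      from DERIV_chain2[OF m this] show ?thesis by (simp add: d_def)
    qed
    define \<omega>' where "\<omega>' s = \<psi> k s + s * ((d s * (m ((s - e k) * (1 - s)) + e k)
        - m ((s - e k) * (1 - s)) * d s) / (m ((s - e k) * (1 - s)) + e k)\<^sup>2)" for s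
    have d1: "((\<lambda>s. s * \<psi> k s) has_real_derivative \<omega>' s) (at s)" for s
    proof -
      have "m ((s - e k) * (1 - s)) + e k \<noteq> 0" using den[of "(s - e k) * (1 - s)" k] by simp
      from DERIV_mult[OF DERIV_ident DERIV_divide[OF dm DERIV_add[OF dm DERIV_const] this]]
      show ?thesis unfolding \<psi>_def
        by (rule DERIV_cong) (simp add: \<omega>'_def \<psi>_def power2_eq_square)
    qed
    have d2: "continuous_on UNIV \<omega>'"
      unfolding \<omega>'_def \<psi>_def d_def using den[of _ k]
      by (intro continuous_intros cc) (auto simp: less_imp_neq[symmetric] order_less_imp_not_eq2)
    have "(\<nu> - \<mu>) * (LINT x|lborel. ((x \<bullet> x) * \<psi> k (x \<bullet> x)) * inverse (x \<bullet> x) * ?H x) = 0"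
      by (rule green_weighted[OF F G d1 d2 e(1)[of k]]) (simp_all add: psi_0)
    then have "(LINT x|lborel. ((x \<bullet> x) * \<psi> k (x \<bullet> x)) * inverse (x \<bullet> x) * ?H x) = 0"
      using ne by simp
    moreover have "((x \<bullet> x) * \<psi> k (x \<bullet> x)) * inverse (x \<bullet> x) * ?H x = \<psi> k (x \<bullet> x) * ?H x" for x :: 'a
      using psi_0[of 0 k] e(1)[of k] by (cases "x = 0") auto
    ultimately show ?thesis by simp
  qed
  have "(\<lambda>k. LINT x|lborel. \<psi> k (x \<bullet> x) * ?H x) \<longlonglongrightarrow> (LINT x|lborel. indicator (ball 0 1) x *\<^sub>R ?H x)"
  proof (rule integral_dominated_convergence[where w = "\<lambda>x. norm (indicator (ball 0 1) x *\<^sub>R ?H x)"])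
    show "integrable lborel (\<lambda>x. norm (indicat_real (ball 0 1) x *\<^sub>R ?H x))" using int by simp
    have ball: "x \<bullet> x < 1 \<longleftrightarrow> norm x < 1" for x :: 'a
      by (simp add: dot_square_norm power_less_one_iff)
    have "AE x in lborel. x \<noteq> (0::'a)" by (rule AE_lborel_singleton)
    then show "AE x in lborel. (\<lambda>k. \<psi> k (x \<bullet> x) * ?H x) \<longlonglongrightarrow> indicat_real (ball 0 1) x *\<^sub>R ?H x"
    proof eventually_elim
      case (elim x)
      show ?case
      proof (cases "norm x < 1")
        case True
        then have "(\<lambda>k. \<psi> k (x \<bullet> x) * ?H x) \<longlonglongrightarrow> 1 * ?H x"
          using elim ball[of x] by (intro tendsto_mult psi_lim tendsto_const) auto
        then show ?thesis using True by simp
      next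
        case False
        then show ?thesis using psi_0[of "x \<bullet> x"] ball[of x] by (simp add: not_less)
      qed
    qed
    show "AE x in lborel. norm (\<psi> k (x \<bullet> x) * ?H x) \<le> norm (indicat_real (ball 0 1) x *\<^sub>R ?H x)" for k
    proof (rule AE_I2)
      fix x :: 'a
      show "norm (\<psi> k (x \<bullet> x) * ?H x) \<le> norm (indicat_real (ball 0 1) x *\<^sub>R ?H x)"
        using psi_01[of k "x \<bullet> x"] psi_0[of "x \<bullet> x" k] ball[of x]
        by (cases "norm x < 1") (auto simp: abs_mult not_less intro!: mult_left_le_one_le)
    qed
    have "continuous_on UNIV (\<psi> k)" for k
      unfolding \<psi>_def
      by (rule continuous_on_divide[OF cc continuous_on_add[OF cc continuous_on_const]])
        (simp add: order_less_imp_not_eq2[OF den])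
    then have "(\<lambda>x::'a. \<psi> k (x \<bullet> x)) \<in> borel_measurable borel" for k
      by (intro borel_measurable_continuous_onI)
        (rule continuous_on_compose2[of UNIV "\<psi> k"], auto intro!: continuous_intros)
    then show "(\<lambda>x. \<psi> k (x \<bullet> x) * ?H x) \<in> borel_measurable lborel" for k
      using mH by simp
    show "(\<lambda>x. indicat_real (ball 0 1) x *\<^sub>R ?H x) \<in> borel_measurable lborel"
      using int by simp
  qed
  then have "(LINT x|lborel. indicator (ball 0 1) x *\<^sub>R ?H x) = 0"
    using zero LIMSEQ_unique by (simp add: LIMSEQ_const_iff)
  then show ?thesis by (simp add: sphere_integral_def set_lebesgue_integral_def radial_ext_def)
qed

section \<open>The operator \<open>P\<^sub>\<sigma>\<close> on finite sums of spherical harmonics\<close>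

definition sph_eig :: "nat \<Rightarrow> nat \<Rightarrow> real" where
  "sph_eig n l = real l * (real l + real n - 1)"

text \<open>The quotient Gamma(l + n - 1) / Gamma(l + 1), which is a polynomial in l because the two
  arguments differ by the integer n - 2.\<close>

definition P_eig :: "nat \<Rightarrow> nat \<Rightarrow> real" where
  "P_eig n l = pochhammer (real l + 1) (n - 2)"

text \<open>Records f as the image of v under the operator together with a decomposition into
  harmonics; carrying the decomposition makes sums and multiples of pairs immediate.\<close>

definition P_pair :: "nat \<Rightarrow> ('a::euclidean_space \<Rightarrow> real) \<Rightarrow> ('a \<Rightarrow> real) \<Rightarrow> bool" where
  "P_pair n v f \<longleftrightarrow> (\<exists>L Y. (\<forall>l. solid_harm l (Y l)) \<and>
     v = (\<lambda>x. \<Sum>l\<le>L. Y l x) \<and> f = (\<lambda>x. \<Sum>l\<le>L. P_eig n l * Y l x))"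

lemma P_pair_solid_harm:
  assumes "solid_harm l Y"
  shows "P_pair n Y (\<lambda>x. P_eig n l * Y x)"
proof -
  define Z where "Z j = (if j = l then Y else (\<lambda>x. 0))" for j
  have "Y = (\<lambda>x. \<Sum>j\<le>l. Z j x)" "(\<lambda>x. P_eig n l * Y x) = (\<lambda>x. \<Sum>j\<le>l. P_eig n j * Z j x)"
    by (auto simp: Z_def fun_eq_iff if_distrib[of "\<lambda>f. f _"] if_distrib[of "\<lambda>t. _ * t"] sum.delta cong: if_cong)
  moreover have "solid_harm j (Z j)" for j
    using assms by (simp add: Z_def solid_harm_zero)
  ultimately show ?thesis unfolding P_pair_def by (intro exI[of _ l] exI[of _ Z]) auto
qed

text \<open>Padding with zero harmonics lets two pairs be written with a common bound on the
  degree.\<close>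

lemma P_pair_truncation:
  assumes "P_pair n v f"
  obtains L Y where "\<And>l. solid_harm l (Y l)" "\<And>l. l > L \<Longrightarrow> Y l = (\<lambda>x. 0)"
    "\<And>M x. M \<ge> L \<Longrightarrow> v x = (\<Sum>l\<le>M. Y l x)" "\<And>M x. M \<ge> L \<Longrightarrow> f x = (\<Sum>l\<le>M. P_eig n l * Y l x)"
proof -
  obtain L Y where Y: "\<And>l. solid_harm l (Y l)" "v = (\<lambda>x. \<Sum>l\<le>L. Y l x)" "f = (\<lambda>x. \<Sum>l\<le>L. P_eig n l * Y l x)"
    using assms by (auto simp: P_pair_def)
  define Z where "Z l = (if l \<le> L then Y l else (\<lambda>x. 0))" for l
  show ?thesis
  proof (rule that[of Z L])
    show "solid_harm l (Z l)" for l using Y by (simp add: Z_def solid_harm_zero)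
    show "v x = (\<Sum>l\<le>M. Z l x)" "f x = (\<Sum>l\<le>M. P_eig n l * Z l x)" if "M \<ge> L" for M x
      unfolding Y(2,3) using that by (auto intro!: sum.mono_neutral_cong_left simp: Z_def split: if_splits)
  qed (simp add: Z_def)
qed

lemma P_pair_add:
  assumes "P_pair n v f" "P_pair n w g"
  shows "P_pair n (\<lambda>x. v x + w x) (\<lambda>x. f x + g x)"
proof -
  obtain L Y where Y: "\<And>l. solid_harm l (Y l)"
    "\<And>M x. M \<ge> L \<Longrightarrow> v x = (\<Sum>l\<le>M. Y l x)" "\<And>M x. M \<ge> L \<Longrightarrow> f x = (\<Sum>l\<le>M. P_eig n l * Y l x)"
    using P_pair_truncation[OF assms(1)] by metis
  obtain J Z where Z: "\<And>l. solid_harm l (Z l)"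
    "\<And>M x. M \<ge> J \<Longrightarrow> w x = (\<Sum>l\<le>M. Z l x)" "\<And>M x. M \<ge> J \<Longrightarrow> g x = (\<Sum>l\<le>M. P_eig n l * Z l x)"
    using P_pair_truncation[OF assms(2)] by metis
  show ?thesis unfolding P_pair_def
    using Y(2,3)[of "max L J"] Z(2,3)[of "max L J"] Y(1) Z(1)
    by (intro exI[of _ "max L J"] exI[of _ "\<lambda>l x. Y l x + Z l x"])
      (auto simp: fun_eq_iff sum.distrib algebra_simps solid_harm_add)
qed

lemma P_pair_cmult:
  assumes "P_pair n v f" shows "P_pair n (\<lambda>x. c * v x) (\<lambda>x. c * f x)"
proof -
  obtain L Y where "\<And>l. solid_harm l (Y l)" "v = (\<lambda>x. \<Sum>l\<le>L. Y l x)" "f = (\<lambda>x. \<Sum>l\<le>L. P_eig n l * Y l x)"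
    using assms by (auto simp: P_pair_def)
  then show ?thesis unfolding P_pair_def
    by (intro exI[of _ L] exI[of _ "\<lambda>l x. c * Y l x"])
      (auto simp: fun_eq_iff sum_distrib_left algebra_simps solid_harm_cmult)
qed

lemma P_pair_zero: "P_pair n (\<lambda>x. 0) (\<lambda>x. 0)"
  using P_pair_solid_harm[OF solid_harm_zero, of n 0] by simp

lemma P_pair_sum:
  "(\<And>i. i \<in> I \<Longrightarrow> P_pair n (v i) (f i)) \<Longrightarrow> P_pair n (\<lambda>x. \<Sum>i\<in>I. v i x) (\<lambda>x. \<Sum>i\<in>I. f i x)"
  by (induction I rule: infinite_finite_induct) (auto simp: P_pair_zero P_pair_add)

lemma Cinf_on_radial_ext_sum:
  assumes "\<And>i. i \<in> I \<Longrightarrow> Cinf_on (- {0}) (radial_ext (f i))"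
  shows "Cinf_on (- {0}) (radial_ext (\<lambda>x. \<Sum>i\<in>I. f i x))"
  using Cinf_on_sum[OF open_minus_zero, of I "\<lambda>i. radial_ext (f i)"] assms
  by (simp add: radial_ext_def[abs_def])

lemma P_pair_Cinf:
  assumes "P_pair n v f"
  shows "Cinf_on (- {0}) (radial_ext v)" "Cinf_on (- {0}) (radial_ext f)"
proof -
  obtain L Y where Y: "\<And>l. solid_harm l (Y l)" "v = (\<lambda>x. \<Sum>l\<le>L. Y l x)" "f = (\<lambda>x. \<Sum>l\<le>L. P_eig n l * Y l x)"
    using assms by (auto simp: P_pair_def)
  show "Cinf_on (- {0}) (radial_ext v)"
    unfolding Y(2) by (rule Cinf_on_radial_ext_sum) (rule solid_harm_sphere_Cinf[OF Y(1)])
  show "Cinf_on (- {0}) (radial_ext f)"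
    unfolding Y(3)
    by (rule Cinf_on_radial_ext_sum) (rule solid_harm_sphere_Cinf[OF solid_harm_cmult[OF Y(1)]])
qed

lemma solid_harm_eigenspace:
  fixes Y :: "'a::euclidean_space \<Rightarrow> real"
  assumes "solid_harm l Y" "DIM('a) = n + 1"
  shows "Y \<in> lap_eigenspace (sph_eig n l)"
  using assms solid_harm_sphere_Cinf[OF assms(1)]
  by (auto simp: lap_eigenspace_def sphere_Ck_iff sphere_lap_solid_harm sph_eig_def Cinf_on_Ck_on)

lemma sph_eig_inj:
  assumes "n \<ge> 1" "sph_eig n l = sph_eig n j" shows "l = j"
proof -
  have "strict_mono (sph_eig n)"
  proof (rule strict_monoI_Suc)
    fix i show "sph_eig n i < sph_eig n (Suc i)"
      using assms(1) by (simp add: sph_eig_def algebra_simps)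
  qed
  then show ?thesis using assms(2) by (simp add: strict_mono_eq)
qed

text \<open>Completing the square gives B = l + (n - 1) / 2 on degree l, and \<sigma> = n / 2 - 1
  turns the Gamma arguments into l + n - 1 and l + 1.\<close>

lemma P_symbol_sph_eig:
  assumes n: "n \<ge> 2" and \<sigma>: "real n = 2 * \<sigma> + 2"
  shows "P_symbol n \<sigma> (sph_eig n l) = P_eig n l"
proof -
  have "sph_eig n l + ((real n - 1) / 2)\<^sup>2 = (real l + (real n - 1) / 2)\<^sup>2"
    by (simp add: sph_eig_def power2_eq_square field_simps)
  moreover have "real l + (real n - 1) / 2 \<ge> 0" using n by simp
  ultimately have b: "sqrt (sph_eig n l + ((real n - 1) / 2)\<^sup>2) = real l + (real n - 1) / 2" by simp
  have e: "real l + (real n - 1) / 2 + 1 / 2 + \<sigma> = (real l + 1) + real (n - 2)"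
    "real l + (real n - 1) / 2 + 1 / 2 - \<sigma> = real l + 1"
    using n \<sigma> by (auto simp: field_simps of_nat_diff)
  have "real l + 1 \<notin> \<int>\<^sub>\<le>\<^sub>0" by (auto elim!: nonpos_Ints_cases)
  then show ?thesis
    unfolding P_symbol_def Let_def b e P_eig_def by (simp add: pochhammer_Gamma)
qed

lemma P_pair_has_P:
  fixes v f w :: "'a::euclidean_space \<Rightarrow> real"
  assumes n: "n \<ge> 2" and \<sigma>: "real n = 2 * \<sigma> + 2" and dim: "DIM('a) = n + 1"
    and vf: "P_pair n v f" and w: "\<And>x. norm x = 1 \<Longrightarrow> w x = f x"
  shows "has_P n \<sigma> v w"
proof -
  obtain L Y where Y: "\<And>l. solid_harm l (Y l)" "v = (\<lambda>x. \<Sum>l\<le>L. Y l x)" "f = (\<lambda>x. \<Sum>l\<le>L. P_eig n l * Y l x)"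
    using vf by (auto simp: P_pair_def)
  have csph: "continuous_on (sphere 0 1) g" if "Cinf_on (- {0}) (radial_ext g)" for g :: "'a \<Rightarrow> real"
    by (rule continuous_on_eq[OF continuous_on_subset[OF Cinf_on_continuous[OF that]]]) auto
  have cY: "continuous_on (sphere 0 1) (Y l)" for l
    by (rule csph[OF solid_harm_sphere_Cinf[OF Y(1)]])
  have cw: "continuous_on (sphere 0 1) w"
    by (rule continuous_on_eq[OF csph[OF P_pair_Cinf(2)[OF vf]]]) (simp add: w)
  \<comment> \<open>At most one degree has eigenvalue \<nu>, so the projection
    \<open>p \<nu>\<close> is a single harmonic or zero.\<close>
  define I where "I \<nu> = {l. l \<le> L \<and> sph_eig n l = \<nu>}" for \<nu>
  have I_cases: "I \<nu> = {} \<or> (\<exists>l\<le>L. sph_eig n l = \<nu> \<and> I \<nu> = {l})" for \<nu>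
  proof (cases "I \<nu> = {}")
    case False
    then obtain l where "l \<le> L" "sph_eig n l = \<nu>" by (auto simp: I_def)
    moreover from this have "I \<nu> = {l}" using sph_eig_inj[of n] n by (force simp: I_def)
    ultimately show ?thesis by blast
  qed simp
  define p where "p \<nu> = (\<lambda>x. \<Sum>l\<in>I \<nu>. Y l x)" for \<nu>
  have zero_eig: "(\<lambda>x::'a. 0) \<in> lap_eigenspace \<nu>" for \<nu>
  proof -
    have "Cinf_on (- {0}) (radial_ext (\<lambda>x::'a. 0))"
      by (simp add: radial_ext_def[abs_def] Cinf_on_const)
    then show ?thesis
      by (simp add: lap_eigenspace_def sphere_Ck_iff sphere_lap_eq radial_ext_def[abs_def] Cinf_on_Ck_on)
  qed
  have proj: "is_eigenprojection \<nu> v (p \<nu>)" for \<nu>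
    unfolding is_eigenprojection_def
  proof (intro conjI ballI)
    show "p \<nu> \<in> lap_eigenspace \<nu>"
      using I_cases[of \<nu>] zero_eig solid_harm_eigenspace[OF Y(1) dim] by (auto simp: p_def)
    fix Z :: "'a \<Rightarrow> real" assume Z: "Z \<in> lap_eigenspace \<nu>"
    then have "Ck_on 2 (- {0}) (radial_ext Z)" by (simp add: lap_eigenspace_def sphere_Ck_iff)
    then have cZ: "continuous_on (sphere 0 1) Z"
      by (intro continuous_on_eq[OF continuous_on_subset[OF Ck_on_continuous[of 2 "- {0}" "radial_ext Z"]]])
        auto
    have "(v x - p \<nu> x) * Z x = (\<Sum>l\<in>{..L} - I \<nu>. Y l x * Z x)" for x
    proof -
      have "(\<Sum>l\<le>L. Y l x) = (\<Sum>l\<in>{..L} - I \<nu>. Y l x) + (\<Sum>l\<in>I \<nu>. Y l x)"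
        by (rule sum.subset_diff) (auto simp: I_def)
      then show ?thesis by (simp add: Y(2) p_def sum_distrib_right)
    qed
    then have "sphere_integral (\<lambda>x. (v x - p \<nu> x) * Z x)
        = sphere_integral (\<lambda>x. \<Sum>l\<in>{..L} - I \<nu>. Y l x * Z x)" by simp
    also have "\<dots> = (\<Sum>l\<in>{..L} - I \<nu>. sphere_integral (\<lambda>x. Y l x * Z x))"
      by (intro sphere_integral_sum continuous_on_mult cY cZ)
    also have "\<dots> = 0"
    proof (rule sum.neutral, rule ballI)
      fix l assume "l \<in> {..L} - I \<nu>"
      then have "sph_eig n l \<noteq> \<nu>" by (auto simp: I_def)
      then show "sphere_integral (\<lambda>x. Y l x * Z x) = 0"
        by (rule eigenfunctions_orthogonal[OF solid_harm_eigenspace[OF Y(1) dim] Z])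
    qed
    finally show "sphere_integral (\<lambda>x. (v x - p \<nu> x) * Z x) = 0" .
  qed
  let ?E = "lap_eigenvalues TYPE('a)"
  \<comment> \<open>The net is constantly 0 once F contains \<open>F0\<close>. A degree whose
    eigenvalue is missing from \<open>?E\<close> can only carry a harmonic that vanishes on the
    sphere, so it contributes nothing to \<open>w\<close>.\<close>
  define F0 where "F0 = sph_eig n ` {..L} \<inter> ?E"
  have lim: "((\<lambda>F. sphere_integral (\<lambda>x. (w x - (\<Sum>\<nu>\<in>F. P_symbol n \<sigma> \<nu> * p \<nu> x))\<^sup>2)) \<longlongrightarrow> 0)
      (finite_subsets_at_top ?E)"
  proof (rule tendsto_eventually, subst eventually_finite_subsets_at_top, intro exI conjI allI impI)
    show "finite F0" "F0 \<subseteq> ?E" by (auto simp: F0_def)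
    fix F assume F: "finite F \<and> F0 \<subseteq> F \<and> F \<subseteq> ?E"
    have cp: "continuous_on (sphere 0 1) (p \<nu>)" for \<nu>
      unfolding p_def by (intro continuous_intros cY)
    have "w x = (\<Sum>\<nu>\<in>F. P_symbol n \<sigma> \<nu> * p \<nu> x)" if x: "norm x = 1" for x :: 'a
    proof -
      have "(\<Sum>\<nu>\<in>F. P_symbol n \<sigma> \<nu> * p \<nu> x) = (\<Sum>\<nu>\<in>F. \<Sum>l\<in>I \<nu>. P_eig n l * Y l x)"
        unfolding p_def sum_distrib_left
        by (intro sum.cong refl) (auto simp: I_def P_symbol_sph_eig[OF n \<sigma>])
      also have "\<dots> = (\<Sum>l\<in>(\<Union>\<nu>\<in>F. I \<nu>). P_eig n l * Y l x)"
        using F by (intro sum.UNION_disjoint[symmetric]) (auto simp: I_def)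
      also have "\<dots> = (\<Sum>l\<le>L. P_eig n l * Y l x)"
      proof (rule sum.mono_neutral_left)
        show "\<forall>l\<in>{..L} - \<Union> (I ` F). P_eig n l * Y l x = 0"
        proof
          fix l assume l: "l \<in> {..L} - \<Union> (I ` F)"
          then have "sph_eig n l \<notin> ?E" using F by (auto simp: I_def F0_def)
          then have "Y l x = 0"
            using solid_harm_eigenspace[OF Y(1) dim, of l] x by (auto simp: lap_eigenvalues_def)
          then show "P_eig n l * Y l x = 0" by simp
        qed
      qed (auto simp: I_def)
      finally show ?thesis using w[OF x] by (simp add: Y(3))
    qed
    then have "sphere_integral (\<lambda>x. (w x - (\<Sum>\<nu>\<in>F. P_symbol n \<sigma> \<nu> * p \<nu> x))\<^sup>2)
        = sphere_integral (\<lambda>x::'a. 0)"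
      by (intro sphere_integral_cong) (auto intro!: continuous_intros cw cp)
    then show "sphere_integral (\<lambda>x. (w x - (\<Sum>\<nu>\<in>F. P_symbol n \<sigma> \<nu> * p \<nu> x))\<^sup>2) = 0"
      by (simp add: sphere_integral_def)
  qed
  show ?thesis
    unfolding has_P_def has_lap_calculus_def using cw proj lim by blast
qed

text \<open>For a pair with \<open>v, f > 0\<close> this is the function \<open>K\<close> for which \<open>v\<close> solves \<open>P\<^sub>\<sigma> v = c K v\<^sup>n\<^sup>-\<^sup>1\<close>.\<close>

definition curv :: "nat \<Rightarrow> real \<Rightarrow> ('a::euclidean_space \<Rightarrow> real) \<Rightarrow> ('a \<Rightarrow> real) \<Rightarrow> 'a \<Rightarrow> real" where
  "curv n c v f x = f x * inverse (c * v x ^ (n - 1))"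

lemma c_const_pos:
  assumes "n \<ge> 2" "real n = 2 * \<sigma> + 2"
  shows "c_const n \<sigma> > 0"
proof -
  have e: "real n / 2 + \<sigma> > 0" "real n / 2 - \<sigma> > 0" using assms by (auto simp: field_simps)
  then show ?thesis unfolding c_const_def by (intro divide_pos_pos Gamma_real_pos) auto
qed

text \<open>As n - 2 \<sigma> = 2, the exponent in the equation is n - 1, and \<open>curv\<close> is
  the quotient that returns f on the sphere.\<close>

lemma curv_solutions:
  fixes v f :: "'a::euclidean_space \<Rightarrow> real"
  assumes n: "n \<ge> 2" and \<sigma>: "real n = 2 * \<sigma> + 2" and dim: "DIM('a) = n + 1"
    and vf: "P_pair n v f" and v: "\<And>x. norm x = 1 \<Longrightarrow> v x > 0"
  shows "v \<in> solutions n \<sigma> (curv n (c_const n \<sigma>) v f)"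
proof -
  have ex: "(real n + 2 * \<sigma>) / (real n - 2 * \<sigma>) = real (n - 1)"
    using n \<sigma> by (simp add: of_nat_diff field_simps)
  have "has_P n \<sigma> v (\<lambda>x. c_const n \<sigma> * curv n (c_const n \<sigma>) v f x
      * v x powr ((real n + 2 * \<sigma>) / (real n - 2 * \<sigma>)))"
  proof (rule P_pair_has_P[OF n \<sigma> dim vf])
    fix x :: 'a assume "norm x = 1"
    then have "v x > 0" by (rule v)
    then show "c_const n \<sigma> * curv n (c_const n \<sigma>) v f x
      * v x powr ((real n + 2 * \<sigma>) / (real n - 2 * \<sigma>)) = f x"
      unfolding ex using c_const_pos[OF n \<sigma>] by (simp add: curv_def powr_realpow field_simps)
  qed
  then show ?thesis
    using P_pair_Cinf(1)[OF vf] v by (auto simp: solutions_def sphere_Ck_iff Cinf_on_Ck_on)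
qed

section \<open>Planar spherical harmonics and jet interpolation\<close>

lemma radial_ext_add: "radial_ext (\<lambda>x. f x + g x) = (\<lambda>x. radial_ext f x + radial_ext g x)"
  by (simp add: radial_ext_def[abs_def])

lemma radial_ext_cmult: "radial_ext (\<lambda>x. c * f x) = (\<lambda>x. c * radial_ext f x)"
  by (simp add: radial_ext_def[abs_def])

lemma radial_ext_sum: "radial_ext (\<lambda>x. \<Sum>i\<in>I. f i x) = (\<lambda>x. \<Sum>i\<in>I. radial_ext (f i) x)"
  by (simp add: radial_ext_def[abs_def])

lemma pd_radial_ext_add:
  assumes "Cinf_on (- {0}) (radial_ext f)" "Cinf_on (- {0}) (radial_ext g)" "x \<noteq> 0"
  shows "pd u (radial_ext (\<lambda>x. f x + g x)) x = pd u (radial_ext f) x + pd u (radial_ext g) x"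
  using assms by (auto simp: radial_ext_add intro!: pd_add Cinf_on_differentiable)

lemma pd_radial_ext_cmult:
  assumes "Cinf_on (- {0}) (radial_ext f)" "x \<noteq> 0"
  shows "pd u (radial_ext (\<lambda>x. c * f x)) x = c * pd u (radial_ext f) x"
  using assms by (auto simp: radial_ext_cmult intro!: pd_cmult Cinf_on_differentiable)

lemma pd_radial_ext_sum:
  assumes "\<And>i. i \<in> I \<Longrightarrow> Cinf_on (- {0}) (radial_ext (f i))" "x \<noteq> 0"
  shows "pd u (radial_ext (\<lambda>x. \<Sum>i\<in>I. f i x)) x = (\<Sum>i\<in>I. pd u (radial_ext (f i)) x)"
  using assms by (auto simp: radial_ext_sum intro!: pd_sum Cinf_on_differentiable)

lemma sphere_hess_sum:
  assumes f: "\<And>i. i \<in> I \<Longrightarrow> Cinf_on (- {0}) (radial_ext (f i))" and x: "x \<noteq> 0"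
  shows "sphere_hess (\<lambda>x. \<Sum>i\<in>I. f i x) x u w = (\<Sum>i\<in>I. sphere_hess (f i) x u w)"
proof -
  have "pd w (pd u (radial_ext (\<lambda>x. \<Sum>i\<in>I. f i x))) x = pd w (\<lambda>x. \<Sum>i\<in>I. pd u (radial_ext (f i)) x) x"
    by (rule pd_cong_open[of "- {0}"]) (auto simp: x pd_radial_ext_sum f)
  then show ?thesis
    using assms by (auto simp: sphere_hess_eq intro!: pd_sum Cinf_on_differentiable[OF Cinf_on_pd])
qed

lemma sphere_hess_add:
  assumes "Cinf_on (- {0}) (radial_ext f)" "Cinf_on (- {0}) (radial_ext g)" "x \<noteq> 0"
  shows "sphere_hess (\<lambda>x. f x + g x) x u w = sphere_hess f x u w + sphere_hess g x u w"
  using sphere_hess_sum[of "UNIV :: bool set" "\<lambda>b. if b then f else g" x u w] assms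
  by (simp add: UNIV_bool add.commute)

lemma sphere_hess_cmult:
  assumes "Cinf_on (- {0}) (radial_ext f)" "x \<noteq> 0"
  shows "sphere_hess (\<lambda>x. c * f x) x u w = c * sphere_hess f x u w"
proof -
  have "pd w (pd u (radial_ext (\<lambda>x. c * f x))) x = pd w (\<lambda>x. c * pd u (radial_ext f) x) x"
    by (rule pd_cong_open[of "- {0}"]) (auto simp: pd_radial_ext_cmult assms)
  then show ?thesis
    using assms by (auto simp: sphere_hess_eq intro!: pd_cmult Cinf_on_differentiable[OF Cinf_on_pd])
qed

lemma sphere_lap_sum:
  assumes "\<And>i. i \<in> I \<Longrightarrow> Cinf_on (- {0}) (radial_ext (f i))" "x \<noteq> 0"
  shows "sphere_lap (\<lambda>x. \<Sum>i\<in>I. f i x) x = (\<Sum>i\<in>I. sphere_lap (f i) x)"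
proof -
  have "sphere_lap (\<lambda>x. \<Sum>i\<in>I. f i x) x = (\<Sum>b\<in>Basis. \<Sum>i\<in>I. sphere_hess (f i) x b b)"
    unfolding sphere_lap_def using assms by (simp add: sphere_hess_sum)
  also have "\<dots> = (\<Sum>i\<in>I. sphere_lap (f i) x)"
    unfolding sphere_lap_def by (rule sum.swap)
  finally show ?thesis .
qed

lemma sphere_lap_add:
  assumes "Cinf_on (- {0}) (radial_ext f)" "Cinf_on (- {0}) (radial_ext g)" "x \<noteq> 0"
  shows "sphere_lap (\<lambda>x. f x + g x) x = sphere_lap f x + sphere_lap g x"
  unfolding sphere_lap_def using assms by (simp add: sphere_hess_add sum.distrib)

lemma sphere_lap_cmult:
  assumes "Cinf_on (- {0}) (radial_ext f)" "x \<noteq> 0"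
  shows "sphere_lap (\<lambda>x. c * f x) x = c * sphere_lap f x"
  unfolding sphere_lap_def using assms by (simp add: sphere_hess_cmult sum_distrib_left)

section \<open>Harmonics of a single complex coordinate\<close>

definition planar :: "'a::real_inner \<Rightarrow> 'a \<Rightarrow> 'a \<Rightarrow> complex" where
  "planar a b x = Complex (x \<bullet> a) (x \<bullet> b)"

lemma planar_linear: "bounded_linear (planar a b)"
proof -
  have "planar a b = (\<lambda>x. of_real (x \<bullet> a) + \<i> * of_real (x \<bullet> b))"
    by (auto simp: planar_def complex_eq_iff)
  moreover have "bounded_linear (\<lambda>x. complex_of_real (x \<bullet> a) + \<i> * of_real (x \<bullet> b))"
    by (intro bounded_linear_add bounded_linear_const_mult bounded_linear_compose[OF bounded_linear_of_real]
        bounded_linear_inner_left)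
  ultimately show ?thesis by simp
qed

lemma has_derivative_planar_power:
  "((\<lambda>x. Re (c * planar a b x ^ l)) has_derivative
    (\<lambda>h. Re (c * of_nat l * planar a b h * planar a b x ^ (l - 1)))) (at x)"
proof -
  have "(planar a b has_derivative planar a b) (at x)"
    using planar_linear bounded_linear_imp_has_derivative by blast
  then have "((\<lambda>x. c * planar a b x ^ l) has_derivative
      (\<lambda>h. c * (of_nat l * planar a b h * planar a b x ^ (l - 1)))) (at x)"
    by (intro has_derivative_mult_right has_derivative_power)
  from bounded_linear.has_derivative[OF bounded_linear_Re this]
  show ?thesis by (simp add: mult.assoc)
qed

lemma pd_planar_power:
  "pd u (\<lambda>x. Re (c * planar a b x ^ l)) = (\<lambda>x. Re ((c * of_nat l * planar a b u) * planar a b x ^ (l - 1)))"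
  by (rule ext, rule pd_eq[OF has_derivative_planar_power])

text \<open>For orthonormal a, b the squares of \<open>planar a b e\<close> over the basis add up to
  |a|^2 - |b|^2 + 2 i (a . b) = 0, and this sum is a factor of the Laplacian of every power of
  z.\<close>

lemma solid_harm_planar:
  fixes a b :: "'a::euclidean_space"
  assumes "norm a = 1" "norm b = 1" "a \<bullet> b = 0"
  shows "solid_harm l (\<lambda>x. Re (c * planar a b x ^ l))"
  unfolding solid_harm_def
proof (intro conjI allI)
  have "Ck_on k UNIV (\<lambda>x. Re (c * planar a b x ^ l))" for k c l
  proof (induction k arbitrary: c l)
    case 0
    show ?case unfolding Ck_on.simps(1)
      by (rule continuous_at_imp_continuous_on)
        (blast intro: has_derivative_continuous[OF has_derivative_planar_power])
  next
    case (Suc k)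
    show ?case unfolding Ck_on_Suc pd_planar_power
      by (intro conjI allI Suc.IH differentiable_at_imp_differentiable_on
          differentiableI[OF has_derivative_planar_power])
  qed
  then show "Cinf_on UNIV (\<lambda>x. Re (c * planar a b x ^ l))" by (simp add: Cinf_on_def)
  fix t x
  have "planar a b (t *\<^sub>R x) = of_real t * planar a b x"
    by (auto simp: planar_def complex_eq_iff)
  then have "c * planar a b (t *\<^sub>R x) ^ l = of_real (t ^ l) * (c * planar a b x ^ l)"
    by (simp add: power_mult_distrib)
  moreover have "Re (of_real s * z) = s * Re z" for s z by simp
  ultimately show "Re (c * planar a b (t *\<^sub>R x) ^ l) = t ^ l * Re (c * planar a b x ^ l)"
    by (simp only:)
next
  fix x
  have "(\<Sum>e\<in>Basis. planar a b e * planar a b e) = Complex (a \<bullet> a - b \<bullet> b) (2 * (a \<bullet> b))"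
    by (auto simp: complex_eq_iff planar_def sum_subtractf sum.distrib
        euclidean_inner[of a a] euclidean_inner[of b b] euclidean_inner[of a b] inner_commute mult.commute sum_distrib_left)
  also have "\<dots> = 0" using assms by (simp add: norm_eq_1 complex_eq_iff)
  finally have s: "(\<Sum>e\<in>Basis. planar a b e * planar a b e) = 0" .
  have "lap (\<lambda>x. Re (c * planar a b x ^ l)) x
      = (\<Sum>e\<in>Basis. Re (c * of_nat l * of_nat (l - 1) * planar a b x ^ (l - 1 - 1)
           * (planar a b e * planar a b e)))"
    unfolding lap_def pd_planar_power by (intro sum.cong refl arg_cong[where f = Re]) (simp add: algebra_simps)
  also have "\<dots> = Re (c * of_nat l * of_nat (l - 1) * planar a b x ^ (l - 1 - 1)
           * (\<Sum>e\<in>Basis. planar a b e * planar a b e))"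
    by (simp only: sum_distrib_left Re_sum)
  finally show "lap (\<lambda>x. Re (c * planar a b x ^ l)) x = 0" by (simp add: s)
qed

text \<open>Bessel's inequality for the orthonormal pair p, b; equality forces x into the plane that
  they span.\<close>

lemma norm_planar:
  assumes "norm p = 1" "norm b = 1" "p \<bullet> b = 0" "norm x = 1"
  shows "norm (planar p b x) \<le> 1"
    and "norm (planar p b x) = 1 \<Longrightarrow> x = (x \<bullet> p) *\<^sub>R p + (x \<bullet> b) *\<^sub>R b"
proof -
  have u: "p \<bullet> p = 1" "b \<bullet> b = 1" "x \<bullet> x = 1" "b \<bullet> p = 0"
    using assms by (auto simp: norm_eq_1 inner_commute)
  have z: "(norm (planar p b x))\<^sup>2 = (x \<bullet> p)\<^sup>2 + (x \<bullet> b)\<^sup>2"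
    by (simp add: planar_def cmod_power2)
  let ?r = "x - ((x \<bullet> p) *\<^sub>R p + (x \<bullet> b) *\<^sub>R b)"
  have r: "?r \<bullet> ?r = 1 - ((x \<bullet> p)\<^sup>2 + (x \<bullet> b)\<^sup>2)"
    using u assms(3) by (simp add: algebra_simps power2_eq_square inner_commute)
  then have "(norm (planar p b x))\<^sup>2 \<le> 1\<^sup>2" using z inner_ge_zero[of ?r] by simp
  then show "norm (planar p b x) \<le> 1" by (rule power2_le_imp_le) simp
  assume "norm (planar p b x) = 1"
  then have "?r \<bullet> ?r = 0" using r z by simp
  then show "x = (x \<bullet> p) *\<^sub>R p + (x \<bullet> b) *\<^sub>R b" by simp
qed

text \<open>With e1, e2 spanning a plane orthogonal to p, a point other than p and -p lies in the
  span of p and e1 + s e2 for at most one s, so finitely many points exclude finitely many s. This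
  is where three dimensions are used.\<close>

lemma planar_direction_exists:
  fixes p :: "'a::euclidean_space"
  assumes dim: "DIM('a) \<ge> 3" and p: "norm p = 1" and S: "finite S"
  obtains b where "norm b = 1" "p \<bullet> b = 0"
    "\<And>x. x \<in> S \<Longrightarrow> norm x = 1 \<Longrightarrow> x \<noteq> p \<Longrightarrow> x \<noteq> - p \<Longrightarrow> norm (planar p b x) < 1"
proof -
  have "dim {p} < DIM('a)" using dim dim_le_card[of "{p}" "{p}"] by (simp add: span_base)
  then obtain e1 where e1: "e1 \<noteq> 0" "\<And>y. y \<in> span {p} \<Longrightarrow> e1 \<bullet> y = 0"
    using orthogonal_to_subspace_exists[of "{p}"] by (auto simp: real_inner_class.orthogonal_def)
  have "dim {p, e1} \<le> 2"
    using dim_le_card[of "{p, e1}" "{p, e1}"] card_insert_le_m1[of 2 "{e1}" p] by (simp add: span_superset)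
  then have "dim {p, e1} < DIM('a)" using dim by simp
  then obtain e2 where e2: "e2 \<noteq> 0" "\<And>y. y \<in> span {p, e1} \<Longrightarrow> e2 \<bullet> y = 0"
    using orthogonal_to_subspace_exists[of "{p, e1}"] by (auto simp: real_inner_class.orthogonal_def)
  have o: "e1 \<bullet> p = 0" "e2 \<bullet> p = 0" "e2 \<bullet> e1 = 0"
    using e1(2)[of p] e2(2)[of p] e2(2)[of e1] by (auto simp: span_base)
  have o': "p \<bullet> e1 = 0" "p \<bullet> e2 = 0" "e1 \<bullet> e2 = 0" using o by (auto simp: inner_commute)
  \<comment> \<open>If x is a combination of p and e1 + s e2 with nonzero second coefficient, this
    ratio of coordinates recovers s. Values caused by division by zero only enlarge a finite
    set.\<close>
  define bad where "bad x = ((x \<bullet> e2) / (e2 \<bullet> e2)) / ((x \<bullet> e1) / (e1 \<bullet> e1))" for x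
  obtain s where s: "s \<notin> bad ` S"
    using ex_new_if_finite[OF infinite_UNIV_char_0, of "bad ` S"] S by auto
  define w where "w = e1 + s *\<^sub>R e2"
  have w0: "w \<noteq> 0"
  proof
    assume "w = 0"
    then have "w \<bullet> e1 = 0" by simp
    then show False using e1(1) o by (simp add: w_def inner_add_left)
  qed
  define b where "b = w /\<^sub>R norm w"
  have b: "norm b = 1" "p \<bullet> b = 0" using w0 o' by (auto simp: b_def w_def inner_add_right)
  show ?thesis
  proof (rule that[OF b])
    fix x assume x: "x \<in> S" "norm x = 1" "x \<noteq> p" "x \<noteq> - p"
    show "norm (planar p b x) < 1"
    proof (rule ccontr)
      assume "\<not> norm (planar p b x) < 1"
      then have eq: "x = (x \<bullet> p) *\<^sub>R p + (x \<bullet> b) *\<^sub>R b"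
        using norm_planar[OF p b x(2)] by linarith
      define t where "t = (x \<bullet> b) / norm w"
      have xe: "x = (x \<bullet> p) *\<^sub>R p + t *\<^sub>R w" using eq by (simp add: b_def t_def divide_inverse)
      have "t \<noteq> 0"
      proof
        assume "t = 0"
        then have "x = (x \<bullet> p) *\<^sub>R p" using xe by simp
        moreover from this have "\<bar>x \<bullet> p\<bar> = 1" using x(2) p by (metis norm_scaleR mult.right_neutral)
        ultimately show False using x(3,4) by (metis abs_eq_iff' abs_1 scaleR_minus1_left scaleR_one abs_if)
      qed
      moreover have "x \<bullet> e1 = t * (e1 \<bullet> e1)" "x \<bullet> e2 = t * s * (e2 \<bullet> e2)"
        by (subst xe, simp add: o o' w_def inner_add_left)+
      ultimately have "bad x = s" using e1(1) e2(1) by (simp add: bad_def)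
      then show False using s x(1) by auto
    qed
  qed
qed

text \<open>The coefficients of \<open>(z - 1)\<^sup>n (z + 1)\<^sup>n\<^sup>+\<^sup>1\<close> annihilate polynomial weights like an iterated
  difference operator, at \<open>z = 1\<close> and at \<open>z = -1\<close>.\<close>

definition coeff_pairing :: "real poly \<Rightarrow> real poly \<Rightarrow> real" where
  "coeff_pairing A r = (\<Sum>j\<le>degree A. coeff A j * poly r (real j))"

definition fdiff :: "real poly \<Rightarrow> real poly" where
  "fdiff r = pcompose r [:1, 1:] - r"

lemma coeff_pairing_eq: "degree A \<le> m \<Longrightarrow> coeff_pairing A r = (\<Sum>j\<le>m. coeff A j * poly r (real j))"
  unfolding coeff_pairing_def by (rule sum.mono_neutral_left) (auto simp: coeff_eq_0)

text \<open>Summation by parts: the coefficients of (z - 1) A are backward differences of those of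
  A.\<close>

lemma coeff_pairing_fdiff: "coeff_pairing ([:-1, 1:] * A) r = coeff_pairing A (fdiff r)"
proof -
  let ?m = "degree A"
  have "degree ([:-1, 1:] * A) \<le> Suc ?m"
    using degree_mult_le[of "[:-1, 1:]" A] by simp
  then have "coeff_pairing ([:-1, 1:] * A) r
      = (\<Sum>j\<le>Suc ?m. coeff ([:-1, 1:] * A) j * poly r (real j))"
    by (rule coeff_pairing_eq)
  also have "\<dots> = (\<Sum>j\<le>Suc ?m. (case j of 0 \<Rightarrow> 0 | Suc i \<Rightarrow> coeff A i) * poly r (real j))
      - (\<Sum>j\<le>Suc ?m. coeff A j * poly r (real j))"
    by (subst sum_subtractf[symmetric], rule sum.cong)
      (auto simp: coeff_pCons algebra_simps split: nat.split)
  also have "(\<Sum>j\<le>Suc ?m. (case j of 0 \<Rightarrow> 0 | Suc i \<Rightarrow> coeff A i) * poly r (real j))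
      = (\<Sum>j\<le>?m. coeff A j * poly r (real (Suc j)))"
    by (subst sum.atMost_Suc_shift) simp
  also have "(\<Sum>j\<le>Suc ?m. coeff A j * poly r (real j)) = (\<Sum>j\<le>?m. coeff A j * poly r (real j))"
    by (simp add: coeff_eq_0)
  finally show ?thesis
    by (simp add: coeff_pairing_def fdiff_def poly_pcompose algebra_simps sum_subtractf)
qed

text \<open>Writing r = a + x q gives fdiff r = x (fdiff q) + q(x + 1), and q(x + 1) = fdiff q + q
  adds one more copy of the leading coefficient at each step.\<close>

lemma coeff_fdiff:
  assumes "degree r \<le> Suc d"
  shows "degree (fdiff r) \<le> d \<and> coeff (fdiff r) d = real (Suc d) * coeff r (Suc d)"
  using assms
proof (induction d arbitrary: r)
  case 0
  then have r: "r = [:coeff r 0, coeff r 1:]"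
    by (intro poly_eqI) (auto simp: coeff_pCons coeff_eq_0 split: nat.split)
  show ?case by (subst (1 2) r) (simp add: fdiff_def pcompose_pCons)
next
  case (Suc d)
  obtain a q where r: "r = pCons a q" by (cases r)
  have q: "degree q \<le> Suc d" using Suc.prems r by (cases "q = 0") auto
  have f: "fdiff r = pCons 0 (fdiff q) + pcompose q [:1, 1:]"
    by (simp add: r fdiff_def pcompose_pCons algebra_simps)
  have IH: "degree (fdiff q) \<le> d" "coeff (fdiff q) d = real (Suc d) * coeff q (Suc d)"
    using Suc.IH[OF q] by auto
  have pq: "pcompose q [:1, 1:] = fdiff q + q" by (simp add: fdiff_def)
  have "degree (pcompose q [:1, 1:]) \<le> Suc d"
    using IH(1) q unfolding pq by (intro degree_add_le) auto
  moreover have "degree (pCons 0 (fdiff q)) \<le> Suc d"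
    using IH(1) degree_pCons_le[of 0 "fdiff q"] by linarith
  ultimately have "degree (fdiff r) \<le> Suc d" unfolding f by (intro degree_add_le)
  moreover have "coeff (fdiff r) (Suc d) = real (Suc (Suc d)) * coeff r (Suc (Suc d))"
    using IH by (simp only: f coeff_add coeff_pCons_Suc pq) (simp add: r coeff_eq_0 algebra_simps)
  ultimately show ?case by blast
qed

text \<open>The m-fold difference of a polynomial of degree at most m is the constant m! times its
  coefficient of degree m, and pairing with a constant evaluates A at 1.\<close>

lemma coeff_pairing_power:
  "degree r \<le> m \<Longrightarrow> coeff_pairing ([:-1, 1:] ^ m * A) r = fact m * coeff r m * poly A 1"
proof (induction m arbitrary: r)
  case 0
  then obtain a where "r = [:a:]" by (metis degree_0_id le_zero_eq)
  then show ?case by (simp add: coeff_pairing_def poly_altdef sum_distrib_left sum_distrib_right mult.commute)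
next
  case (Suc m)
  have "coeff_pairing ([:-1, 1:] ^ Suc m * A) r = coeff_pairing ([:-1, 1:] ^ m * A) (fdiff r)"
    using coeff_pairing_fdiff[of "[:-1, 1:] ^ m * A" r] by (simp only: power_Suc mult.assoc)
  also have "\<dots> = fact m * coeff (fdiff r) m * poly A 1"
    using coeff_fdiff[OF Suc.prems] by (intro Suc.IH) blast
  finally show ?case using coeff_fdiff[OF Suc.prems] by (simp add: algebra_simps)
qed

text \<open>The zero of order n at 1 lets exactly the coefficient of degree n through, the one
  carried by the Laplacian of f. The zero at -1 has order n + 1 and removes that coefficient too, so
  the antipode of the pole sees nothing.\<close>

definition bump_poly :: "nat \<Rightarrow> real poly" where
  "bump_poly n = [:-1, 1:] ^ n * [:1, 1:] ^ Suc n"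

lemma bump_poly_at_1:
  assumes "degree r \<le> n"
  shows "coeff_pairing (bump_poly n) r = fact n * 2 ^ Suc n * coeff r n"
  unfolding bump_poly_def coeff_pairing_power[OF assms] by simp

text \<open>The substitution z -> -z exchanges the two linear factors up to sign, so that the zero
  of order n + 1 moves to 1, where it annihilates all weights of degree at most n.\<close>

lemma bump_poly_at_minus_1:
  assumes "degree r \<le> n"
  shows "(\<Sum>j\<le>degree (bump_poly n). coeff (bump_poly n) j * (-1) ^ j * poly r (real j)) = 0"
proof -
  let ?B = "pcompose (bump_poly n) [:0, -1:]"
  have cB: "coeff ?B j = coeff (bump_poly n) j * (-1) ^ j" for j
    using coeff_pcompose_linear[of "bump_poly n" "-1" j] by (simp add: mult.commute)
  have pow: "pcompose (A ^ k) q = pcompose A q ^ k" for A q :: "real poly" and k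
    by (induction k) (simp_all add: pcompose_mult pcompose_1)
  have minus: "(- A) ^ n * (- C) ^ Suc n = C ^ Suc n * (- (A ^ n))" for A C :: "real poly"
  proof -
    have "(- A) ^ n * (- C) ^ Suc n = ((-1) ^ n * (-1) ^ n) * (C ^ Suc n * (- (A ^ n)))"
      unfolding power_minus[of A] power_minus[of C] power_Suc by (simp add: algebra_simps)
    then show ?thesis by (simp only: minus_one_mult_self mult_1)
  qed
  have lin: "pcompose [:-1, 1:] [:0, -1::real:] = - [:1, 1:]" "pcompose [:1, 1:] [:0, -1::real:] = - [:-1, 1:]"
    by (simp_all add: pcompose_pCons)
  have "?B = [:-1, 1:] ^ Suc n * (- ([:1, 1:] ^ n))"
    unfolding bump_poly_def pcompose_mult pow lin by (rule minus)
  then have "coeff_pairing ?B r = 0"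
    using coeff_pairing_power[of r "Suc n" "- ([:1, 1:] ^ n)"] assms
    by (simp only: coeff_eq_0)
  moreover have "coeff_pairing ?B r = (\<Sum>j\<le>degree (bump_poly n). coeff ?B j * poly r (real j))"
    by (rule coeff_pairing_eq) (simp add: degree_pcompose)
  ultimately show ?thesis by (simp add: cB)
qed

lemma power_mult_geometric_tendsto_0:
  fixes s :: real
  assumes "0 \<le> s" "s < 1"
  shows "(\<lambda>l. real l ^ k * s ^ l) \<longlonglongrightarrow> 0"
  using assms
proof (induction k arbitrary: s)
  case 0
  then show ?case by (simp add: LIMSEQ_realpow_zero)
next
  case (Suc k)
  \<comment> \<open>Splitting s^l into two powers of the root spends one of them on a single factor
    l and leaves the other to the induction hypothesis.\<close>
  let ?t = "sqrt s"
  have t: "0 \<le> ?t" "?t < 1" "?t * ?t = s" using Suc.prems by auto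
  have "(\<lambda>l. real l * ?t ^ l) \<longlonglongrightarrow> 0"
    using powser_times_n_limit_0[of ?t] t by simp
  from tendsto_mult[OF this Suc.IH[OF t(1,2)]]
  show ?case using t(3) by (simp add: power_mult_distrib[symmetric] algebra_simps)
qed

lemma poly_mult_geometric_tendsto_0:
  fixes z :: complex
  assumes "norm z < 1"
  shows "(\<lambda>L. of_real (poly r (real (L + j))) * z ^ (L + j)) \<longlonglongrightarrow> 0"
proof -
  have "(\<lambda>l. poly r (real l) * norm z ^ l) \<longlonglongrightarrow> (\<Sum>i\<le>degree r. coeff r i * 0)"
    unfolding poly_altdef sum_distrib_right mult.assoc
    using assms by (intro tendsto_sum tendsto_mult tendsto_const power_mult_geometric_tendsto_0) auto
  then have "(\<lambda>l. poly r (real l) * norm z ^ l) \<longlonglongrightarrow> 0" by simp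
  then have "(\<lambda>l. of_real (poly r (real l)) * z ^ l) \<longlonglongrightarrow> 0"
    by (rule Lim_null_comparison[rotated, OF tendsto_rabs_zero]) (simp add: norm_mult norm_power abs_mult)
  then show ?thesis by (rule LIMSEQ_ignore_initial_segment[where k = j])
qed

text \<open>A subspace of a finite-dimensional space is closed, so interpolation in the limit gives
  exact interpolation. Only the coordinates in I count; they are eliminated one at a time.\<close>

lemma limit_in_subspace_finite:
  fixes V :: "('i \<Rightarrow> real) set"
  assumes "finite I" "(\<lambda>i. 0) \<in> V"
    and "\<And>u w. u \<in> V \<Longrightarrow> w \<in> V \<Longrightarrow> (\<lambda>i. u i + w i) \<in> V"
    and "\<And>c u. u \<in> V \<Longrightarrow> (\<lambda>i. c * u i) \<in> V"
    and "\<And>k. w k \<in> V" "\<And>i. i \<in> I \<Longrightarrow> (\<lambda>k::nat. w k i) \<longlonglongrightarrow> t i"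
  shows "\<exists>u\<in>V. \<forall>i\<in>I. u i = t i"
  using assms
proof (induction I arbitrary: V w t rule: finite_induct)
  case empty
  then show ?case by auto
next
  case (insert i I)
  note add = insert.prems(2) and scale = insert.prems(3) and w = insert.prems(4,5)
  show ?case
  proof (cases "\<forall>u\<in>V. u i = 0")
    case True
    then have "w k i = 0" for k using w(1) by blast
    then have ti: "t i = 0" using w(2)[of i] by (simp add: LIMSEQ_const_iff)
    have "\<exists>u\<in>V. \<forall>j\<in>I. u j = t j"
      by (rule insert.IH[where w = w, OF insert.prems(1) add scale w(1)]) (use w(2) in auto)
    then show ?thesis using True ti by auto
  next
    case False
    then obtain e0 where e0: "e0 \<in> V" "e0 i \<noteq> 0" by blast
    \<comment> \<open>Subtracting multiples of this vector, whose i-th coordinate is 1, moves the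
      sequence into the subspace where coordinate i vanishes.\<close>
    define e where "e = (\<lambda>j. inverse (e0 i) * e0 j)"
    have e: "e \<in> V" "e i = 1" using e0 scale by (auto simp: e_def)
    let ?V = "{u \<in> V. u i = 0}"
    have sub: "(\<lambda>j. u j + - c * e j) \<in> V" if "u \<in> V" for u c
      using add[OF that scale[OF e(1)]] .
    have "\<exists>u\<in>?V. \<forall>j\<in>I. u j = t j + - t i * e j"
    proof (rule insert.IH[where w = "\<lambda>k j. w k j + - w k i * e j"])
      show "(\<lambda>j. w k j + - w k i * e j) \<in> ?V" for k
        using sub[OF w(1)] e(2) by simp
      show "(\<lambda>k. w k j + - w k i * e j) \<longlonglongrightarrow> t j + - t i * e j" if "j \<in> I" for j
        using that w(2) by (intro tendsto_intros) auto
    qed (use insert.prems(1) add scale in auto)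
    then obtain u where u: "u \<in> V" "u i = 0" "\<And>j. j \<in> I \<Longrightarrow> u j = t j + - t i * e j" by auto
    have "(\<lambda>j. u j + t i * e j) \<in> V" using add[OF u(1) scale[OF e(1)]] .
    moreover have "u j + t i * e j = t j" if "j \<in> insert i I" for j
      using that u(2,3) e(2) by auto
    ultimately show ?thesis by (intro bexI[of _ "\<lambda>j. u j + t i * e j"]) auto
  qed
qed

text \<open>The coefficients of \<open>bump_poly\<close> are spread over the degrees from L onwards;
  the weight s encodes the operator applied to each degree, and L -> \<infinity> gives decay
  wherever |z| < 1.\<close>

definition bump_sum :: "nat \<Rightarrow> real poly \<Rightarrow> complex \<Rightarrow> nat \<Rightarrow> complex" where
  "bump_sum n s z L = (\<Sum>j\<le>degree (bump_poly n).
     of_real (coeff (bump_poly n) j * poly s (real (L + j))) * z ^ (L + j))"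

lemma coeff_pcompose_monic_linear:
  fixes s :: "real poly"
  assumes "degree s \<le> n" shows "coeff (pcompose s [:c, 1:]) n = coeff s n"
proof (cases "degree s = n")
  case True
  then show ?thesis using lead_coeff_comp[of "[:c, 1:]" s] by (simp add: degree_pcompose)
next
  case False
  then show ?thesis using assms by (simp add: coeff_eq_0 degree_pcompose)
qed

text \<open>Shifting the argument of s by L keeps its coefficient of degree n, so the value is
  independent of L.\<close>

lemma bump_sum_at_1:
  assumes "degree s \<le> n"
  shows "bump_sum n s 1 L = of_real (fact n * 2 ^ Suc n * coeff s n)"
proof -
  have "bump_sum n s 1 L = of_real (coeff_pairing (bump_poly n) (pcompose s [:real L, 1:]))"
    by (simp add: bump_sum_def coeff_pairing_def poly_pcompose)
  also have "coeff_pairing (bump_poly n) (pcompose s [:real L, 1:]) = fact n * 2 ^ Suc n * coeff s n"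
    using assms by (subst bump_poly_at_1) (auto simp: degree_pcompose coeff_pcompose_monic_linear)
  finally show ?thesis .
qed

lemma bump_sum_at_minus_1:
  assumes "degree s \<le> n"
  shows "bump_sum n s (-1) L = 0"
proof -
  have "bump_sum n s (-1) L = (-1) ^ L * of_real (\<Sum>j\<le>degree (bump_poly n).
      coeff (bump_poly n) j * (-1) ^ j * poly (pcompose s [:real L, 1:]) (real j))"
    by (simp add: bump_sum_def poly_pcompose sum_distrib_left power_add mult_ac)
  then show ?thesis
    using assms by (subst (asm) bump_poly_at_minus_1) (auto simp: degree_pcompose)
qed

lemma bump_sum_tendsto_0:
  assumes "norm z < 1"
  shows "(\<lambda>L. bump_sum n s z L) \<longlonglongrightarrow> 0"
proof -
  have "(\<lambda>L. \<Sum>j\<le>degree (bump_poly n). of_real (coeff (bump_poly n) j) *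
      (of_real (poly s (real (L + j))) * z ^ (L + j))) \<longlonglongrightarrow>
      (\<Sum>j\<le>degree (bump_poly n). of_real (coeff (bump_poly n) j) * 0)"
    by (intro tendsto_sum tendsto_mult tendsto_const poly_mult_geometric_tendsto_0 assms)
  then show ?thesis by (simp add: bump_sum_def mult.assoc)
qed

lemma bump_sum_shift:
  "(\<Sum>j\<le>degree (bump_poly n). of_real (coeff (bump_poly n) j * poly s (real (Suc M + j))) * z ^ (M + j))
    = bump_sum n (pcompose s [:1, 1:]) z M"
  by (simp add: bump_sum_def poly_pcompose algebra_simps)

definition bump_fun :: "nat \<Rightarrow> real poly \<Rightarrow> 'a::real_inner \<Rightarrow> 'a \<Rightarrow> nat \<Rightarrow> 'a \<Rightarrow> real" where
  "bump_fun n s p b L x = Re (bump_sum n s (planar p b x) L)"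

lemma bump_fun_eq: "bump_fun n s p b L = (\<lambda>x. \<Sum>j\<le>degree (bump_poly n).
     Re (of_real (coeff (bump_poly n) j * poly s (real (L + j))) * planar p b x ^ (L + j)))"
  unfolding bump_fun_def[abs_def] bump_sum_def Re_sum ..

text \<open>Differentiation and the Laplacian multiply degree l by l and by - l (l + n - 1), so they
  only change the weight s. A derivative lowers the power of z by one: starting at
  \<open>Suc M\<close> avoids truncated subtraction, and composition with \<open>[:1, 1:]\<close>
  corrects the index.\<close>

lemma
  fixes x :: "'a::euclidean_space"
  assumes pb: "norm p = 1" "norm b = 1" "p \<bullet> b = 0" and x: "norm x = 1"
  shows pd_bump_fun: "pd u (radial_ext (bump_fun n s p b (Suc M))) x =
      Re (planar p b u * bump_sum n (pcompose ([:0, 1:] * s) [:1, 1:]) (planar p b x) M)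
      - (x \<bullet> u) * Re (bump_sum n ([:0, 1:] * s) (planar p b x) (Suc M))"
    and sphere_lap_bump_fun: "DIM('a) = n + 1 \<Longrightarrow> sphere_lap (bump_fun n s p b L) x =
      - Re (bump_sum n ([:0, 1:] * [:real n - 1, 1:] * s) (planar p b x) L)"
proof -
  have x0: "x \<noteq> 0" using x by auto
  let ?B = "bump_poly n" and ?z = "planar p b x"
  define c where "c L j = complex_of_real (coeff ?B j * poly s (real (L + j)))" for L j
  define Y where "Y L j = (\<lambda>x. Re (c L j * planar p b x ^ (L + j)))" for L j
  have Y: "solid_harm (L + j) (Y L j)" for L j unfolding Y_def by (rule solid_harm_planar[OF pb])
  have B: "bump_fun n s p b L = (\<lambda>x. \<Sum>j\<le>degree ?B. Y L j x)" for L
    unfolding bump_fun_eq Y_def c_def ..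
  have "pd u (radial_ext (Y (Suc M) j)) x
      = Re (planar p b u * (of_real (coeff ?B j * poly ([:0, 1:] * s) (real (Suc M + j))) * ?z ^ (M + j)))
        - (x \<bullet> u) * Re (of_real (coeff ?B j * poly ([:0, 1:] * s) (real (Suc M + j))) * ?z ^ (Suc M + j))" for j
  proof -
    have 1: "c (Suc M) j * of_nat (Suc M + j) = of_real (coeff ?B j * poly ([:0, 1:] * s) (real (Suc M + j)))"
      by (simp add: c_def algebra_simps)
    have 2: "pd u (Y (Suc M) j) x = Re (c (Suc M) j * of_nat (Suc M + j) * planar p b u * ?z ^ (M + j))"
      unfolding Y_def pd_planar_power by (simp only: add_Suc diff_Suc_1)
    have "pd u (radial_ext (Y (Suc M) j)) x
        = Re (c (Suc M) j * of_nat (Suc M + j) * planar p b u * ?z ^ (M + j))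
          - (x \<bullet> u) * (real (Suc M + j) * Re (c (Suc M) j * ?z ^ (Suc M + j)))"
      unfolding pd_radial_ext_solid_harm[OF Y x0] 2 x
      by (simp add: Y_def del: of_nat_Suc of_nat_add times_complex.sel)
    also have "real (Suc M + j) * Re (c (Suc M) j * ?z ^ (Suc M + j))
        = Re (c (Suc M) j * of_nat (Suc M + j) * ?z ^ (Suc M + j))"
      by (simp add: algebra_simps)
    finally show ?thesis unfolding 1 by (simp only: mult_ac)
  qed
  note pdY = this
  have "pd u (radial_ext (bump_fun n s p b (Suc M))) x = (\<Sum>j\<le>degree ?B. pd u (radial_ext (Y (Suc M) j)) x)"
    unfolding B by (rule pd_radial_ext_sum[OF solid_harm_sphere_Cinf[OF Y] x0])
  also have "\<dots> = Re (planar p b u * bump_sum n (pcompose ([:0, 1:] * s) [:1, 1:]) ?z M)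
      - (x \<bullet> u) * Re (bump_sum n ([:0, 1:] * s) ?z (Suc M))"
    unfolding pdY bump_sum_shift[symmetric]
    by (simp only: sum_subtractf bump_sum_def sum_distrib_left Re_sum)
  finally show "pd u (radial_ext (bump_fun n s p b (Suc M))) x =
      Re (planar p b u * bump_sum n (pcompose ([:0, 1:] * s) [:1, 1:]) ?z M)
      - (x \<bullet> u) * Re (bump_sum n ([:0, 1:] * s) ?z (Suc M))" .
  assume dim: "DIM('a) = n + 1"
  have "sphere_lap (Y L j) x = - Re (of_real (coeff ?B j
      * poly ([:0, 1:] * [:real n - 1, 1:] * s) (real (L + j))) * ?z ^ (L + j))" for j
    unfolding sphere_lap_solid_harm[OF Y x] dim by (simp add: Y_def c_def algebra_simps)
  then have "sphere_lap (bump_fun n s p b L) x = (\<Sum>j\<le>degree ?B. - Re (of_real (coeff ?B j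
      * poly ([:0, 1:] * [:real n - 1, 1:] * s) (real (L + j))) * ?z ^ (L + j)))"
    unfolding B by (subst sphere_lap_sum[OF solid_harm_sphere_Cinf[OF Y] x0]) simp
  then show "sphere_lap (bump_fun n s p b L) x =
      - Re (bump_sum n ([:0, 1:] * [:real n - 1, 1:] * s) ?z L)"
    by (simp only: bump_sum_def Re_sum sum_negf)
qed

definition P_poly :: "nat \<Rightarrow> real poly" where
  "P_poly n = (\<Prod>i<n - 2. [:1 + real i, 1:])"

lemma P_poly:
  shows "poly (P_poly n) (real l) = P_eig n l" "degree (P_poly n) = n - 2" "lead_coeff (P_poly n) = 1"
proof -
  show "poly (P_poly n) (real l) = P_eig n l"
    by (simp add: P_poly_def P_eig_def poly_prod pochhammer_prod atLeast0LessThan algebra_simps)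
  show "degree (P_poly n) = n - 2"
    unfolding P_poly_def by (subst degree_prod_eq_sum_degree) auto
  show "lead_coeff (P_poly n) = 1"
    unfolding P_poly_def by (simp add: lead_coeff_prod)
qed

lemma P_pair_bump_fun:
  assumes pb: "norm p = 1" "norm b = 1" "p \<bullet> b = 0"
  shows "P_pair n (bump_fun n 1 p b L) (bump_fun n (P_poly n) p b L)"
proof -
  have "P_pair n (bump_fun n 1 p b L) (\<lambda>x. \<Sum>j\<le>degree (bump_poly n).
     P_eig n (L + j) * Re (of_real (coeff (bump_poly n) j) * planar p b x ^ (L + j)))"
    unfolding bump_fun_eq poly_1 mult_1_right
    by (rule P_pair_sum) (rule P_pair_solid_harm[OF solid_harm_planar[OF pb]])
  also have "(\<lambda>x. \<Sum>j\<le>degree (bump_poly n).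
     P_eig n (L + j) * Re (of_real (coeff (bump_poly n) j) * planar p b x ^ (L + j)))
     = bump_fun n (P_poly n) p b L"
    unfolding bump_fun_eq P_poly by (intro ext sum.cong refl) (simp add: algebra_simps)
  finally show ?thesis .
qed

text \<open>All data that the interpolation prescribes form one function on a finite index set, as
  \<open>limit_in_subspace_finite\<close> requires. The direction b is read only for k = 1 and k =
  4.\<close>

definition jet :: "('a::euclidean_space \<Rightarrow> real) \<Rightarrow> ('a \<Rightarrow> real) \<Rightarrow> 'a \<times> nat \<times> 'a \<Rightarrow> real" where
  "jet v f = (\<lambda>(x, k, b).
     if k = 0 then v x else if k = 1 then pd b (radial_ext v) x else if k = 2 then sphere_lap v x
     else if k = 3 then f x else if k = 4 then pd b (radial_ext f) x else sphere_lap f x)"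

lemma jet_add:
  assumes "P_pair n v f" "P_pair n w g" "fst i \<noteq> 0"
  shows "jet (\<lambda>x. v x + w x) (\<lambda>x. f x + g x) i = jet v f i + jet w g i"
  using assms P_pair_Cinf[OF assms(1)] P_pair_Cinf[OF assms(2)]
  by (cases i) (auto simp: jet_def pd_radial_ext_add sphere_lap_add)

lemma jet_cmult:
  assumes "P_pair n v f" "fst i \<noteq> 0"
  shows "jet (\<lambda>x. c * v x) (\<lambda>x. c * f x) i = c * jet v f i"
  using assms P_pair_Cinf[OF assms(1)]
  by (cases i) (auto simp: jet_def pd_radial_ext_cmult sphere_lap_cmult)

lemma jet_sum:
  assumes "\<And>a. a \<in> A \<Longrightarrow> P_pair n (v a) (f a)" "fst i \<noteq> 0"
  shows "jet (\<lambda>x. \<Sum>a\<in>A. v a x) (\<lambda>x. \<Sum>a\<in>A. f a x) i = (\<Sum>a\<in>A. jet (v a) (f a) i)"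
  using assms P_pair_Cinf[OF assms(1)]
  by (cases i) (auto simp: jet_def pd_radial_ext_sum sphere_lap_sum)

text \<open>The weights have degrees 0, 1, 2 for v and n - 2, n - 1, n for f, and n \<ge> 3 leaves
  only the last one of degree n. So every other entry tends to 0 at the pole, all entries do so at
  its antipode, and elsewhere there is geometric decay.\<close>

lemma jet_bump_fun_limit:
  fixes p :: "'a::euclidean_space"
  assumes n: "n \<ge> 3" and dim: "DIM('a) = n + 1" and pb: "norm p = 1" "norm b = 1" "p \<bullet> b = 0"
    and x: "norm x = 1" and off: "x \<noteq> p \<Longrightarrow> x \<noteq> - p \<Longrightarrow> norm (planar p b x) < 1"
    and k: "k \<le> 5"
  shows "(\<lambda>M. jet (bump_fun n 1 p b (Suc M)) (bump_fun n (P_poly n) p b (Suc M)) (x, k, u)) \<longlonglongrightarrow>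
    (if x = p \<and> k = 5 then - (fact n * 2 ^ Suc n) else 0)"
proof -
  define X :: "real poly" where "X = [:0, 1:]"
  define E :: "real poly" where "E = [:0, 1:] * [:real n - 1, 1:]"
  let ?P = "P_poly n"
  have nz: "?P \<noteq> 0" using P_poly(3)[of n] by auto
  have lin: "[:0, 1::real:] \<noteq> 0" "[:real n - 1, 1::real:] \<noteq> 0" by auto
  have deg: "degree X = 1" "degree E = 2" "degree (X * ?P) = n - 1" "degree (E * ?P) = n"
    using n nz lin by (auto simp: X_def E_def degree_mult_eq P_poly(2) simp del: mult_pCons_left mult_pCons_right)
  have lead: "coeff (E * ?P) n = 1"
  proof -
    have "lead_coeff E = 1" by (simp add: E_def)
    then have "lead_coeff (E * ?P) = 1" using P_poly(3)[of n] by (simp add: lead_coeff_mult del: coeff_mult)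
    then show ?thesis using deg by simp
  qed
  let ?z = "planar p b x"
  have lim: "(\<lambda>M. bump_sum n s ?z (M + a)) \<longlonglongrightarrow>
      (if x = p then of_real (fact n * 2 ^ Suc n * coeff s n) else 0)" if "degree s \<le> n" for s a
  proof -
    consider "x = p" | "x = - p" "x \<noteq> p" | "x \<noteq> p" "x \<noteq> - p" by blast
    then show ?thesis
    proof cases
      case 1
      then have "?z = 1" using pb by (simp add: planar_def complex_eq_iff norm_eq_1)
      then show ?thesis using 1 bump_sum_at_1[OF that] by simp
    next
      case 2
      then have "?z = -1" using pb by (simp add: planar_def complex_eq_iff norm_eq_1)
      then show ?thesis using 2 bump_sum_at_minus_1[OF that] by simp
    next
      case 3
      show ?thesis using LIMSEQ_ignore_initial_segment[OF bump_sum_tendsto_0[OF off[OF 3]]] 3 by simp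
    qed
  qed
  have lim0: "(\<lambda>M. bump_sum n s ?z (M + a)) \<longlonglongrightarrow> 0" if "degree s < n" for s a
    using lim[of s a] that by (simp add: coeff_eq_0 split: if_splits)
  note lim0S = lim0[of _ 1, simplified]
  note lim00 = lim0[of _ 0, simplified]
  have comp: "degree (pcompose s [:1, 1:]) = degree s" for s :: "real poly" by (simp add: degree_pcompose)
  have v0: "(\<lambda>M. bump_fun n s p b (Suc M) x) \<longlonglongrightarrow> 0" if "degree s < n" for s
    using tendsto_Re[OF lim0S[OF that]] by (simp add: bump_fun_def)
  have v1: "(\<lambda>M. pd u (radial_ext (bump_fun n s p b (Suc M))) x) \<longlonglongrightarrow> 0" if "degree (X * s) < n" for s
  proof -
    have "(\<lambda>M. Re (planar p b u * bump_sum n (pcompose (X * s) [:1, 1:]) ?z M)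
        - (x \<bullet> u) * Re (bump_sum n (X * s) ?z (Suc M))) \<longlonglongrightarrow> Re (planar p b u * 0) - (x \<bullet> u) * Re 0"
      using that by (intro tendsto_intros lim0S lim00) (simp_all only: comp)
    then show ?thesis unfolding pd_bump_fun[OF pb x] X_def by simp
  qed
  have v2: "(\<lambda>M. sphere_lap (bump_fun n s p b (Suc M)) x) \<longlonglongrightarrow>
      - Re (if x = p then of_real (fact n * 2 ^ Suc n * coeff (E * s) n) else 0)" if "degree (E * s) \<le> n" for s
    unfolding sphere_lap_bump_fun[OF pb x dim] E_def[symmetric]
    using tendsto_minus[OF tendsto_Re[OF lim[OF that, of 1]]] by simp
  have k: "k \<in> {0, 1, 2, 3, 4, 5}" using k by auto
  have v2_1: "(\<lambda>M. sphere_lap (bump_fun n 1 p b (Suc M)) x) \<longlonglongrightarrow> 0"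
    using v2[of 1] deg n by (simp add: coeff_eq_0 split: if_splits)
  show ?thesis
    using k v2_1 v0[of 1] v1[of 1] v0[of ?P] v1[of ?P] v2[of ?P] deg lead n P_poly(2)[of n]
    by (auto simp: jet_def)
qed

text \<open>The sum of the bumps at the points of A, scaled by the wanted values, has the required
  jet in the limit; by finite-dimensionality some pair has it exactly.\<close>

lemma jet_interpolation:
  fixes A :: "'a::euclidean_space set"
  assumes n: "n \<ge> 3" and dim: "DIM('a) = n + 1" and A: "finite A" "\<And>p. p \<in> A \<Longrightarrow> norm p = 1"
  obtains h g where "P_pair n h g"
    "\<And>p. p \<in> A \<Longrightarrow> h p = 0" "\<And>p u. p \<in> A \<Longrightarrow> pd u (radial_ext h) p = 0"
    "\<And>p. p \<in> A \<Longrightarrow> sphere_lap h p = 0" "\<And>p. p \<in> A \<Longrightarrow> g p = 0"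
    "\<And>p u. p \<in> A \<Longrightarrow> pd u (radial_ext g) p = 0" "\<And>p. p \<in> A \<Longrightarrow> sphere_lap g p = a p"
proof -
  have "\<exists>b. norm b = 1 \<and> p \<bullet> b = 0 \<and>
      (\<forall>x\<in>A. x \<noteq> p \<longrightarrow> x \<noteq> - p \<longrightarrow> norm (planar p b x) < 1)" if "p \<in> A" for p
    using planar_direction_exists[of p A] that A n dim by (metis add_le_mono1 le_trans numeral_le_iff
      semiring_norm(69) trans_le_add1)
  then obtain b where b: "\<And>p. p \<in> A \<Longrightarrow> norm (b p) = 1" "\<And>p. p \<in> A \<Longrightarrow> p \<bullet> b p = 0"
    "\<And>p x. p \<in> A \<Longrightarrow> x \<in> A \<Longrightarrow> x \<noteq> p \<Longrightarrow> x \<noteq> - p \<Longrightarrow> norm (planar p (b p) x) < 1"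
    by metis
  \<comment> \<open>The limit of the Laplacian of the second component of a bump at its own
    pole.\<close>
  define \<kappa> where "\<kappa> = - (fact n * 2 ^ Suc n :: real)"
  have \<kappa>: "\<kappa> \<noteq> 0" by (simp add: \<kappa>_def)
  define I where "I = A \<times> {..5::nat} \<times> (Basis :: 'a set)"
  define V where "V = {jet h g | (h :: 'a \<Rightarrow> real) g. P_pair n h g}"
  \<comment> \<open>Jets add up only at nonzero base points. Allowing every function that agrees
    with a jet on \<open>I\<close> makes the set a subspace.\<close>
  define V' where "V' = {u. \<exists>w\<in>V. \<forall>i\<in>I. u i = w i}"
  have I0: "fst i \<noteq> 0" if "i \<in> I" for i using that A(2)[of "fst i"] by (auto simp: I_def)
  define v where "v M p = bump_fun n 1 p (b p) (Suc M)" for M p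
  define f where "f M p = bump_fun n (P_poly n) p (b p) (Suc M)" for M p
  have vf: "P_pair n (v M p) (f M p)" if "p \<in> A" for M p
    unfolding v_def f_def by (rule P_pair_bump_fun) (use A b that in auto)
  define w where "w M = jet (\<lambda>x. \<Sum>p\<in>A. (a p / \<kappa>) * v M p x) (\<lambda>x. \<Sum>p\<in>A. (a p / \<kappa>) * f M p x)" for M
  define t where "t = (\<lambda>(x, k, u :: 'a). if k = (5::nat) then a x else 0)"
  have "\<exists>u\<in>V'. \<forall>i\<in>I. u i = t i"
  proof (rule limit_in_subspace_finite[where w = w])
    show "finite I" using A(1) by (simp add: I_def)
    have "jet (\<lambda>x. 0) (\<lambda>x. 0) \<in> V" unfolding V_def using P_pair_zero by blast
    moreover have "jet (\<lambda>x. 0) (\<lambda>x. 0) i = 0" if "i \<in> I" for i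
      using jet_cmult[OF P_pair_zero I0[OF that], where c = 0] by simp
    ultimately show "(\<lambda>i. 0) \<in> V'" unfolding V'_def
      by (intro CollectI bexI[of _ "jet (\<lambda>x. 0) (\<lambda>x. 0)"]) auto
    fix u u' assume "u \<in> V'" "u' \<in> V'"
    then obtain h g h' g' where hg: "P_pair n h g" "P_pair n h' g'"
      "\<forall>i\<in>I. u i = jet h g i" "\<forall>i\<in>I. u' i = jet h' g' i"
      by (auto simp: V'_def V_def)
    have "jet (\<lambda>x. h x + h' x) (\<lambda>x. g x + g' x) \<in> V" using P_pair_add[OF hg(1,2)] by (auto simp: V_def)
    then show "(\<lambda>i. u i + u' i) \<in> V'" unfolding V'_def
      using hg I0 jet_add[OF hg(1,2)] by (intro CollectI bexI) auto
  next
    fix c u assume "u \<in> V'"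
    then obtain h g where hg: "P_pair n h g" "\<forall>i\<in>I. u i = jet h g i"
      by (auto simp: V'_def V_def)
    have "jet (\<lambda>x. c * h x) (\<lambda>x. c * g x) \<in> V" using P_pair_cmult[OF hg(1)] by (auto simp: V_def)
    then show "(\<lambda>i. c * u i) \<in> V'" unfolding V'_def
      using hg I0 jet_cmult[OF hg(1)] by (intro CollectI bexI) auto
  next
    fix M
    have "P_pair n (\<lambda>x. \<Sum>p\<in>A. (a p / \<kappa>) * v M p x) (\<lambda>x. \<Sum>p\<in>A. (a p / \<kappa>) * f M p x)"
      by (intro P_pair_sum P_pair_cmult vf)
    then have "w M \<in> V" unfolding w_def V_def by blast
    then show "w M \<in> V'" by (auto simp: V'_def)
  next
    fix i assume i: "i \<in> I"
    then obtain x k u where xk: "i = (x, k, u)" "x \<in> A" "k \<le> 5" by (auto simp: I_def)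
    have "w M i = (\<Sum>p\<in>A. (a p / \<kappa>) * jet (v M p) (f M p) i)" for M
    proof -
      have "w M i = (\<Sum>p\<in>A. jet (\<lambda>x. (a p / \<kappa>) * v M p x) (\<lambda>x. (a p / \<kappa>) * f M p x) i)"
        unfolding w_def by (rule jet_sum[OF P_pair_cmult[OF vf] I0[OF i]])
      then show ?thesis using jet_cmult[OF vf I0[OF i]] by (simp only: cong: sum.cong)
    qed
    moreover have "(\<lambda>M. \<Sum>p\<in>A. (a p / \<kappa>) * jet (v M p) (f M p) i) \<longlonglongrightarrow>
        (\<Sum>p\<in>A. (a p / \<kappa>) * (if x = p \<and> k = 5 then - (fact n * 2 ^ Suc n) else 0))"
      unfolding v_def f_def xk(1)
      by (intro tendsto_sum tendsto_mult tendsto_const jet_bump_fun_limit[OF n dim])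
        (use A b xk in auto)
    moreover have "(\<Sum>p\<in>A. (a p / \<kappa>) * (if x = p \<and> k = 5 then - (fact n * 2 ^ Suc n) else 0)) = t i"
    proof -
      have "(\<Sum>p\<in>A. (a p / \<kappa>) * (if x = p \<and> k = 5 then - (fact n * 2 ^ Suc n) else 0))
          = (\<Sum>p\<in>A. if x = p then t i else 0)"
        using \<kappa> by (intro sum.cong refl) (auto simp: t_def xk(1) \<kappa>_def)
      then show ?thesis using xk(2) A(1) by simp
    qed
    ultimately show "(\<lambda>M. w M i) \<longlonglongrightarrow> t i" by simp
  qed
  then obtain h g where hg: "P_pair n h g" "\<And>i. i \<in> I \<Longrightarrow> jet h g i = t i"
    unfolding V'_def V_def by auto
  have mem: "(p, k, u) \<in> I" if "p \<in> A" "k \<le> 5" "u \<in> Basis" for p k u using that by (simp add: I_def)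
  have dd: "radial_ext h differentiable at p" "radial_ext g differentiable at p" if "p \<in> A" for p
    using P_pair_Cinf[OF hg(1)] A(2)[OF that] by (auto intro!: Cinf_on_differentiable)
  obtain e :: 'a where e: "e \<in> Basis" using nonempty_Basis by blast
  show ?thesis
  proof (rule that[OF hg(1)])
    fix p u assume p: "p \<in> A"
    show "h p = 0" using hg(2)[OF mem[OF p _ e, of 0]] by (simp add: jet_def t_def)
    show "sphere_lap h p = 0" using hg(2)[OF mem[OF p _ e, of 2]] by (simp add: jet_def t_def)
    show "g p = 0" using hg(2)[OF mem[OF p _ e, of 3]] by (simp add: jet_def t_def)
    show "sphere_lap g p = a p" using hg(2)[OF mem[OF p _ e, of 5]] by (simp add: jet_def t_def)
    have "pd c (radial_ext h) p = 0" "pd c (radial_ext g) p = 0" if "c \<in> Basis" for c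
      using hg(2)[OF mem[OF p _ that, of 1]] hg(2)[OF mem[OF p _ that, of 4]] by (simp_all add: jet_def t_def)
    then show "pd u (radial_ext h) p = 0" "pd u (radial_ext g) p = 0"
      by (subst pd_euclidean, use dd[OF p] in simp, simp)+
  qed
qed

section \<open>Critical points of \<open>f / v\<^sup>n\<^sup>-\<^sup>1\<close>\<close>

text \<open>Up to a positive factor, the gradient of \<open>f / v\<^sup>n\<^sup>-\<^sup>1\<close> is a quadratic form in the jet of \<open>(v, f)\<close>.\<close>

definition egrad :: "nat \<Rightarrow> ('a::euclidean_space \<Rightarrow> real) \<Rightarrow> ('a \<Rightarrow> real) \<Rightarrow> 'a \<Rightarrow> 'a \<Rightarrow> real" where
  "egrad n v f u x = radial_ext v x * pd u (radial_ext f) x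
     - (real n - 1) * (radial_ext f x * pd u (radial_ext v) x)"

definition ehess :: "nat \<Rightarrow> ('a::euclidean_space \<Rightarrow> real) \<Rightarrow> ('a \<Rightarrow> real) \<Rightarrow> 'a \<Rightarrow> 'a \<Rightarrow> 'a \<Rightarrow> real" where
  "ehess n v f u w x =
     radial_ext v x * pd w (pd u (radial_ext f)) x + pd w (radial_ext v) x * pd u (radial_ext f) x
     - (real n - 1) * (radial_ext f x * pd w (pd u (radial_ext v)) x
         + pd w (radial_ext f) x * pd u (radial_ext v) x)"

lemma Cinf_jet_differentiable:
  assumes "Cinf_on (- {0}) (radial_ext v)" "x \<noteq> 0"
  shows "radial_ext v differentiable at x" "pd u (radial_ext v) differentiable at x"
  using assms Cinf_on_differentiable[OF assms(1)] Cinf_on_differentiable[OF Cinf_on_pd[OF assms(1)]] by auto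

lemma has_derivative_egrad:
  assumes v: "Cinf_on (- {0}) (radial_ext v)" and f: "Cinf_on (- {0}) (radial_ext f)" and x: "x \<noteq> 0"
  shows "(egrad n v f u has_derivative (\<lambda>w. ehess n v f u w x)) (at x)"
  unfolding egrad_def ehess_def
  by (intro has_derivative_diff has_derivative_mult has_derivative_mult_right has_derivative_pd
      Cinf_jet_differentiable[OF v x] Cinf_jet_differentiable[OF f x])

lemma pd_egrad:
  assumes "Cinf_on (- {0}) (radial_ext v)" "Cinf_on (- {0}) (radial_ext f)" "x \<noteq> 0"
  shows "pd w (egrad n v f u) x = ehess n v f u w x"
  by (rule pd_eq[OF has_derivative_egrad[OF assms]])

lemma egrad_expand:
  assumes v: "Cinf_on (- {0}) (radial_ext v)" and f: "Cinf_on (- {0}) (radial_ext f)" and x: "x \<noteq> 0"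
  shows "egrad n v f u x = (\<Sum>b\<in>Basis. (u \<bullet> b) * egrad n v f b x)"
  unfolding egrad_def
  by (subst (1 2) pd_euclidean)
    (auto simp: Cinf_jet_differentiable[OF v x] Cinf_jet_differentiable[OF f x]
      sum_distrib_left sum_subtractf[symmetric] algebra_simps intro!: sum.cong)

lemma ehess_expand_left:
  assumes v: "Cinf_on (- {0}) (radial_ext v)" and f: "Cinf_on (- {0}) (radial_ext f)" and x: "x \<noteq> 0"
  shows "ehess n v f u w x = (\<Sum>b\<in>Basis. (u \<bullet> b) * ehess n v f b w x)"
proof -
  have "((\<lambda>x. \<Sum>b\<in>Basis. (u \<bullet> b) * egrad n v f b x) has_derivative
      (\<lambda>w. \<Sum>b\<in>Basis. (u \<bullet> b) * ehess n v f b w x)) (at x)"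
    by (intro has_derivative_sum has_derivative_mult_right has_derivative_egrad assms)
  then have "pd w (\<lambda>x. \<Sum>b\<in>Basis. (u \<bullet> b) * egrad n v f b x) x = (\<Sum>b\<in>Basis. (u \<bullet> b) * ehess n v f b w x)"
    by (rule pd_eq)
  moreover have "pd w (egrad n v f u) x = pd w (\<lambda>x. \<Sum>b\<in>Basis. (u \<bullet> b) * egrad n v f b x) x"
    by (rule pd_cong_open[of "- {0}"]) (use x egrad_expand[OF v f] in auto)
  ultimately show ?thesis using pd_egrad[OF assms] by simp
qed

lemma egrad_scaleR:
  assumes v: "Cinf_on (- {0}) (radial_ext v)" and f: "Cinf_on (- {0}) (radial_ext f)"
    and "x \<noteq> 0" "t > 0"
  shows "egrad n v f u (t *\<^sub>R x) = inverse t * egrad n v f u x"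
  using pd_radial_ext_scaleR[OF Cinf_on_Ck_on[OF v], of x t u]
    pd_radial_ext_scaleR[OF Cinf_on_Ck_on[OF f], of x t u] assms
  by (simp add: egrad_def radial_ext_scaleR algebra_simps)

lemma ehess_scaleR:
  assumes v: "Cinf_on (- {0}) (radial_ext v)" and f: "Cinf_on (- {0}) (radial_ext f)"
    and "x \<noteq> 0" "t > 0"
  shows "ehess n v f u w (t *\<^sub>R x) = inverse (t\<^sup>2) * ehess n v f u w x"
proof -
  have "t *\<^sub>R x \<noteq> 0" using assms by simp
  have d: "egrad n v f u differentiable at y" if "y \<noteq> 0" for y
    using has_derivative_egrad[OF v f that] differentiableI by blast
  have "t * pd w (egrad n v f u) (t *\<^sub>R x) = inverse t * pd w (egrad n v f u) x"
    by (rule pd_at_scaleR) (use d assms egrad_scaleR[OF v f] in auto)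
  then show ?thesis
    using assms pd_egrad[OF v f] by (simp add: field_simps power2_eq_square)
qed

lemma radial_ext_curv: "radial_ext (curv n c v f) x = radial_ext f x * inverse (c * radial_ext v x ^ (n - 1))"
  by (simp add: curv_def radial_ext_def)

lemma radial_ext_pos:
  assumes "\<forall>x\<in>sphere 0 1. v x > 0" "x \<noteq> 0" shows "radial_ext v x > 0"
  using assms(1)[rule_format, of "x /\<^sub>R norm x"] assms(2) by (simp add: radial_ext_def)

lemma Cinf_curv:
  assumes v: "Cinf_on (- {0}) (radial_ext v)" and f: "Cinf_on (- {0}) (radial_ext f)"
    and pos: "\<forall>x\<in>sphere 0 1. v x > 0" and c: "c > 0"
  shows "Cinf_on (- {0}) (radial_ext (curv n c v f))"
  unfolding radial_ext_curv[abs_def]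
  using order_less_imp_not_eq2[OF radial_ext_pos[OF pos]] c
  by (intro Cinf_on_mult[OF open_minus_zero f] Cinf_on_inverse[OF open_minus_zero]
      Cinf_on_cmult[OF open_minus_zero] Cinf_on_power[OF open_minus_zero] v) auto

lemma pd_curv:
  assumes v: "Cinf_on (- {0}) (radial_ext v)" and f: "Cinf_on (- {0}) (radial_ext f)"
    and pos: "\<forall>x\<in>sphere 0 1. v x > 0" and c: "c > 0" and n: "n \<ge> 1" and x: "x \<noteq> 0"
  shows "pd u (radial_ext (curv n c v f)) x = egrad n v f u x * inverse (c * radial_ext v x ^ n)"
proof -
  have V: "radial_ext v x > 0" by (rule radial_ext_pos[OF pos x])
  obtain k where k: "n = Suc k" using n by (cases n) auto
  have "(radial_ext (curv n c v f) has_derivative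
     (\<lambda>u. egrad n v f u x * inverse (c * radial_ext v x ^ n))) (at x)"
    unfolding radial_ext_curv[abs_def] k
    apply (rule has_derivative_eq_rhs)
     apply (rule has_derivative_mult[OF has_derivative_pd[OF Cinf_jet_differentiable(1)[OF f x]]
          Deriv.has_derivative_inverse[OF _ has_derivative_mult_right[OF has_derivative_power[OF
            has_derivative_pd[OF Cinf_jet_differentiable(1)[OF v x]]]]]])
    using V c apply simp
    using V c by (cases k) (auto simp: egrad_def fun_eq_iff field_simps)
  then show ?thesis by (rule pd_eq)
qed

lemma crit_curv_iff:
  assumes v: "Cinf_on (- {0}) (radial_ext v)" and f: "Cinf_on (- {0}) (radial_ext f)"
    and pos: "\<forall>x\<in>sphere 0 1. v x > 0" and c: "c > 0" and n: "n \<ge> 1"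
  shows "x \<in> crit (curv n c v f) \<longleftrightarrow> norm x = 1 \<and> (\<forall>b\<in>Basis. egrad n v f b x = 0)"
proof -
  have "pd b (radial_ext (curv n c v f)) x = 0 \<longleftrightarrow> egrad n v f b x = 0" if "norm x = 1" for b
  proof -
    have "x \<noteq> 0" using that by auto
    then show ?thesis using pd_curv[OF v f pos c n, of x b] radial_ext_pos[OF pos, of x] c by simp
  qed
  then show ?thesis by (auto simp: crit_def sphere_grad_eq_0_iff)
qed

text \<open>In the product rule the derivative of the factor 1 / (c v^n) is multiplied by
  \<open>egrad\<close>, which vanishes at a critical point.\<close>

lemma sphere_hess_curv:
  assumes v: "Cinf_on (- {0}) (radial_ext v)" and f: "Cinf_on (- {0}) (radial_ext f)"
    and pos: "\<forall>x\<in>sphere 0 1. v x > 0" and c: "c > 0" and n: "n \<ge> 1"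
    and x: "x \<in> crit (curv n c v f)"
  shows "sphere_hess (curv n c v f) x u w = ehess n v f u w x * inverse (c * radial_ext v x ^ n)"
proof -
  have x1: "norm x = 1" and e: "\<And>b. b \<in> Basis \<Longrightarrow> egrad n v f b x = 0"
    using x crit_curv_iff[OF v f pos c n] by auto
  have x0: "x \<noteq> 0" using x1 by auto
  have eu: "egrad n v f u x = 0" using egrad_expand[OF v f x0, of n u] e by simp
  have "Cinf_on (- {0}) (\<lambda>x. inverse (c * radial_ext v x ^ n))"
    using order_less_imp_not_eq2[OF radial_ext_pos[OF pos]] c
    by (intro Cinf_on_inverse[OF open_minus_zero] Cinf_on_cmult[OF open_minus_zero]
        Cinf_on_power[OF open_minus_zero] v) auto
  then have d: "(\<lambda>x. inverse (c * radial_ext v x ^ n)) differentiable at x"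
    using x0 by (intro Cinf_on_differentiable) auto
  have d': "egrad n v f u differentiable at x"
    using has_derivative_egrad[OF v f x0] differentiableI by blast
  have "pd w (pd u (radial_ext (curv n c v f))) x
      = pd w (\<lambda>x. egrad n v f u x * inverse (c * radial_ext v x ^ n)) x"
    by (rule pd_cong_open[of "- {0}"]) (use x0 pd_curv[OF v f pos c n] in auto)
  then show ?thesis
    unfolding sphere_hess_eq by (simp only: pd_mult[OF d' d] eu pd_egrad[OF v f x0])
qed

text \<open>Unit vectors u make the condition accessible to compactness, and the subset C allows
  patching. Any basis vector w is allowed: at a critical point the second derivative in the radial
  direction vanishes, so the tangential part of w already has the same value.\<close>

definition morse_on :: "nat \<Rightarrow> ('a::euclidean_space \<Rightarrow> real) \<Rightarrow> ('a \<Rightarrow> real) \<Rightarrow> 'a set \<Rightarrow> bool" where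
  "morse_on n v f C \<longleftrightarrow> (\<forall>x\<in>C. (\<forall>b\<in>Basis. egrad n v f b x = 0) \<longrightarrow>
     (\<forall>u. norm u = 1 \<and> u \<bullet> x = 0 \<longrightarrow> (\<exists>w\<in>Basis. ehess n v f u w x \<noteq> 0)))"

lemma morse_curv:
  assumes v: "Cinf_on (- {0}) (radial_ext v)" and f: "Cinf_on (- {0}) (radial_ext f)"
    and pos: "\<forall>x\<in>sphere 0 1. v x > 0" and c: "c > 0" and n: "n \<ge> 1"
    and good: "morse_on n v f (sphere 0 1)"
  shows "morse (curv n c v f)"
  unfolding morse_def
proof (intro conjI ballI)
  let ?K = "curv n c v f"
  have K: "Cinf_on (- {0}) (radial_ext ?K)" by (rule Cinf_curv[OF v f pos c])
  show "?K \<in> sphere_Ck 2" using K by (simp add: sphere_Ck_iff Cinf_on_Ck_on)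
  fix q assume q: "q \<in> crit ?K"
  have q1: "norm q = 1" and e: "\<And>b. b \<in> Basis \<Longrightarrow> egrad n v f b q = 0"
    using q crit_curv_iff[OF v f pos c n] by auto
  have q0: "q \<noteq> 0" using q1 by auto
  show "nondegenerate_at ?K q"
    unfolding nondegenerate_at_def
  proof (intro allI impI, elim conjE)
    fix u assume u: "u \<bullet> q = 0" "u \<noteq> 0"
    define u' where "u' = u /\<^sub>R norm u"
    have u': "norm u' = 1" "u' \<bullet> q = 0" using u by (auto simp: u'_def)
    then obtain b where b: "b \<in> Basis" "ehess n v f u' b q \<noteq> 0"
      using good e q1 unfolding morse_on_def by (metis mem_sphere_0)
    \<comment> \<open>The tangential part of b; \<open>hq\<close> shows that dropping the radial
      part does not change the Hessian.\<close>
    define w where "w = b - (b \<bullet> q) *\<^sub>R q"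
    have wq: "w \<bullet> q = 0" using q1 by (simp add: w_def inner_diff_left norm_eq_1)
    have dK: "pd u (radial_ext ?K) differentiable at q" by (rule Cinf_jet_differentiable(2)[OF K q0])
    have eu: "pd u (radial_ext ?K) q = 0"
      using pd_curv[OF v f pos c n q0] egrad_expand[OF v f q0, of n u] e by simp
    have hq: "sphere_hess ?K q u q = 0"
      using pd_pd_radial_ext_radial[OF Cinf_on_Ck_on[OF K] q0, of u] eu by (simp add: sphere_hess_eq)
    have "b = w + (b \<bullet> q) *\<^sub>R q" by (simp add: w_def)
    then have "sphere_hess ?K q u b = sphere_hess ?K q u w + (b \<bullet> q) * sphere_hess ?K q u q"
      unfolding sphere_hess_eq using pd_arg_add[OF dK, of w "(b \<bullet> q) *\<^sub>R q"] pd_arg_scaleR[OF dK]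
      by simp
    then have eq: "sphere_hess ?K q u b = sphere_hess ?K q u w" using hq by simp
    have "ehess n v f u' b q = inverse (norm u) * ehess n v f u b q"
      unfolding ehess_expand_left[OF v f q0, of n u' b] ehess_expand_left[OF v f q0, of n u b]
      by (simp add: u'_def sum_distrib_left mult.assoc)
    then have "ehess n v f u b q \<noteq> 0" using b by auto
    then have "sphere_hess ?K q u b \<noteq> 0"
      using sphere_hess_curv[OF v f pos c n q] radial_ext_pos[OF pos q0] c by simp
    then show "\<exists>w. w \<bullet> q = 0 \<and> sphere_hess ?K q u w \<noteq> 0" using wq eq by auto
  qed
qed

section \<open>Finite-dimensional linear perturbations\<close>

text \<open>The parameter space is left open: it is the ambient space in the Sard argument and the
  real line for the final one-parameter shift.\<close>

definition perturb :: "('a \<Rightarrow> real) \<Rightarrow> ('b::euclidean_space \<Rightarrow> 'a \<Rightarrow> real) \<Rightarrow> 'b \<Rightarrow> 'a \<Rightarrow> real" where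
  "perturb v h w x = v x + (\<Sum>b\<in>Basis. (w \<bullet> b) * h b x)"

lemma P_pair_perturb:
  assumes "P_pair n v f" "\<And>b. b \<in> Basis \<Longrightarrow> P_pair n (h b) (g b)"
  shows "P_pair n (perturb v h w) (perturb f g w)"
  unfolding perturb_def[abs_def] by (intro P_pair_add assms P_pair_sum P_pair_cmult)

lemma radial_ext_perturb:
  "radial_ext (perturb v h w) = perturb (radial_ext v) (\<lambda>b. radial_ext (h b)) w"
  by (simp add: radial_ext_def perturb_def fun_eq_iff)

lemma pd_perturb:
  assumes "v differentiable at x" "\<And>b. b \<in> Basis \<Longrightarrow> h b differentiable at x"
  shows "pd u (perturb v h w) x = perturb (pd u v) (\<lambda>b. pd u (h b)) w x"
proof -
  have "(perturb v h w has_derivative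
      (\<lambda>u. pd u v x + (\<Sum>b\<in>Basis. (w \<bullet> b) * pd u (h b) x))) (at x)"
    unfolding perturb_def[abs_def]
    by (intro has_derivative_add has_derivative_sum has_derivative_mult_right has_derivative_pd assms)
  then show ?thesis by (simp add: pd_eq perturb_def)
qed

context
  fixes v :: "'a::euclidean_space \<Rightarrow> real" and h :: "'b::euclidean_space \<Rightarrow> 'a \<Rightarrow> real"
  assumes v: "Cinf_on (- {0}) (radial_ext v)"
    and h: "\<And>b. b \<in> Basis \<Longrightarrow> Cinf_on (- {0}) (radial_ext (h b))"
begin

lemma pd_radial_ext_perturb:
  "x \<noteq> 0 \<Longrightarrow> pd u (radial_ext (perturb v h w)) x
     = perturb (pd u (radial_ext v)) (\<lambda>b. pd u (radial_ext (h b))) w x"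
  unfolding radial_ext_perturb using Cinf_jet_differentiable(1)[OF v] Cinf_jet_differentiable(1)[OF h]
  by (intro pd_perturb) auto

lemma pd_pd_radial_ext_perturb:
  assumes "x \<noteq> 0"
  shows "pd u' (pd u (radial_ext (perturb v h w))) x
     = perturb (pd u' (pd u (radial_ext v))) (\<lambda>b. pd u' (pd u (radial_ext (h b)))) w x"
proof -
  have "pd u' (pd u (radial_ext (perturb v h w))) x
      = pd u' (perturb (pd u (radial_ext v)) (\<lambda>b. pd u (radial_ext (h b))) w) x"
    by (rule pd_cong_open[of "- {0}"]) (use assms pd_radial_ext_perturb in auto)
  also have "\<dots> = perturb (pd u' (pd u (radial_ext v))) (\<lambda>b. pd u' (pd u (radial_ext (h b)))) w x"
    using Cinf_jet_differentiable(2)[OF v assms] Cinf_jet_differentiable(2)[OF h assms]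
    by (intro pd_perturb) auto
  finally show ?thesis .
qed

end

lemma continuous_on_perturb:
  assumes "continuous_on S v" "\<And>b. b \<in> Basis \<Longrightarrow> continuous_on S (h b)" "\<And>z. z \<in> T \<Longrightarrow> X z \<in> S"
    "continuous_on T W" "continuous_on T X"
  shows "continuous_on T (\<lambda>z. perturb v h (W z) (X z))"
  unfolding perturb_def
  by (intro continuous_intros assms continuous_on_compose2[OF assms(1)] continuous_on_compose2[OF assms(2)])
    (use assms(3) in auto)

text \<open>Degeneracy is the vanishing of one continuous function \<Theta> of parameter, point and
  direction. It is bounded away from 0 on the compact set at parameter 0, hence by uniform
  continuity for all small parameters.\<close>

lemma morse_on_perturb:
  fixes v f :: "'a::euclidean_space \<Rightarrow> real" and h g :: "'b::euclidean_space \<Rightarrow> 'a \<Rightarrow> real"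
  assumes vf: "P_pair n v f" and hg: "\<And>b. b \<in> Basis \<Longrightarrow> P_pair n (h b) (g b)"
    and C: "compact C" "C \<subseteq> sphere 0 1" and good: "morse_on n v f C"
  obtains \<delta> where "\<delta> > 0" "\<And>w. norm w < \<delta> \<Longrightarrow> morse_on n (perturb v h w) (perturb f g w) C"
proof -
  note cv = P_pair_Cinf[OF vf] and ch = P_pair_Cinf[OF hg]
  \<comment> \<open>A sum of squares combines the conditions of being critical, tangent and
    degenerate. The Hessian is expanded in u so that continuity in u is visible.\<close>
  define \<Theta> where "\<Theta> = (\<lambda>z :: 'b \<times> 'a \<times> 'a.
      (\<Sum>b\<in>Basis. (egrad n (perturb v h (fst z)) (perturb f g (fst z)) b (fst (snd z)))\<^sup>2)
      + (snd (snd z) \<bullet> fst (snd z))\<^sup>2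
      + (\<Sum>c\<in>Basis. (\<Sum>b\<in>Basis. (snd (snd z) \<bullet> b) *
            ehess n (perturb v h (fst z)) (perturb f g (fst z)) b c (fst (snd z)))\<^sup>2))"
  have nz: "\<Theta> (w, x, u) \<noteq> 0 \<longleftrightarrow> ((\<forall>b\<in>Basis. egrad n (perturb v h w) (perturb f g w) b x = 0) \<and> u \<bullet> x = 0
      \<longrightarrow> (\<exists>c\<in>Basis. ehess n (perturb v h w) (perturb f g w) u c x \<noteq> 0))" if "x \<noteq> 0" for w x u
  proof -
    have P: "P_pair n (perturb v h w) (perturb f g w)" by (rule P_pair_perturb[OF vf hg])
    have sq: "(\<Sum>i\<in>Basis. (q i)\<^sup>2) = 0 \<longleftrightarrow> (\<forall>i\<in>Basis. q i = 0)" for q :: "'a \<Rightarrow> real"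
      by (simp add: sum_nonneg_eq_0_iff)
    have nn: "(\<Sum>i\<in>Basis. (q i)\<^sup>2) \<ge> 0" for q :: "'a \<Rightarrow> real" by (simp add: sum_nonneg)
    let ?S1 = "\<Sum>b\<in>Basis. (egrad n (perturb v h w) (perturb f g w) b x)\<^sup>2"
    let ?S3 = "\<Sum>c\<in>Basis. (ehess n (perturb v h w) (perturb f g w) u c x)\<^sup>2"
    have "\<Theta> (w, x, u) = ?S1 + (u \<bullet> x)\<^sup>2 + ?S3"
      unfolding ehess_expand_left[OF P_pair_Cinf[OF P] that, of n u] by (simp add: \<Theta>_def)
    then have "\<Theta> (w, x, u) = 0 \<longleftrightarrow> ?S1 = 0 \<and> (u \<bullet> x)\<^sup>2 = 0 \<and> ?S3 = 0"
      using nn[of "\<lambda>b. egrad n (perturb v h w) (perturb f g w) b x"]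
        nn[of "\<lambda>c. ehess n (perturb v h w) (perturb f g w) u c x"]
      by (simp add: add_nonneg_eq_0_iff)
    then show ?thesis unfolding sq by auto
  qed
  have cont: "continuous_on (UNIV \<times> (- {0}) \<times> UNIV) \<Theta>"
  proof -
    let ?T = "UNIV \<times> (- {0}) \<times> UNIV :: ('b \<times> 'a \<times> 'a) set"
    have X: "continuous_on ?T (\<lambda>z. fst (snd z))" "continuous_on ?T fst" "continuous_on ?T (\<lambda>z. snd (snd z))"
      by (auto intro!: continuous_intros)
    have j0: "continuous_on ?T (\<lambda>z. radial_ext (perturb V H (fst z)) (fst (snd z)))"
      and j1: "continuous_on ?T (\<lambda>z. pd b (radial_ext (perturb V H (fst z))) (fst (snd z)))"
      and j2: "continuous_on ?T (\<lambda>z. pd c (pd b (radial_ext (perturb V H (fst z)))) (fst (snd z)))"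
      if V: "Cinf_on (- {0}) (radial_ext V)" and H: "\<And>b. b \<in> Basis \<Longrightarrow> Cinf_on (- {0}) (radial_ext (H b))"
      for V :: "'a \<Rightarrow> real" and H :: "'b \<Rightarrow> 'a \<Rightarrow> real" and b c
    proof -
      show "continuous_on ?T (\<lambda>z. radial_ext (perturb V H (fst z)) (fst (snd z)))"
        unfolding radial_ext_perturb
        by (rule continuous_on_perturb[OF Cinf_on_continuous[OF V] Cinf_on_continuous[OF H] _ X(2,1)]) auto
      have "continuous_on ?T (\<lambda>z. perturb (pd b (radial_ext V)) (\<lambda>e. pd b (radial_ext (H e))) (fst z) (fst (snd z)))"
        by (rule continuous_on_perturb[OF Cinf_on_continuous[OF Cinf_on_pd[OF V]]
              Cinf_on_continuous[OF Cinf_on_pd[OF H]] _ X(2,1)]) auto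
      then show "continuous_on ?T (\<lambda>z. pd b (radial_ext (perturb V H (fst z))) (fst (snd z)))"
        by (rule continuous_on_eq) (rule pd_radial_ext_perturb[OF V H, symmetric], auto)
      have "continuous_on ?T (\<lambda>z. perturb (pd c (pd b (radial_ext V))) (\<lambda>e. pd c (pd b (radial_ext (H e)))) (fst z) (fst (snd z)))"
        by (rule continuous_on_perturb[OF Cinf_on_continuous[OF Cinf_on_pd[OF Cinf_on_pd[OF V]]]
              Cinf_on_continuous[OF Cinf_on_pd[OF Cinf_on_pd[OF H]]] _ X(2,1)]) auto
      then show "continuous_on ?T (\<lambda>z. pd c (pd b (radial_ext (perturb V H (fst z)))) (fst (snd z)))"
        by (rule continuous_on_eq) (rule pd_pd_radial_ext_perturb[OF V H, symmetric], auto)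
    qed
    show ?thesis
      unfolding \<Theta>_def egrad_def ehess_def
      by (intro continuous_on_add continuous_on_diff continuous_on_mult continuous_on_power continuous_on_sum
          continuous_on_const continuous_on_inner X j0 j1 j2 cv ch)
  qed
  show ?thesis
  proof (cases "C = {}")
    case True
    then show ?thesis using that[of 1] by (simp add: morse_on_def)
  next
    case False
    let ?D = "C \<times> sphere 0 1 :: ('a \<times> 'a) set"
    let ?Z = "cball 0 1 \<times> ?D :: ('b \<times> 'a \<times> 'a) set"
    have C0: "x \<noteq> 0" if "x \<in> C" for x using that C(2) by auto
    have Z: "compact ?Z" "compact ?D" using C(1) by (auto intro!: compact_Times)
    have cZ: "continuous_on ?Z \<Theta>" by (rule continuous_on_subset[OF cont]) (use C0 in auto)
    then have uc: "uniformly_continuous_on ?Z \<Theta>" using Z compact_uniformly_continuous by blast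
    have ne: "?D \<noteq> {}" using False by auto
    have pert0: "perturb V H 0 = V" for V :: "'a \<Rightarrow> real" and H :: "'b \<Rightarrow> 'a \<Rightarrow> real"
      by (simp add: perturb_def fun_eq_iff)
    have "continuous_on ?D (\<lambda>y. \<bar>\<Theta> (0, y)\<bar>)"
      by (rule continuous_on_rabs, rule continuous_on_compose2[OF cZ]) (auto intro!: continuous_intros)
    then obtain y0 where y0: "y0 \<in> ?D" "\<And>y. y \<in> ?D \<Longrightarrow> \<bar>\<Theta> (0, y0)\<bar> \<le> \<bar>\<Theta> (0, y)\<bar>"
      using continuous_attains_inf[OF Z(2) ne] by metis
    have "\<Theta> (0, y0) \<noteq> 0"
      using y0(1) good C0 nz[of "fst y0" 0 "snd y0"] unfolding pert0 morse_on_def by (cases y0) force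
    then obtain d where d: "d > 0" "\<And>z z'. z \<in> ?Z \<Longrightarrow> z' \<in> ?Z \<Longrightarrow> dist z' z < d \<Longrightarrow>
        dist (\<Theta> z') (\<Theta> z) < \<bar>\<Theta> (0, y0)\<bar>"
      using uc unfolding uniformly_continuous_on_def by (metis zero_less_abs_iff)
    show ?thesis
    proof (rule that[of "min d 1"])
      show "min d 1 > 0" using d by simp
      fix w :: 'b assume w: "norm w < min d 1"
      show "morse_on n (perturb v h w) (perturb f g w) C"
        unfolding morse_on_def
      proof (intro ballI impI allI)
        fix x u assume x: "x \<in> C" "\<forall>b\<in>Basis. egrad n (perturb v h w) (perturb f g w) b x = 0"
          and u: "norm u = 1 \<and> u \<bullet> x = 0"
        have "dist (\<Theta> (w, x, u)) (\<Theta> (0, x, u)) < \<bar>\<Theta> (0, y0)\<bar>"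
          by (rule d(2)) (use w x u in \<open>auto simp: dist_Pair_Pair\<close>)
        moreover have "\<bar>\<Theta> (0, y0)\<bar> \<le> \<bar>\<Theta> (0, x, u)\<bar>" using y0(2)[of "(x, u)"] x u by simp
        ultimately have "\<Theta> (w, x, u) \<noteq> 0" by (auto simp: dist_real_def)
        then show "\<exists>c\<in>Basis. ehess n (perturb v h w) (perturb f g w) u c x \<noteq> 0"
          using nz[OF C0[OF x(1)]] x u by blast
      qed
    qed
  qed
qed

text \<open>Measured on an annulus and not just on the sphere, because the Sard argument moves x in
  an open subset of the ambient space.\<close>

definition C1_close :: "real \<Rightarrow> ('a::euclidean_space \<Rightarrow> real) \<Rightarrow> ('a \<Rightarrow> real) \<Rightarrow> bool" where
  "C1_close \<epsilon> v w \<longleftrightarrow> (\<forall>x. 1 / 2 \<le> norm x \<and> norm x \<le> 2 \<longrightarrow>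
     \<bar>radial_ext w x - radial_ext v x\<bar> < \<epsilon> \<and>
     (\<forall>b\<in>Basis. \<bar>pd b (radial_ext w) x - pd b (radial_ext v) x\<bar> < \<epsilon>))"

lemma C1_close_refl: "\<epsilon> > 0 \<Longrightarrow> C1_close \<epsilon> v v"
  by (simp add: C1_close_def)

lemma C1_close_trans:
  assumes "C1_close \<epsilon> u v" "C1_close \<delta> v w" shows "C1_close (\<epsilon> + \<delta>) u w"
  unfolding C1_close_def
proof (intro allI impI conjI ballI)
  fix x :: 'a assume x: "1 / 2 \<le> norm x \<and> norm x \<le> 2"
  show "\<bar>radial_ext w x - radial_ext u x\<bar> < \<epsilon> + \<delta>"
    using assms x unfolding C1_close_def by fastforce
  fix b :: 'a assume "b \<in> Basis"
  then have "\<bar>pd b (radial_ext w) x - pd b (radial_ext v) x\<bar> < \<delta>"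
    "\<bar>pd b (radial_ext v) x - pd b (radial_ext u) x\<bar> < \<epsilon>"
    using assms x by (auto simp: C1_close_def)
  then show "\<bar>pd b (radial_ext w) x - pd b (radial_ext u) x\<bar> < \<epsilon> + \<delta>" by linarith
qed

lemma C1_close_mono: "C1_close \<epsilon> v w \<Longrightarrow> \<epsilon> \<le> \<delta> \<Longrightarrow> C1_close \<delta> v w"
  unfolding C1_close_def by (meson order_less_le_trans)

lemma C1_close_sphere:
  assumes "C1_close \<epsilon> v w" "norm x = 1" shows "\<bar>w x - v x\<bar> < \<epsilon>"
proof -
  have "\<bar>radial_ext w x - radial_ext v x\<bar> < \<epsilon>"
    using assms(1)[unfolded C1_close_def, rule_format, of x] assms(2) by simp
  then show ?thesis using assms(2) by simp
qed

lemma C1_close_perturb: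
  fixes v :: "'a::euclidean_space \<Rightarrow> real" and h :: "'b::euclidean_space \<Rightarrow> 'a \<Rightarrow> real"
  assumes v: "Cinf_on (- {0}) (radial_ext v)"
    and h: "\<And>b. b \<in> Basis \<Longrightarrow> Cinf_on (- {0}) (radial_ext (h b))" and "\<epsilon> > 0"
  obtains \<delta> where "\<delta> > 0" "\<And>w. norm w < \<delta> \<Longrightarrow> C1_close \<epsilon> v (perturb v h w)"
proof -
  let ?A = "cball 0 2 - ball 0 (1 / 2) :: 'a set"
  have A: "compact ?A" "?A \<subseteq> - {0}" by (auto intro!: compact_diff)
  have bnd: "\<exists>M>0. \<forall>x\<in>?A. \<bar>q x\<bar> \<le> M" if "continuous_on (- {0}) q" for q :: "'a \<Rightarrow> real"
  proof -
    have "bounded (q ` ?A)"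
      by (intro compact_imp_bounded compact_continuous_image continuous_on_subset[OF that] A)
    then show ?thesis by (auto simp: bounded_pos)
  qed
  have "\<forall>b\<in>Basis. \<exists>M>0. \<forall>x\<in>?A. \<bar>radial_ext (h b) x\<bar> \<le> M"
    using bnd[OF Cinf_on_continuous[OF h]] by blast
  then obtain M0 where M0: "\<And>b x. b \<in> Basis \<Longrightarrow> x \<in> ?A \<Longrightarrow> \<bar>radial_ext (h b) x\<bar> \<le> M0 b"
    "\<And>b. b \<in> Basis \<Longrightarrow> M0 b > 0" by metis
  have "\<forall>c\<in>Basis. \<forall>b\<in>Basis. \<exists>M>0. \<forall>x\<in>?A. \<bar>pd c (radial_ext (h b)) x\<bar> \<le> M"
    using bnd[OF Cinf_on_continuous[OF Cinf_on_pd[OF h]]] by blast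
  then obtain M1 where M1: "\<And>c b x. c \<in> Basis \<Longrightarrow> b \<in> Basis \<Longrightarrow> x \<in> ?A \<Longrightarrow> \<bar>pd c (radial_ext (h b)) x\<bar> \<le> M1 c b"
    "\<And>c b. c \<in> Basis \<Longrightarrow> b \<in> Basis \<Longrightarrow> M1 c b > 0" by metis
  define M where "M = 1 + (\<Sum>b\<in>Basis. M0 b) + (\<Sum>c\<in>Basis. \<Sum>b\<in>Basis. M1 c b)"
  have s0: "(\<Sum>b\<in>Basis. M0 b) \<ge> 0" using M0(2) by (simp add: sum_nonneg less_imp_le)
  have s1: "(\<Sum>b\<in>Basis. M1 c b) \<ge> 0" if "c \<in> Basis" for c using M1(2) that by (simp add: sum_nonneg less_imp_le)
  have s2: "(\<Sum>c\<in>Basis. \<Sum>b\<in>Basis. M1 c b) \<ge> 0" using s1 by (simp add: sum_nonneg)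
  have M: "M > 0" "(\<Sum>b\<in>Basis. M0 b) < M" using s0 s2 by (auto simp: M_def)
  have M': "(\<Sum>b\<in>Basis. M1 c b) < M" if "c \<in> Basis" for c
    using member_le_sum[of c Basis "\<lambda>c. \<Sum>b\<in>Basis. M1 c b"] s0 s1 that by (simp add: M_def)
  have est: "\<bar>perturb q r w x - q x\<bar> \<le> norm w * (\<Sum>b\<in>Basis. m b)"
    if "\<And>b. b \<in> Basis \<Longrightarrow> \<bar>r b x\<bar> \<le> m b" for q r m w and x :: 'a
  proof -
    have "\<bar>perturb q r w x - q x\<bar> \<le> (\<Sum>b\<in>Basis. \<bar>(w \<bullet> b) * r b x\<bar>)"
      by (simp add: perturb_def sum_abs)
    also have "\<dots> \<le> (\<Sum>b\<in>Basis. norm w * m b)"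
      unfolding abs_mult by (intro sum_mono mult_mono that Basis_le_norm) auto
    finally show ?thesis by (simp add: sum_distrib_left)
  qed
  show ?thesis
  proof (rule that[of "\<epsilon> / M"])
    show "\<epsilon> / M > 0" using M assms by simp
    fix w :: 'b assume w: "norm w < \<epsilon> / M"
    then have wM: "norm w * M < \<epsilon>" using M by (simp add: pos_less_divide_eq)
    show "C1_close \<epsilon> v (perturb v h w)"
      unfolding C1_close_def
    proof (intro allI impI conjI ballI)
      fix x :: 'a assume x: "1 / 2 \<le> norm x \<and> norm x \<le> 2"
      then have xA: "x \<in> ?A" and x0: "x \<noteq> 0" by auto
      have "\<bar>radial_ext (perturb v h w) x - radial_ext v x\<bar> \<le> norm w * (\<Sum>b\<in>Basis. M0 b)"
        unfolding radial_ext_perturb by (rule est) (use M0 xA in auto)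
      also have "\<dots> \<le> norm w * M" using M by (intro mult_left_mono) auto
      finally show "\<bar>radial_ext (perturb v h w) x - radial_ext v x\<bar> < \<epsilon>" using wM by simp
      fix c :: 'a assume c: "c \<in> Basis"
      have "\<bar>pd c (radial_ext (perturb v h w)) x - pd c (radial_ext v) x\<bar> \<le> norm w * (\<Sum>b\<in>Basis. M1 c b)"
      proof -
        have "pd c (radial_ext (perturb v h w)) x
            = perturb (pd c (radial_ext v)) (\<lambda>b. pd c (radial_ext (h b))) w x"
          by (rule pd_radial_ext_perturb[OF v h x0])
        then show ?thesis by (simp only:) (rule est, use M1 c xA in auto)
      qed
      also have "\<dots> \<le> norm w * M" using M'[OF c] by (intro mult_left_mono) auto
      finally show "\<bar>pd c (radial_ext (perturb v h w)) x - pd c (radial_ext v) x\<bar> < \<epsilon>" using wM by simp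
    qed
  qed
qed

section \<open>Density of Morse functions\<close>

text \<open>\<open>baby_Sard\<close> asks for a well-ordered index type; a copy of a finite type carries such an order.\<close>

typedef 'a enumerated = "UNIV :: 'a set" by simp

definition enum_index :: "'a::finite \<Rightarrow> nat" where
  "enum_index = (SOME f. inj f)"

lemma inj_enum_index: "inj (enum_index :: 'a::finite \<Rightarrow> nat)"
proof -
  have "\<exists>f :: 'a \<Rightarrow> nat. inj f"
    using finite_imp_inj_to_nat_seg[of "UNIV :: 'a set"] by auto
  then show ?thesis unfolding enum_index_def by (rule someI_ex)
qed

instance enumerated :: (finite) finite
proof
  have "(UNIV :: 'a enumerated set) = range Abs_enumerated"
    by (metis Rep_enumerated_inverse UNIV_eq_I rangeI)
  then show "finite (UNIV :: 'a enumerated set)"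
    using finite_imageI[OF finite[of "UNIV :: 'a set"]] by metis
qed

instantiation enumerated :: (finite) wellorder
begin

definition less_eq_enumerated :: "'a enumerated \<Rightarrow> 'a enumerated \<Rightarrow> bool" where
  "less_eq_enumerated x y \<longleftrightarrow> enum_index (Rep_enumerated x) \<le> enum_index (Rep_enumerated y)"

definition less_enumerated :: "'a enumerated \<Rightarrow> 'a enumerated \<Rightarrow> bool" where
  "less_enumerated x y \<longleftrightarrow> enum_index (Rep_enumerated x) < enum_index (Rep_enumerated y)"

instance
proof
  fix x y :: "'a enumerated"
  assume "x \<le> y" "y \<le> x"
  then have "enum_index (Rep_enumerated x) = enum_index (Rep_enumerated y)"
    by (simp add: less_eq_enumerated_def)
  then show "x = y" using inj_enum_index by (metis Rep_enumerated_inject injD)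
next
  fix P :: "'a enumerated \<Rightarrow> bool" and a
  assume step: "\<And>x. (\<And>y. y < x \<Longrightarrow> P y) \<Longrightarrow> P x"
  show "P a"
    by (induction a rule: measure_induct_rule[of "\<lambda>x. enum_index (Rep_enumerated x)"])
      (use step in \<open>auto simp: less_enumerated_def\<close>)
qed (auto simp: less_eq_enumerated_def less_enumerated_def)

end

text \<open>A vector orthogonal to the range of the derivative forces rank below full. The maps
  \<open>J\<close> and \<open>J'\<close> carry the situation to the ordered index type and back;
  since they are homeomorphisms, the absence of interior survives the transfer.\<close>

lemma sard_empty_interior:
  fixes f :: "real ^ 'd \<Rightarrow> real ^ 'd"
  assumes der: "\<And>x. x \<in> S \<Longrightarrow> (f has_derivative f' x) (at x within S)"
    and deg: "\<And>x. x \<in> S \<Longrightarrow> \<exists>u. u \<noteq> 0 \<and> (\<forall>h. u \<bullet> f' x h = 0)"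
  shows "interior (f ` S) = {}"
proof -
  define J :: "real ^ 'd \<Rightarrow> real ^ 'd enumerated" where "J x = (\<chi> i. x $ Rep_enumerated i)" for x
  define J' :: "real ^ 'd enumerated \<Rightarrow> real ^ 'd" where "J' y = (\<chi> i. y $ Abs_enumerated i)" for y
  have J: "J' (J x) = x" "J (J' y) = y" for x y
    by (simp_all add: J_def J'_def Finite_Cartesian_Product.vec_eq_iff Abs_enumerated_inverse Rep_enumerated_inverse)
  have "linear J" "linear J'" by (auto intro!: linearI simp: J_def J'_def Finite_Cartesian_Product.vec_eq_iff)
  then have bl: "bounded_linear J" "bounded_linear J'" by (simp_all add: linear_conv_bounded_linear)
  let ?g = "\<lambda>y. J (f (J' y))"
  have "negligible (?g ` (J ` S))"
  proof (rule baby_Sard)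
    fix y assume "y \<in> J ` S"
    then obtain x where x: "x \<in> S" "y = J x" by auto
    have im: "J' ` J ` S = S" by (auto simp: J image_iff)
    have d1: "(J' has_derivative J') (at y within J ` S)"
      using bl(2) bounded_linear_imp_has_derivative by blast
    have d2: "(f has_derivative f' x) (at (J' y) within J' ` J ` S)"
      using der[OF x(1)] by (simp add: im x(2) J)
    have d3: "((\<lambda>y. f (J' y)) has_derivative (\<lambda>h. f' x (J' h))) (at y within J ` S)"
      using has_derivative_in_compose[OF d1 d2] .
    have d4: "(?g has_derivative (\<lambda>h. J (f' (J' y) (J' h)))) (at y within J ` S)"
      using bounded_linear.has_derivative[OF bl(1) d3] by (simp add: x(2) J)
    then show "(?g has_derivative (\<lambda>h. J (f' (J' y) (J' h)))) (at y within J ` S)" .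
    have lin: "linear (\<lambda>h. J (f' (J' y) (J' h)))"
      using d4 has_derivative_linear by blast
    obtain u where u: "u \<noteq> 0" "\<forall>h. u \<bullet> f' x h = 0" using deg[OF x(1)] by blast
    have "\<not> surj (\<lambda>h. J (f' (J' y) (J' h)))"
    proof
      assume "surj (\<lambda>h. J (f' (J' y) (J' h)))"
      then obtain h where "J u = J (f' x (J' h))" unfolding surj_def x(2) J by metis
      then have "u = f' x (J' h)" using J(1) by metis
      then have "u \<bullet> u = 0" using u(2) by metis
      then show False using u(1) by simp
    qed
    then have "\<not> surj ((*v) (matrix (\<lambda>h. J (f' (J' y) (J' h)))))"
      using matrix_vector_mul(2)[OF lin] by simp
    then have "rank (matrix (\<lambda>h. J (f' (J' y) (J' h)))) \<noteq> CARD('d enumerated)"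
      by (simp add: full_rank_surjective)
    then show "rank (matrix (\<lambda>h. J (f' (J' y) (J' h)))) < CARD('d enumerated)"
      using rank_bound[of "matrix (\<lambda>h. J (f' (J' y) (J' h)))"] by simp
  qed simp
  then have neg: "negligible (J ` f ` S)" by (simp add: image_image J)
  have "open (J ` interior (f ` S))"
  proof -
    have "J ` interior (f ` S) = J' -` interior (f ` S)"
      by (auto simp: J image_iff) (metis J(2))
    moreover have "continuous_on UNIV J'" using bl(2) linear_continuous_on by blast
    ultimately show ?thesis by (simp add: continuous_on_open_vimage open_vimage)
  qed
  moreover have "negligible (J ` interior (f ` S))"
    by (rule negligible_subset[OF neg]) (use interior_subset in blast)
  ultimately show ?thesis using open_not_negligible by blast
qed

text \<open>The solution set of \<open>E x w = 0\<close> is a graph \<open>w = W x\<close>, because \<open>E\<close> is uniformly injective in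
  \<open>w\<close>; no implicit function theorem is needed, since Sard's lemma accepts derivatives within the
  domain of \<open>W\<close>.\<close>

lemma degenerate_parameters_empty_interior:
  fixes E :: "real ^ 'd \<Rightarrow> real ^ 'd \<Rightarrow> real ^ 'd"
  assumes lin: "\<And>x w w'. linear (T x w w')"
    and diff: "\<And>x w w'. x \<in> X \<Longrightarrow> E x w' - E x w = T x w w' (w' - w)"
    and m: "m > 0" "\<And>x w w' d. x \<in> X \<Longrightarrow> w \<in> B \<Longrightarrow> w' \<in> B \<Longrightarrow> m * norm d \<le> norm (T x w w' d)"
    and cont: "\<And>w d. w \<in> B \<Longrightarrow> continuous_on (X \<times> B) (\<lambda>z. T (fst z) w (snd z) d)"
    and der: "\<And>x w. x \<in> X \<Longrightarrow> w \<in> B \<Longrightarrow> ((\<lambda>x. E x w) has_derivative D x w) (at x)"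
    and S: "S \<subseteq> B" "\<And>w. w \<in> S \<Longrightarrow> \<exists>x\<in>X. E x w = 0 \<and> (\<exists>u. u \<noteq> 0 \<and> (\<forall>h. u \<bullet> D x w h = 0))"
  shows "interior S = {}"
proof -
  define A where "A = {x \<in> X. \<exists>w\<in>S. E x w = 0 \<and> (\<exists>u. u \<noteq> 0 \<and> (\<forall>h. u \<bullet> D x w h = 0))}"
  have "\<forall>x\<in>A. \<exists>w. w \<in> S \<and> E x w = 0 \<and> (\<exists>u. u \<noteq> 0 \<and> (\<forall>h. u \<bullet> D x w h = 0))"
    by (auto simp: A_def)
  then obtain W where W: "\<And>x. x \<in> A \<Longrightarrow> W x \<in> S" "\<And>x. x \<in> A \<Longrightarrow> E x (W x) = 0"
    "\<And>x. x \<in> A \<Longrightarrow> \<exists>u. u \<noteq> 0 \<and> (\<forall>h. u \<bullet> D x (W x) h = 0)" by metis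
  have AX: "x \<in> X" if "x \<in> A" for x using that by (simp add: A_def)
  have WB: "W x \<in> B" if "x \<in> A" for x using W(1)[OF that] S(1) by auto
  \<comment> \<open>The lower bound m makes the zero of \<open>E x\<close> in B unique, so the
    chosen \<open>W x\<close> is the given parameter.\<close>
  have "S \<subseteq> W ` A"
  proof
    fix w assume w: "w \<in> S"
    then obtain x where x: "x \<in> X" "E x w = 0" "\<exists>u. u \<noteq> 0 \<and> (\<forall>h. u \<bullet> D x w h = 0)" using S(2) by blast
    then have xA: "x \<in> A" using w by (auto simp: A_def)
    have "m * norm (W x - w) \<le> norm (T x w (W x) (W x - w))"
      using m(2)[OF x(1) _ WB[OF xA]] w S(1) by blast
    also have "\<dots> = norm (E x (W x) - E x w)" using diff[OF x(1)] by simp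
    also have "\<dots> = 0" using W(2)[OF xA] x(2) by simp
    finally have "W x = w" using m(1) by (simp add: mult_le_0_iff)
    then show "w \<in> W ` A" using xA by blast
  qed
  then have SW: "S = W ` A" using W(1) by auto
  have inj: "inj (T x w w)" if "x \<in> X" "w \<in> B" for x w
  proof (rule linear_injective_0[OF lin, THEN iffD2], intro allI impI)
    fix d assume "T x w w d = 0"
    then have "m * norm d \<le> 0" using m(2)[OF that(1,2,2), of d] by simp
    then show "d = 0" using m(1) by (simp add: mult_le_0_iff)
  qed
  \<comment> \<open>Implicit differentiation: with G the inverse of the divided difference at (x, W
    x, W x), the derivative of W is - G composed with D.\<close>
  define G where "G x = (SOME g. linear g \<and> (\<forall>d. g (T x (W x) (W x) d) = d) \<and> (\<forall>d. T x (W x) (W x) (g d) = d))" for x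
  have G: "linear (G x)" "G x (T x (W x) (W x) d) = d" "T x (W x) (W x) (G x d) = d" if "x \<in> A" for x d
  proof -
    have "\<exists>g. linear g \<and> (\<forall>d. g (T x (W x) (W x) d) = d) \<and> (\<forall>d. T x (W x) (W x) (g d) = d)"
      using linear_injective_isomorphism[OF lin inj[OF AX[OF that] WB[OF that]]] by blast
    then have "linear (G x) \<and> (\<forall>d. G x (T x (W x) (W x) d) = d) \<and> (\<forall>d. T x (W x) (W x) (G x d) = d)"
      unfolding G_def by (rule someI_ex)
    then show "linear (G x)" "G x (T x (W x) (W x) d) = d" "T x (W x) (W x) (G x d) = d" by auto
  qed
  have dW: "(W has_derivative (\<lambda>h. - G x (D x (W x) h))) (at x within A)" if x: "x \<in> A" for x
  proof -
    define w where "w = W x"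
    have wB: "w \<in> B" and xX: "x \<in> X" using WB[OF x] AX[OF x] by (auto simp: w_def)
    have Ew: "E x w = 0" using W(2)[OF x] by (simp add: w_def)
    have dE: "((\<lambda>x. E x w) has_derivative D x w) (at x within A)"
      using der[OF xX wB] has_derivative_at_withinI by blast
    obtain K where K: "K \<ge> 0" "\<And>h. norm (D x w h) \<le> K * norm h"
      using bounded_linear.nonneg_bounded[OF has_derivative_bounded_linear[OF dE]] by (metis mult.commute)
    have blG: "bounded_linear (G x)" using G(1)[OF x] by (simp add: linear_conv_bounded_linear)
    obtain Kg where Kg: "Kg \<ge> 0" "\<And>h. norm (G x h) \<le> Kg * norm h"
      using bounded_linear.nonneg_bounded[OF blG] by (metis mult.commute)
    define q where "q y = norm (E y w - (E x w + D x w (y - x))) / norm (y - x)" for y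
    have q0: "(q \<longlongrightarrow> 0) (at x within A)"
    proof -
      have "((\<lambda>y. norm ((1 / norm (y - x)) *\<^sub>R (E y w - (E x w + D x w (y - x))))) \<longlongrightarrow> 0) (at x within A)"
        by (rule tendsto_norm_zero) (use dE in \<open>simp add: has_derivative_within\<close>)
      moreover have "q = (\<lambda>y. norm ((1 / norm (y - x)) *\<^sub>R (E y w - (E x w + D x w (y - x)))))"
        by (simp add: q_def fun_eq_iff)
      ultimately show ?thesis by simp
    qed
    have qn: "q y \<ge> 0" for y by (simp add: q_def)
    have Ey: "norm (E y w) \<le> (q y + K) * norm (y - x)" if "y \<noteq> x" for y
    proof -
      have "norm (E y w) \<le> norm (E y w - (E x w + D x w (y - x))) + norm (D x w (y - x))"
        using norm_triangle_ineq[of "E y w - D x w (y - x)" "D x w (y - x)"] Ew by simp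
      also have "norm (E y w - (E x w + D x w (y - x))) = q y * norm (y - x)"
        using that by (simp add: q_def)
      finally show ?thesis using K(2)[of "y - x"] by (simp add: algebra_simps)
    qed
    have dist: "norm (W y - w) \<le> (q y + K) / m * norm (y - x)" if "y \<in> A" "y \<noteq> x" for y
    proof -
      have "m * norm (W y - w) \<le> norm (T y w (W y) (W y - w))"
        by (rule m(2)[OF AX[OF that(1)] wB WB[OF that(1)]])
      also have "\<dots> = norm (E y w)" using diff[OF AX[OF that(1)], of "W y" w] W(2)[OF that(1)]
        by (metis norm_minus_cancel diff_0)
      also note Ey[OF that(2)]
      finally show ?thesis using m(1) by (simp add: field_simps)
    qed
    have lim_id: "((\<lambda>y. y) \<longlongrightarrow> x) (at x within A)" by (rule tendsto_ident_at)
    have evA: "\<forall>\<^sub>F y in at x within A. y \<in> A \<and> y \<noteq> x" by (simp add: eventually_at_filter)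
    have Wlim: "(W \<longlongrightarrow> w) (at x within A)"
    proof -
      have "((\<lambda>y. (q y + K) / m * norm (y - x)) \<longlongrightarrow> (0 + K) / m * norm (x - x)) (at x within A)"
        by (intro tendsto_intros q0 lim_id) (use m(1) in auto)
      then have "((\<lambda>y. (q y + K) / m * norm (y - x)) \<longlongrightarrow> 0) (at x within A)" by simp
      then have "((\<lambda>y. W y - w) \<longlongrightarrow> 0) (at x within A)"
        by (rule Lim_null_comparison[rotated]) (use evA dist in \<open>auto elim!: eventually_mono\<close>)
      then show ?thesis by (simp add: LIM_zero_iff)
    qed
    \<comment> \<open>Stands in for the operator norm of the drift of the divided difference between
      x and y.\<close>
    define \<tau> where "\<tau> y = (\<Sum>b\<in>Basis. norm (T x w w b - T y w (W y) b))" for y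
    have \<tau>0: "(\<tau> \<longlongrightarrow> 0) (at x within A)"
    proof -
      have "((\<lambda>y. T y w (W y) b) \<longlongrightarrow> T x w w b) (at x within A)" for b
      proof -
        have "((\<lambda>y. (\<lambda>z. T (fst z) w (snd z) b) (y, W y)) \<longlongrightarrow> (\<lambda>z. T (fst z) w (snd z) b) (x, w)) (at x within A)"
        proof (rule continuous_on_tendsto_compose[OF cont[OF wB]])
          show "((\<lambda>y. (y, W y)) \<longlongrightarrow> (x, w)) (at x within A)" by (intro tendsto_Pair lim_id Wlim)
          show "\<forall>\<^sub>F y in at x within A. (y, W y) \<in> X \<times> B"
            using evA by (rule eventually_mono) (use AX WB in auto)
        qed (use xX wB in auto)
        then show ?thesis by simp
      qed
      then have "((\<lambda>y. norm (T x w w b - T y w (W y) b)) \<longlongrightarrow> norm (T x w w b - T x w w b)) (at x within A)" for b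
        by (intro tendsto_intros)
      then have "(\<tau> \<longlongrightarrow> (\<Sum>b\<in>(Basis :: (real ^ 'd) set). norm (T x w w b - T x w w b))) (at x within A)"
        unfolding \<tau>_def[abs_def] by (intro tendsto_sum)
      then show ?thesis by simp
    qed
    have \<tau>_est: "norm (T x w w d - T y w (W y) d) \<le> norm d * \<tau> y" for y d
    proof -
      have l: "linear (\<lambda>d. T x w w d - T y w (W y) d)" using lin by (intro linear_compose_sub)
      have "T x w w d - T y w (W y) d = (\<Sum>b\<in>Basis. (d \<bullet> b) *\<^sub>R (T x w w b - T y w (W y) b))"
        using linear_sum[OF l, of "\<lambda>b. (d \<bullet> b) *\<^sub>R b" Basis] linear_scale[OF l]
        by (simp add: euclidean_representation)
      also have "norm \<dots> \<le> (\<Sum>b\<in>Basis. norm d * norm (T x w w b - T y w (W y) b))"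
        by (intro sum_norm_le) (simp add: mult_right_mono Basis_le_norm)
      finally show ?thesis by (simp add: \<tau>_def sum_distrib_left)
    qed
    have \<tau>n: "\<tau> y \<ge> 0" for y by (simp add: \<tau>_def sum_nonneg)
    \<comment> \<open>Two errors remain, and both are small compared with |y - x|: the remainder q
      of the expansion of E in x, and the drift \<tau> times |W y - w|, where \<open>dist\<close>
      bounds the last factor by a multiple of |y - x|.\<close>
    have key: "norm ((1 / norm (y - x)) *\<^sub>R (W y - (W x + - G x (D x (W x) (y - x)))))
        \<le> Kg * (q y + (q y + K) / m * \<tau> y)" if y: "y \<in> A" "y \<noteq> x" for y
    proof -
      define d where "d = W y - w"
      have Td: "T y w (W y) d = - E y w"
        using diff[OF AX[OF y(1)], of "W y" w] W(2)[OF y(1)] by (simp add: d_def)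
      have "W y - (W x + - G x (D x (W x) (y - x))) = d + G x (D x w (y - x))"
        by (simp add: d_def w_def)
      also have "\<dots> = G x (T x w w d) + G x (D x w (y - x))"
        using G(2)[OF x, of d] by (simp add: w_def)
      also have "\<dots> = G x (T x w w d + D x w (y - x))" by (simp add: linear_add[OF G(1)[OF x]])
      also have "T x w w d + D x w (y - x)
          = (T x w w d - T y w (W y) d) - (E y w - (E x w + D x w (y - x)))"
        by (simp add: Td Ew)
      finally have "norm (W y - (W x + - G x (D x (W x) (y - x))))
          \<le> Kg * norm ((T x w w d - T y w (W y) d) - (E y w - (E x w + D x w (y - x))))"
        using Kg(2) by simp
      also have "\<dots> \<le> Kg * (norm d * \<tau> y + q y * norm (y - x))"
      proof (rule mult_left_mono[OF _ Kg(1)])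
        have "norm (E y w - (E x w + D x w (y - x))) = q y * norm (y - x)" using y(2) by (simp add: q_def)
        then show "norm ((T x w w d - T y w (W y) d) - (E y w - (E x w + D x w (y - x))))
            \<le> norm d * \<tau> y + q y * norm (y - x)"
          using norm_triangle_ineq4[of "T x w w d - T y w (W y) d" "E y w - (E x w + D x w (y - x))"]
            \<tau>_est[of d y] by linarith
      qed
      also have "\<dots> \<le> Kg * ((q y + K) / m * norm (y - x) * \<tau> y + q y * norm (y - x))"
        using dist[OF y] \<tau>n[of y] Kg(1)
        by (intro mult_left_mono add_right_mono mult_right_mono) (auto simp: d_def)
      finally have "norm (W y - (W x + - G x (D x (W x) (y - x))))
          \<le> (Kg * (q y + (q y + K) / m * \<tau> y)) * norm (y - x)" by (simp add: algebra_simps)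
      then show ?thesis using y(2) by (simp add: pos_divide_le_eq)
    qed
    have "((\<lambda>y. Kg * (q y + (q y + K) / m * \<tau> y)) \<longlongrightarrow> Kg * (0 + (0 + K) / m * 0)) (at x within A)"
      by (intro tendsto_intros q0 \<tau>0) (use m(1) in auto)
    then have "((\<lambda>y. Kg * (q y + (q y + K) / m * \<tau> y)) \<longlongrightarrow> 0) (at x within A)" by simp
    then have "((\<lambda>y. (1 / norm (y - x)) *\<^sub>R (W y - (W x + - G x (D x (W x) (y - x))))) \<longlongrightarrow> 0) (at x within A)"
      by (rule Lim_null_comparison[rotated]) (use evA key in \<open>auto elim!: eventually_mono\<close>)
    moreover have "bounded_linear (\<lambda>h. - G x (D x (W x) h))"
      using bounded_linear_compose[OF blG has_derivative_bounded_linear[OF dE]]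
      by (simp add: bounded_linear_minus w_def)
    ultimately show ?thesis by (simp add: has_derivative_within)
  qed
  have "interior (W ` A) = {}"
  proof (rule sard_empty_interior[OF dW])
    fix x assume x: "x \<in> A"
    obtain u where u: "u \<noteq> 0" "\<And>h. u \<bullet> D x (W x) h = 0" using W(3)[OF x] by blast
    \<comment> \<open>The adjoint of the divided difference carries the vector orthogonal to the
      range of D to one orthogonal to the range of G D, because the difference undoes G.\<close>
    define a where "a = adjoint (T x (W x) (W x)) u"
    have ad: "a \<bullet> h = u \<bullet> T x (W x) (W x) h" for h
      unfolding a_def using adjoint_works[OF lin] by (metis inner_commute)
    have "a \<noteq> 0"
    proof
      assume "a = 0"
      then have "u \<bullet> T x (W x) (W x) (G x u) = 0" using ad[of "G x u"] by simp
      then show False using G(3)[OF x] u(1) by simp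
    qed
    moreover have "a \<bullet> - G x (D x (W x) h) = 0" for h
      using ad[of "G x (D x (W x) h)"] G(3)[OF x] u(2) by simp
    ultimately show "\<exists>a. a \<noteq> 0 \<and> (\<forall>h. a \<bullet> - G x (D x (W x) h) = 0)" by blast
  qed
  then show ?thesis by (simp add: SW)
qed

lemma P_eig_ge: "n \<ge> 3 \<Longrightarrow> P_eig n l \<ge> real l"
proof -
  assume n: "n \<ge> 3"
  then have e: "n - 2 = Suc (n - 3)" by simp
  have "pochhammer (real l + 2) (n - 3) \<ge> 1"
    unfolding pochhammer_prod by (rule prod_ge_1) simp
  then have "(real l + 1) * 1 \<le> (real l + 1) * pochhammer (real l + 2) (n - 3)"
    by (intro mult_left_mono) auto
  then have "real l \<le> (real l + 1) * pochhammer (real l + 2) (n - 3)" by (rule order_trans[rotated]) simp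
  then show ?thesis unfolding P_eig_def e pochhammer_rec by (simp only: add.assoc one_add_one)
qed

text \<open>The degree l is the same for all t, so the operator multiplies all these harmonics by
  one common factor.\<close>

lemma tangent_harmonic_exists:
  fixes q t :: "'a::euclidean_space"
  assumes q: "norm q = 1" and t: "t \<bullet> q = 0" and l: "l \<ge> 1"
  shows "\<exists>Y. solid_harm l Y \<and> Y q = 0 \<and> (\<forall>u. pd u (radial_ext Y) q = t \<bullet> u)"
proof (cases "t = 0")
  case True
  have "radial_ext (\<lambda>x::'a. 0) = (\<lambda>x. 0)" by (simp add: radial_ext_def fun_eq_iff)
  then show ?thesis using True solid_harm_zero by (intro exI[of _ "\<lambda>x. 0"]) simp
next
  case False
  define e where "e = t /\<^sub>R norm t"
  have e: "norm e = 1" "q \<bullet> e = 0" "norm t *\<^sub>R e = t" using False t by (auto simp: e_def inner_commute)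
  have q0: "q \<noteq> 0" using q by auto
  \<comment> \<open>At q the coordinate z equals 1, so an imaginary coefficient gives value 0; its
    size makes Re (c l z(u)) equal to |t| (u . e).\<close>
  let ?c = "Complex 0 (- (norm t / real l))"
  define Y where "Y = (\<lambda>x. Re (?c * planar q e x ^ l))"
  have Y: "solid_harm l Y" unfolding Y_def by (rule solid_harm_planar[OF q e(1,2)])
  have z: "planar q e q = 1" using q e by (simp add: planar_def complex_eq_iff norm_eq_1)
  have Yq: "Y q = 0" by (simp add: Y_def z)
  have "pd u (radial_ext Y) q = t \<bullet> u" for u
  proof -
    have "pd u (radial_ext Y) q = pd u Y q"
      by (simp add: pd_radial_ext_solid_harm[OF Y q0] q Yq)
    also have "\<dots> = norm t * (u \<bullet> e)"
      unfolding Y_def pd_planar_power z using l by (simp add: planar_def)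
    also have "\<dots> = t \<bullet> u" using e(3) by (metis inner_commute inner_scaleR_left)
    finally show ?thesis .
  qed
  then show ?thesis using Y Yq by blast
qed

section \<open>The gradient field and its dependence on the parameter\<close>

definition lin_val :: "('a::euclidean_space \<Rightarrow> 'a \<Rightarrow> real) \<Rightarrow> 'a \<Rightarrow> 'a \<Rightarrow> real" where
  "lin_val Y d x = (\<Sum>b\<in>Basis. (d \<bullet> b) * radial_ext (Y b) x)"

definition lin_pd :: "('a::euclidean_space \<Rightarrow> 'a \<Rightarrow> real) \<Rightarrow> 'a \<Rightarrow> 'a \<Rightarrow> 'a \<Rightarrow> real" where
  "lin_pd Y u d x = (\<Sum>b\<in>Basis. (d \<bullet> b) * pd u (radial_ext (Y b)) x)"

text \<open>Zeros of \<open>grad_field\<close> in \<open>x\<close> are the critical points of the perturbed function, scaled to radius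
  \<open>sqrt (1 + w \<bullet> q)\<close>: the radial term makes the parameter \<open>w\<close> as large as the space.\<close>

definition grad_field ::
  "nat \<Rightarrow> real \<Rightarrow> ('a::euclidean_space \<Rightarrow> real) \<Rightarrow> ('a \<Rightarrow> real) \<Rightarrow> ('a \<Rightarrow> 'a \<Rightarrow> real) \<Rightarrow> 'a \<Rightarrow> 'a \<Rightarrow> 'a \<Rightarrow> 'a"
  where "grad_field n s v f Y q x w =
    (\<Sum>u\<in>Basis. egrad n (perturb v Y w) (perturb f (\<lambda>b x. s * Y b x) w) u x *\<^sub>R u)
    + (x \<bullet> x - 1 - w \<bullet> q) *\<^sub>R x"

text \<open>\<open>egrad\<close> is quadratic in the parameter, so its increment is an exact divided
  difference, linear in d. The coefficient 2 - n = 1 - (n - 1) belongs to the quadratic term, which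
  is split asymmetrically between w' and w.\<close>

definition grad_diff ::
  "nat \<Rightarrow> real \<Rightarrow> ('a::euclidean_space \<Rightarrow> real) \<Rightarrow> ('a \<Rightarrow> real) \<Rightarrow> ('a \<Rightarrow> 'a \<Rightarrow> real) \<Rightarrow> 'a \<Rightarrow> 'a \<Rightarrow> 'a \<Rightarrow> 'a \<Rightarrow> 'a \<Rightarrow> 'a"
  where "grad_diff n s v f Y q x w w' d =
    (\<Sum>u\<in>Basis. ((s * radial_ext v x - (real n - 1) * radial_ext f x) * lin_pd Y u d x
       + lin_val Y d x * (pd u (radial_ext f) x - (real n - 1) * s * pd u (radial_ext v) x)
       + s * (2 - real n) * (lin_val Y w' x * lin_pd Y u d x + lin_val Y d x * lin_pd Y u w x)) *\<^sub>R u)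
    - (d \<bullet> q) *\<^sub>R x"

lemma grad_field_diff:
  fixes v f :: "'a::euclidean_space \<Rightarrow> real"
  assumes v: "Cinf_on (- {0}) (radial_ext v)" and f: "Cinf_on (- {0}) (radial_ext f)"
    and Y: "\<And>b. b \<in> Basis \<Longrightarrow> Cinf_on (- {0}) (radial_ext (Y b))" and x: "x \<noteq> 0"
  shows "grad_field n s v f Y q x w' - grad_field n s v f Y q x w = grad_diff n s v f Y q x w w' (w' - w)"
proof -
  have sY: "Cinf_on (- {0}) (radial_ext (\<lambda>x. s * Y b x))" if "b \<in> Basis" for b
    unfolding radial_ext_cmult by (rule Cinf_on_cmult[OF open_minus_zero Y[OF that]])
  have pv: "pd u (radial_ext (perturb v Y w)) x = pd u (radial_ext v) x + lin_pd Y u w x" for u w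
    by (subst pd_radial_ext_perturb[OF v Y x]) (simp_all add: perturb_def lin_pd_def)
  have pf: "pd u (radial_ext (perturb f (\<lambda>b x. s * Y b x) w)) x = pd u (radial_ext f) x + s * lin_pd Y u w x" for u w
    by (subst pd_radial_ext_perturb[OF f sY x])
      (simp_all add: perturb_def lin_pd_def pd_radial_ext_cmult[OF Y x] sum_distrib_left algebra_simps)
  have rv: "radial_ext (perturb v Y w) x = radial_ext v x + lin_val Y w x" for w
    by (simp add: radial_ext_perturb perturb_def lin_val_def)
  have rf: "radial_ext (perturb f (\<lambda>b x. s * Y b x) w) x = radial_ext f x + s * lin_val Y w x" for w
    by (simp add: radial_ext_perturb radial_ext_cmult perturb_def lin_val_def sum_distrib_left algebra_simps)
  have lv: "lin_val Y (w' - w) x = lin_val Y w' x - lin_val Y w x"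
    by (simp add: lin_val_def inner_diff_left algebra_simps sum_subtractf)
  have lp: "lin_pd Y u (w' - w) x = lin_pd Y u w' x - lin_pd Y u w x" for u
    by (simp add: lin_pd_def inner_diff_left algebra_simps sum_subtractf)
  have u: "egrad n (perturb v Y w') (perturb f (\<lambda>b x. s * Y b x) w') u x
      - egrad n (perturb v Y w) (perturb f (\<lambda>b x. s * Y b x) w) u x
    = (s * radial_ext v x - (real n - 1) * radial_ext f x) * lin_pd Y u (w' - w) x
       + lin_val Y (w' - w) x * (pd u (radial_ext f) x - (real n - 1) * s * pd u (radial_ext v) x)
       + s * (2 - real n) * (lin_val Y w' x * lin_pd Y u (w' - w) x + lin_val Y (w' - w) x * lin_pd Y u w x)" for u
    unfolding egrad_def pv pf rv rf lv lp by (simp add: algebra_simps)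
  show ?thesis
    unfolding grad_field_def grad_diff_def u[symmetric]
    by (simp add: scaleR_diff_left sum_subtractf inner_diff_left algebra_simps)
qed

lemma linear_grad_diff: "linear (grad_diff n s v f Y q x w w')"
proof -
  have lv: "lin_val Y (a + b) x = lin_val Y a x + lin_val Y b x" "lin_val Y (c *\<^sub>R a) x = c * lin_val Y a x" for a b c
    by (simp_all add: lin_val_def inner_add_left algebra_simps sum.distrib sum_distrib_left)
  have lp: "lin_pd Y u (a + b) x = lin_pd Y u a x + lin_pd Y u b x" "lin_pd Y u (c *\<^sub>R a) x = c * lin_pd Y u a x" for a b c u
    by (simp_all add: lin_pd_def inner_add_left algebra_simps sum.distrib sum_distrib_left)
  show ?thesis
    by (rule linearI) (simp_all add: grad_diff_def lv lp inner_add_left algebra_simps sum.distrib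
        scaleR_add_left scaleR_diff_left sum_subtractf scaleR_sum_right)
qed

lemma continuous_on_grad_diff:
  fixes v f :: "'a::euclidean_space \<Rightarrow> real"
  assumes v: "Cinf_on (- {0}) (radial_ext v)" and f: "Cinf_on (- {0}) (radial_ext f)"
    and Y: "\<And>b. b \<in> Basis \<Longrightarrow> Cinf_on (- {0}) (radial_ext (Y b))" and X: "X \<subseteq> - {0}"
  shows "continuous_on (X \<times> B) (\<lambda>z. grad_diff n s v f Y q (fst z) w (snd z) d)"
proof -
  have c: "continuous_on (X \<times> B) (\<lambda>z. g (fst z))" if "continuous_on (- {0}) g" for g :: "'a \<Rightarrow> real"
    by (rule continuous_on_compose2[OF that]) (use X in \<open>auto intro!: continuous_intros\<close>)
  note c' = c[OF Cinf_on_continuous]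
  show ?thesis unfolding grad_diff_def lin_val_def lin_pd_def
    by (intro continuous_intros c'[OF v] c'[OF f] c'[OF Y] c'[OF Cinf_on_pd[OF v]]
        c'[OF Cinf_on_pd[OF f]] c'[OF Cinf_on_pd[OF Y]])
qed

lemma C1_close_tendsto:
  fixes v :: "'a::euclidean_space \<Rightarrow> real"
  assumes v: "Cinf_on (- {0}) (radial_ext v)" and q: "norm q = 1" and x: "x \<longlonglongrightarrow> q"
    and close: "\<And>k. C1_close (\<epsilon> k) v (vs k)" and \<epsilon>: "\<epsilon> \<longlonglongrightarrow> 0"
  shows "(\<lambda>k. radial_ext (vs k) (x k)) \<longlonglongrightarrow> radial_ext v q"
    and "b \<in> Basis \<Longrightarrow> (\<lambda>k. pd b (radial_ext (vs k)) (x k)) \<longlonglongrightarrow> pd b (radial_ext v) q"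
proof -
  have q0: "q \<in> - {0}" using q by auto
  have lim: "(\<lambda>k. g (x k)) \<longlonglongrightarrow> g q" if "Cinf_on (- {0}) g" for g :: "'a \<Rightarrow> real"
    using continuous_on_eq_continuous_at[OF open_minus_zero] Cinf_on_continuous[OF that] q0 x
    by (metis isCont_tendsto_compose)
  have "(\<lambda>k. norm (x k)) \<longlonglongrightarrow> 1" using tendsto_norm[OF x] q by simp
  then have "\<forall>\<^sub>F k in sequentially. norm (x k) \<in> {1/2<..<2}"
    by (rule topological_tendstoD) auto
  then have ann: "\<forall>\<^sub>F k in sequentially. 1/2 \<le> norm (x k) \<and> norm (x k) \<le> 2"
    by (rule eventually_mono) auto
  have "(\<lambda>k. radial_ext (vs k) (x k) - radial_ext v (x k)) \<longlonglongrightarrow> 0"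
    by (rule Lim_null_comparison[OF _ \<epsilon>])
      (use ann close in \<open>auto simp: C1_close_def elim!: eventually_mono intro: less_imp_le\<close>)
  from tendsto_add[OF this lim[OF v]] show "(\<lambda>k. radial_ext (vs k) (x k)) \<longlonglongrightarrow> radial_ext v q" by simp
  assume b: "b \<in> Basis"
  have "(\<lambda>k. pd b (radial_ext (vs k)) (x k) - pd b (radial_ext v) (x k)) \<longlonglongrightarrow> 0"
    by (rule Lim_null_comparison[OF _ \<epsilon>])
      (use ann close b in \<open>auto simp: C1_close_def elim!: eventually_mono intro: less_imp_le\<close>)
  from tendsto_add[OF this lim[OF Cinf_on_pd[OF v, of b]]]
  show "(\<lambda>k. pd b (radial_ext (vs k)) (x k)) \<longlonglongrightarrow> pd b (radial_ext v) q" by simp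
qed

text \<open>At x = q with zero parameters the map sends d to \<kappa> p - (d . q) q, where p is the
  tangential part of d and \<kappa> is the number assumed to be at least 1, so it does not shrink d.
  A compactness argument keeps the constant 1/2 nearby, uniformly over C^1-close pairs.\<close>

lemma grad_diff_bounded_below:
  fixes v f :: "'a::euclidean_space \<Rightarrow> real"
  assumes v: "Cinf_on (- {0}) (radial_ext v)" and f: "Cinf_on (- {0}) (radial_ext f)"
    and Y: "\<And>b. b \<in> Basis \<Longrightarrow> Cinf_on (- {0}) (radial_ext (Y b))" and q: "norm q = 1"
    and Yq: "\<And>b. b \<in> Basis \<Longrightarrow> Y b q = 0"
    and dY: "\<And>b u. b \<in> Basis \<Longrightarrow> pd u (radial_ext (Y b)) q = (b - (b \<bullet> q) *\<^sub>R q) \<bullet> u"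
    and \<kappa>: "s * v q - (real n - 1) * f q \<ge> 1"
  shows "\<exists>\<eta>>0. \<forall>v' f' x w w' d. C1_close \<eta> v v' \<longrightarrow> C1_close \<eta> f f' \<longrightarrow> norm (x - q) < \<eta> \<longrightarrow>
    norm w < \<eta> \<longrightarrow> norm w' < \<eta> \<longrightarrow> 1 / 2 * norm d \<le> norm (grad_diff n s v' f' Y q x w w' d)"
proof (rule ccontr)
  assume neg: "\<not> ?thesis"
  define \<epsilon> where "\<epsilon> k = inverse (real (Suc k))" for k
  have "\<forall>k. \<exists>v' f' x w w' d. C1_close (\<epsilon> k) v v' \<and> C1_close (\<epsilon> k) f f' \<and> norm (x - q) < \<epsilon> k \<and>
    norm w < \<epsilon> k \<and> norm w' < \<epsilon> k \<and> norm (grad_diff n s v' f' Y q x w w' d) < 1 / 2 * norm d"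
  proof
    fix k
    have "\<epsilon> k > 0" by (simp add: \<epsilon>_def)
    then show "\<exists>v' f' x w w' d. C1_close (\<epsilon> k) v v' \<and> C1_close (\<epsilon> k) f f' \<and> norm (x - q) < \<epsilon> k \<and>
      norm w < \<epsilon> k \<and> norm w' < \<epsilon> k \<and> norm (grad_diff n s v' f' Y q x w w' d) < 1 / 2 * norm d"
      using neg by (auto simp: not_le)
  qed
  then obtain vs fs xs ws ws' ds where seq:
    "\<And>k. C1_close (\<epsilon> k) v (vs k)" "\<And>k. C1_close (\<epsilon> k) f (fs k)" "\<And>k. norm (xs k - q) < \<epsilon> k"
    "\<And>k. norm (ws k) < \<epsilon> k" "\<And>k. norm (ws' k) < \<epsilon> k"
    "\<And>k. norm (grad_diff n s (vs k) (fs k) Y q (xs k) (ws k) (ws' k) (ds k)) < 1 / 2 * norm (ds k)"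
    by metis
  have \<epsilon>0: "\<epsilon> \<longlonglongrightarrow> 0" unfolding \<epsilon>_def by (rule LIMSEQ_inverse_real_of_nat)
  define e where "e k = ds k /\<^sub>R norm (ds k)" for k
  have ds: "ds k \<noteq> 0" for k using seq(6)[of k] by auto
  have e1: "norm (e k) = 1" for k using ds by (simp add: e_def)
  have small: "norm (grad_diff n s (vs k) (fs k) Y q (xs k) (ws k) (ws' k) (e k)) \<le> 1 / 2" for k
  proof -
    have "grad_diff n s (vs k) (fs k) Y q (xs k) (ws k) (ws' k) (e k)
        = grad_diff n s (vs k) (fs k) Y q (xs k) (ws k) (ws' k) (ds k) /\<^sub>R norm (ds k)"
      unfolding e_def by (rule linear_scale[OF linear_grad_diff])
    then show ?thesis using seq(6)[of k] ds[of k] by (simp add: field_simps)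
  qed
  have "\<forall>k. e k \<in> sphere 0 1" using e1 by simp
  then obtain l r where l: "l \<in> sphere 0 1" "strict_mono r" "(e \<circ> r) \<longlonglongrightarrow> l"
    using compact_sphere[of "0::'a" 1] unfolding compact_def by metis
  have er: "(\<lambda>k. e (r k)) \<longlonglongrightarrow> l" using l(3) by (simp add: comp_def)
  have \<epsilon>r: "(\<lambda>k. \<epsilon> (r k)) \<longlonglongrightarrow> 0" using LIMSEQ_subseq_LIMSEQ[OF \<epsilon>0 l(2)] by (simp add: comp_def)
  have null: "(\<lambda>k. g (r k)) \<longlonglongrightarrow> 0" if "\<And>k. norm (g k) < \<epsilon> k" for g :: "nat \<Rightarrow> 'a"
    by (rule Lim_null_comparison[OF _ \<epsilon>r]) (use that in \<open>auto intro!: always_eventually less_imp_le\<close>)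
  have xr: "(\<lambda>k. xs (r k)) \<longlonglongrightarrow> q" using null[of "\<lambda>k. xs k - q"] seq(3) by (simp add: LIM_zero_iff)
  have wr: "(\<lambda>k. ws (r k)) \<longlonglongrightarrow> 0" "(\<lambda>k. ws' (r k)) \<longlonglongrightarrow> 0" using null seq(4,5) by auto
  have q0: "q \<in> - {0}" using q by auto
  have limx: "(\<lambda>k. g (xs (r k))) \<longlonglongrightarrow> g q" if "Cinf_on (- {0}) g" for g :: "'a \<Rightarrow> real"
    using continuous_on_eq_continuous_at[OF open_minus_zero] Cinf_on_continuous[OF that] q0 xr
    by (metis isCont_tendsto_compose)
  have lv: "(\<lambda>k. lin_val Y (d (r k)) (xs (r k))) \<longlonglongrightarrow> lin_val Y d0 q"
    and lp: "(\<lambda>k. lin_pd Y u (d (r k)) (xs (r k))) \<longlonglongrightarrow> lin_pd Y u d0 q"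
    if "(\<lambda>k. d (r k)) \<longlonglongrightarrow> d0" for d d0 u
    unfolding lin_val_def lin_pd_def
    by (intro tendsto_intros that limx Y Cinf_on_pd; assumption)+
  note close = C1_close_tendsto[OF v q xr seq(1) \<epsilon>r] C1_close_tendsto[OF f q xr seq(2) \<epsilon>r]
  have lim: "(\<lambda>k. grad_diff n s (vs (r k)) (fs (r k)) Y q (xs (r k)) (ws (r k)) (ws' (r k)) (e (r k)))
      \<longlonglongrightarrow> grad_diff n s v f Y q q 0 0 l"
    unfolding grad_diff_def
    by (intro tendsto_intros close lv lp er wr xr; assumption)
  have le: "norm (grad_diff n s v f Y q q 0 0 l) \<le> 1 / 2"
    by (rule tendsto_upperbound[OF tendsto_norm[OF lim]]) (use small in auto)
  define p where "p = l - (l \<bullet> q) *\<^sub>R q"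
  let ?\<kappa> = "s * v q - (real n - 1) * f q"
  have "lin_pd Y u l q = p \<bullet> u" for u
  proof -
    have "lin_pd Y u l q = (\<Sum>b\<in>Basis. (l \<bullet> b) * (b \<bullet> u) - (q \<bullet> u) * ((l \<bullet> b) * (q \<bullet> b)))"
      unfolding lin_pd_def by (intro sum.cong refl) (simp add: dY inner_diff_left inner_commute algebra_simps)
    also have "\<dots> = l \<bullet> u - (q \<bullet> u) * (l \<bullet> q)"
      unfolding sum_subtractf sum_distrib_left[symmetric] euclidean_inner[of l u] euclidean_inner[of l q]
      by (simp add: inner_commute)
    finally show ?thesis by (simp add: p_def inner_diff_left)
  qed
  moreover have "lin_val Y l q = 0" "lin_val Y 0 q = 0" "lin_pd Y u 0 q = 0" for u
    using q by (simp_all add: lin_val_def lin_pd_def Yq)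
  ultimately have "grad_diff n s v f Y q q 0 0 l = (\<Sum>u\<in>Basis. (?\<kappa> * (p \<bullet> u)) *\<^sub>R u) - (l \<bullet> q) *\<^sub>R q"
    using q by (simp add: grad_diff_def)
  also have "(\<Sum>u\<in>Basis. (?\<kappa> * (p \<bullet> u)) *\<^sub>R u) = ?\<kappa> *\<^sub>R p"
    using euclidean_representation[of "?\<kappa> *\<^sub>R p"] by simp
  finally have G: "grad_diff n s v f Y q q 0 0 l = ?\<kappa> *\<^sub>R p - (l \<bullet> q) *\<^sub>R q" .
  have qq: "q \<bullet> q = 1" using q by (simp add: norm_eq_1)
  have pq: "p \<bullet> q = 0" by (simp add: p_def inner_diff_left qq)
  have "1 = l \<bullet> l" using l(1) by (simp add: norm_eq_1)
  also have "\<dots> = p \<bullet> p + (l \<bullet> q)\<^sup>2"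
    by (simp add: p_def inner_diff_left inner_diff_right qq inner_commute power2_eq_square algebra_simps)
  also have "\<dots> \<le> ?\<kappa>\<^sup>2 * (p \<bullet> p) + (l \<bullet> q)\<^sup>2"
  proof -
    have "1 \<le> ?\<kappa>\<^sup>2" using \<kappa> by (simp add: one_le_power)
    then show ?thesis using mult_right_mono[of 1 "?\<kappa>\<^sup>2" "p \<bullet> p"] by simp
  qed
  also have "\<dots> = (norm (?\<kappa> *\<^sub>R p - (l \<bullet> q) *\<^sub>R q))\<^sup>2"
    unfolding power2_norm_eq_inner
    by (simp add: inner_diff_left inner_diff_right pq qq inner_commute power2_eq_square algebra_simps)
  also have "\<dots> \<le> (1 / 2)\<^sup>2" using le unfolding G by (intro power_mono) auto
  finally show False by (simp add: power2_eq_square)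
qed

text \<open>If every small parameter were degenerate, a whole ball would lie in a set without
  interior. The radius r and the tolerance \<eta> do not depend on the nearby pair, so the lemma
  still applies after earlier perturbations.\<close>

lemma local_morse_perturbation:
  fixes v f :: "real ^ 'd \<Rightarrow> real"
  assumes vf: "P_pair n v f" and q: "norm q = 1" and l: "l \<ge> 1"
    and \<kappa>: "P_eig n l * v q - (real n - 1) * f q \<ge> 1"
  obtains r \<eta> and h g :: "real ^ 'd \<Rightarrow> real ^ 'd \<Rightarrow> real" where "r > 0" "\<eta> > 0" "\<And>b. b \<in> Basis \<Longrightarrow> P_pair n (h b) (g b)"
    "\<And>v' f' \<delta>. P_pair n v' f' \<Longrightarrow> C1_close \<eta> v v' \<Longrightarrow> C1_close \<eta> f f' \<Longrightarrow> \<delta> > 0 \<Longrightarrow>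
      \<exists>w. norm w < \<delta> \<and> morse_on n (perturb v' h w) (perturb f' g w) (sphere 0 1 \<inter> cball q r)"
proof -
  let ?s = "P_eig n l"
  have "\<forall>b. \<exists>Y. solid_harm l Y \<and> Y q = 0 \<and> (\<forall>u. pd u (radial_ext Y) q = (b - (b \<bullet> q) *\<^sub>R q) \<bullet> u)"
    using q by (intro allI tangent_harmonic_exists[OF q _ l]) (simp add: inner_diff_left norm_eq_1)
  then obtain Y where Y: "\<And>b. solid_harm l (Y b)" "\<And>b. Y b q = 0"
    "\<And>b u. pd u (radial_ext (Y b)) q = (b - (b \<bullet> q) *\<^sub>R q) \<bullet> u" by metis
  have YC: "Cinf_on (- {0}) (radial_ext (Y b))" for b by (rule solid_harm_sphere_Cinf[OF Y(1)])
  obtain \<eta>0 where \<eta>0: "\<eta>0 > 0" "\<And>v' f' x w w' d. C1_close \<eta>0 v v' \<Longrightarrow> C1_close \<eta>0 f f' \<Longrightarrow> norm (x - q) < \<eta>0 \<Longrightarrow>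
    norm w < \<eta>0 \<Longrightarrow> norm w' < \<eta>0 \<Longrightarrow> 1 / 2 * norm d \<le> norm (grad_diff n ?s v' f' Y q x w w' d)"
    using grad_diff_bounded_below[OF P_pair_Cinf[OF vf] YC q Y(2,3) \<kappa>] by blast
  define \<eta> where "\<eta> = min \<eta>0 (1 / 2)"
  have \<eta>: "\<eta> > 0" "\<eta> \<le> \<eta>0" "\<eta> \<le> 1 / 2" using \<eta>0(1) by (auto simp: \<eta>_def)
  let ?g = "\<lambda>b x. ?s * Y b x"
  have hg: "P_pair n (Y b) (?g b)" for b by (rule P_pair_solid_harm[OF Y(1)])
  show ?thesis
  proof (rule that[of "\<eta> / 2" \<eta> Y ?g])
    show "\<eta> / 2 > 0" "\<eta> > 0" using \<eta> by auto
    show "P_pair n (Y b) (?g b)" for b by (rule hg)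
    fix v' f' \<delta>
    assume vf': "P_pair n v' f'" and close: "C1_close \<eta> v v'" "C1_close \<eta> f f'" and \<delta>: "(\<delta>::real) > 0"
    note C' = P_pair_Cinf[OF vf']
    show "\<exists>w. norm w < \<delta> \<and> morse_on n (perturb v' Y w) (perturb f' ?g w) (sphere 0 1 \<inter> cball q (\<eta> / 2))"
    proof (rule ccontr)
      assume neg: "\<not> ?thesis"
      \<comment> \<open>Rescaling a critical point y to x moves it by less than \<rho>, so \<eta>/4
        + \<eta>/2 < \<eta> keeps x in the ball around q.\<close>
      define \<rho> where "\<rho> = min \<delta> (\<eta> / 4)"
      have \<rho>: "\<rho> > 0" "\<rho> \<le> \<delta>" "\<rho> \<le> \<eta> / 4" using \<delta> \<eta> by (auto simp: \<rho>_def)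
      let ?X = "ball q \<eta>" and ?B = "ball (0 :: real ^ 'd) \<eta>" and ?S = "ball (0 :: real ^ 'd) \<rho>"
      let ?E = "grad_field n ?s v' f' Y q"
      define D where "D x w h = (\<Sum>u\<in>Basis. ehess n (perturb v' Y w) (perturb f' ?g w) u h x *\<^sub>R u)
          + ((x \<bullet> x - 1 - w \<bullet> q) *\<^sub>R h + (2 * (x \<bullet> h)) *\<^sub>R x)" for x w h
      have X0: "x \<noteq> 0" if "x \<in> ?X" for x
      proof
        assume "x = 0"
        then have "norm q < \<eta>" using that by simp
        then show False using q \<eta>(3) by simp
      qed
      have Cw: "Cinf_on (- {0}) (radial_ext (perturb v' Y w))"
        "Cinf_on (- {0}) (radial_ext (perturb f' ?g w))" for w
      proof -
        have "P_pair n (perturb v' Y w) (perturb f' ?g w)" by (rule P_pair_perturb[OF vf' hg])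
        then show "Cinf_on (- {0}) (radial_ext (perturb v' Y w))"
          "Cinf_on (- {0}) (radial_ext (perturb f' ?g w))" by (rule P_pair_Cinf)+
      qed
      have XB: "norm (x - q) < \<eta>0" if "x \<in> ?X" for x
        using that \<eta> by (simp add: dist_norm norm_minus_commute)
      have "interior ?S = {}"
      proof (rule degenerate_parameters_empty_interior[where E = ?E and X = ?X and B = ?B and m = "1/2"
            and T = "grad_diff n ?s v' f' Y q" and D = D])
        show "linear (grad_diff n ?s v' f' Y q x w w')" for x w w' by (rule linear_grad_diff)
        show "?E x w' - ?E x w = grad_diff n ?s v' f' Y q x w w' (w' - w)" if "x \<in> ?X" for x w w'
          by (rule grad_field_diff[OF C' YC X0[OF that]])
        show "1 / 2 * norm d \<le> norm (grad_diff n ?s v' f' Y q x w w' d)"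
          if "x \<in> ?X" "w \<in> ?B" "w' \<in> ?B" for x w w' d
          using \<eta>0(2)[OF C1_close_mono[OF close(1) \<eta>(2)] C1_close_mono[OF close(2) \<eta>(2)] XB[OF that(1)]]
            that(2,3) \<eta>(2) by simp
        show "continuous_on (?X \<times> ?B) (\<lambda>z. grad_diff n ?s v' f' Y q (fst z) w (snd z) d)" for w d
          by (rule continuous_on_grad_diff[OF C' YC]) (use X0 in blast)
        show "((\<lambda>x. ?E x w) has_derivative D x w) (at x)" if "x \<in> ?X" for x w
        proof -
          have "((\<lambda>x. x \<bullet> x - 1 - w \<bullet> q) has_derivative (\<lambda>h. 2 * (x \<bullet> h))) (at x)"
            by (auto intro!: derivative_eq_intros simp: inner_commute)
          from has_derivative_scaleR[OF this has_derivative_ident]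
          have "((\<lambda>x. (x \<bullet> x - 1 - w \<bullet> q) *\<^sub>R x) has_derivative
              (\<lambda>h. (x \<bullet> x - 1 - w \<bullet> q) *\<^sub>R h + (2 * (x \<bullet> h)) *\<^sub>R x)) (at x)" by simp
          then show ?thesis unfolding grad_field_def D_def[abs_def]
            by (intro has_derivative_add has_derivative_sum has_derivative_scaleR_left
                has_derivative_egrad[OF Cw X0[OF that]])
        qed
        show "?S \<subseteq> ?B" using \<rho> \<eta> by auto
        fix w assume w: "w \<in> ?S"
        let ?v = "perturb v' Y w" and ?f = "perturb f' ?g w"
        have "\<not> morse_on n ?v ?f (sphere 0 1 \<inter> cball q (\<eta> / 2))" using neg w \<rho>(2) by auto
        then obtain y u where y: "norm y = 1" "dist q y \<le> \<eta> / 2" "\<And>b. b \<in> Basis \<Longrightarrow> egrad n ?v ?f b y = 0"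
          and u: "norm u = 1" "u \<bullet> y = 0" "\<And>c. c \<in> Basis \<Longrightarrow> ehess n ?v ?f u c y = 0"
          unfolding morse_on_def by auto
        have y0: "y \<noteq> 0" using y(1) by auto
        define a where "a = w \<bullet> q"
        have "\<bar>a\<bar> \<le> norm w * norm q" unfolding a_def by (rule Cauchy_Schwarz_ineq2)
        then have a: "\<bar>a\<bar> < \<rho>" using w q by simp
        then have a': "\<bar>a\<bar> < 1 / 8" using \<rho> \<eta> by simp
        define \<tau> where "\<tau> = sqrt (1 + a)"
        have \<tau>: "\<tau> > 0" "\<tau>\<^sup>2 = 1 + a" using a' by (auto simp: \<tau>_def)
        have "\<bar>\<tau> - 1\<bar> \<le> \<bar>a\<bar>"
        proof -
          have "(\<tau> - 1) * (\<tau> + 1) = a" using \<tau>(2) by (simp add: power2_eq_square algebra_simps)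
          then have "\<bar>\<tau> - 1\<bar> * \<bar>\<tau> + 1\<bar> = \<bar>a\<bar>" unfolding abs_mult[symmetric] by (rule arg_cong)
          then have "\<bar>\<tau> - 1\<bar> * (\<tau> + 1) = \<bar>a\<bar>" using \<tau>(1) by simp
          moreover have "\<bar>\<tau> - 1\<bar> * 1 \<le> \<bar>\<tau> - 1\<bar> * (\<tau> + 1)" using \<tau>(1) by (intro mult_left_mono) auto
          ultimately show ?thesis by simp
        qed
        define x where "x = \<tau> *\<^sub>R y"
        have "norm (x - y) = \<bar>\<tau> - 1\<bar>"
          using y(1) by (metis x_def scaleR_left_diff_distrib scaleR_one norm_scaleR mult.right_neutral)
        then have xX: "x \<in> ?X"
          using \<open>\<bar>\<tau> - 1\<bar> \<le> \<bar>a\<bar>\<close> a \<rho>(3) y(2) norm_triangle_ineq4[of "x - y" "q - y"] \<eta>(1)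
          by (simp add: dist_norm norm_minus_commute)
        have xx: "x \<bullet> x - 1 - w \<bullet> q = 0"
          using \<tau>(2) y(1) by (simp add: x_def a_def norm_eq_1 power2_eq_square)
        have "egrad n ?v ?f b x = 0" if "b \<in> Basis" for b
          using egrad_scaleR[OF Cw y0 \<tau>(1)] y(3)[OF that] by (simp add: x_def)
        then have Ex: "?E x w = 0" using xx by (simp add: grad_field_def)
        \<comment> \<open>The degenerate direction annihilates the whole derivative: the Hessian
          part by degeneracy, one radial term because its factor is zero at x, the other because u
          is orthogonal to x.\<close>
        have "u \<bullet> D x w h = 0" for h
        proof -
          have d: "egrad n ?v ?f u differentiable at x"
            using has_derivative_egrad[OF Cw X0[OF xX]] differentiableI by blast
          have "ehess n ?v ?f u c x = 0" if "c \<in> Basis" for c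
            using ehess_scaleR[OF Cw y0 \<tau>(1)] u(3)[OF that] by (simp add: x_def)
          then have "ehess n ?v ?f u h x = 0"
            using pd_euclidean[OF d, of h] by (simp add: pd_egrad[OF Cw X0[OF xX]])
          then have "(\<Sum>b\<in>Basis. (u \<bullet> b) * ehess n ?v ?f b h x) = 0"
            by (rule trans[OF ehess_expand_left[OF Cw[of w] X0[OF xX], of n u h, symmetric]])
          then show ?thesis
            using xx u(2) by (simp add: D_def inner_add_right inner_sum_right x_def mult.commute)
        qed
        then show "\<exists>x\<in>?X. ?E x w = 0 \<and> (\<exists>u. u \<noteq> 0 \<and> (\<forall>h. u \<bullet> D x w h = 0))"
          using xX Ex u(1) by (intro bexI[of _ x] conjI exI[of _ u]) auto
      qed simp
      then show False using \<rho>(1) by simp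
    qed
  qed
qed

text \<open>Finitely many patches cover the sphere. They are treated one after the other, each
  perturbation small enough to keep the earlier patches nondegenerate by
  \<open>morse_on_perturb\<close>.\<close>

lemma morse_density:
  fixes v f :: "real ^ 'd \<Rightarrow> real"
  assumes n: "n \<ge> 3" and vf: "P_pair n v f" and pos: "\<forall>x\<in>sphere 0 1. v x > 0" and \<epsilon>: "\<epsilon> > 0"
  obtains v' f' where "P_pair n v' f'" "C1_close \<epsilon> v v'" "C1_close \<epsilon> f f'" "morse_on n v' f' (sphere 0 1)"
proof -
  let ?S = "sphere (0 :: real ^ 'd) 1"
  have csph: "continuous_on ?S g" if "Cinf_on (- {0}) (radial_ext g)" for g :: "real ^ 'd \<Rightarrow> real"
    by (rule continuous_on_eq[OF continuous_on_subset[OF Cinf_on_continuous[OF that]]]) auto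
  have ne: "?S \<noteq> {}" by simp
  obtain x0 where x0: "x0 \<in> ?S" "\<And>x. x \<in> ?S \<Longrightarrow> v x0 \<le> v x"
    using continuous_attains_inf[OF compact_sphere ne csph[OF P_pair_Cinf(1)[OF vf]]] by blast
  obtain x1 where x1: "x1 \<in> ?S" "\<And>x. x \<in> ?S \<Longrightarrow> f x \<le> f x1"
    using continuous_attains_sup[OF compact_sphere ne csph[OF P_pair_Cinf(2)[OF vf]]] by blast
  \<comment> \<open>The minimum of v and the maximum of f make one degree serve all points q at
    once.\<close>
  obtain l :: nat where l: "real l \<ge> (1 + (real n - 1) * \<bar>f x1\<bar>) / v x0"
    using real_arch_simple by blast
  have v0: "v x0 > 0" using pos x0(1) by blast
  have \<kappa>: "P_eig n (Suc l) * v q - (real n - 1) * f q \<ge> 1" if "norm q = 1" for q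
  proof -
    have "1 + (real n - 1) * \<bar>f x1\<bar> \<le> real l * v x0" using l v0 by (simp add: field_simps)
    also have "\<dots> \<le> P_eig n (Suc l) * v q"
      using P_eig_ge[OF n, of "Suc l"] x0(2)[of q] v0 that by (intro mult_mono) auto
    finally have "1 + (real n - 1) * \<bar>f x1\<bar> \<le> P_eig n (Suc l) * v q" .
    moreover have "(real n - 1) * f q \<le> (real n - 1) * \<bar>f x1\<bar>"
      using x1(2)[of q] that n by (intro mult_left_mono) auto
    ultimately show ?thesis by linarith
  qed
  define \<Phi> where "\<Phi> q r \<eta> h g \<longleftrightarrow> r > 0 \<and> \<eta> > 0 \<and> (\<forall>b\<in>Basis. P_pair n (h b) (g b)) \<and>
    (\<forall>v' f' \<delta>. P_pair n v' f' \<longrightarrow> C1_close \<eta> v v' \<longrightarrow> C1_close \<eta> f f' \<longrightarrow> \<delta> > 0 \<longrightarrow>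
      (\<exists>w. norm w < \<delta> \<and> morse_on n (perturb v' h w) (perturb f' g w) (?S \<inter> cball q r)))"
    for q r \<eta> and h g :: "real ^ 'd \<Rightarrow> real ^ 'd \<Rightarrow> real"
  have "\<forall>q\<in>?S. \<exists>r \<eta> h g. \<Phi> q r \<eta> h g"
  proof
    fix q assume "q \<in> ?S"
    then have q: "norm q = 1" by simp
    show "\<exists>r \<eta> h g. \<Phi> q r \<eta> h g"
      unfolding \<Phi>_def by (rule local_morse_perturbation[OF vf q _ \<kappa>[OF q]]) (simp, blast)
  qed
  then obtain r \<eta> h g where "\<forall>q\<in>?S. \<Phi> q (r q) (\<eta> q) (h q) (g q)" by metis
  then have loc:
    "\<And>q. q \<in> ?S \<Longrightarrow> r q > 0" "\<And>q. q \<in> ?S \<Longrightarrow> \<eta> q > 0"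
    "\<And>q b. q \<in> ?S \<Longrightarrow> b \<in> Basis \<Longrightarrow> P_pair n (h q b) (g q b)"
    "\<And>q v' f' \<delta>. q \<in> ?S \<Longrightarrow> P_pair n v' f' \<Longrightarrow> C1_close (\<eta> q) v v' \<Longrightarrow> C1_close (\<eta> q) f f' \<Longrightarrow> \<delta> > 0 \<Longrightarrow>
      \<exists>w. norm w < \<delta> \<and> morse_on n (perturb v' (h q) w) (perturb f' (g q) w) (?S \<inter> cball q (r q))"
    unfolding \<Phi>_def by blast+
  have cover: "?S \<subseteq> (\<Union>q\<in>?S. ball q (r q))" using loc(1) by force
  obtain Q where Q: "Q \<subseteq> ?S" "finite Q" "?S \<subseteq> (\<Union>q\<in>Q. ball q (r q))"
    by (rule compactE_image[of ?S ?S "\<lambda>q. ball q (r q)"]) (use cover in auto)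
  have patch: "\<forall>\<epsilon>>0. \<exists>v' f'. P_pair n v' f' \<and> C1_close \<epsilon> v v' \<and> C1_close \<epsilon> f f' \<and>
      morse_on n v' f' (\<Union>q\<in>Q'. ?S \<inter> cball q (r q))" if "finite Q'" "Q' \<subseteq> ?S" for Q'
    using that
  proof (induction Q' rule: finite_induct)
    case empty
    then show ?case using vf C1_close_refl by (auto simp: morse_on_def)
  next
    case (insert q Q')
    show ?case
    proof (intro allI impI)
      fix \<epsilon> :: real assume \<epsilon>: "\<epsilon> > 0"
      have qS: "q \<in> ?S" using insert by auto
      \<comment> \<open>Half of the tolerance is left for the new perturbation; closeness below
        \<open>\<eta> q\<close> lets the local result at q be applied to the pair already
        perturbed.\<close>
      define e where "e = min (\<epsilon> / 2) (\<eta> q)"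
      have e: "e > 0" "e \<le> \<epsilon> / 2" "e \<le> \<eta> q" using \<epsilon> loc(2)[OF qS] by (auto simp: e_def)
      obtain v' f' where vf': "P_pair n v' f'" "C1_close e v v'" "C1_close e f f'"
        "morse_on n v' f' (\<Union>q\<in>Q'. ?S \<inter> cball q (r q))"
        using insert e(1) by auto
      note hq = loc(3)[OF qS]
      have comp: "compact (\<Union>q\<in>Q'. ?S \<inter> cball q (r q))" using insert(1) by (intro compact_UN) auto
      obtain \<delta>1 where \<delta>1: "\<delta>1 > 0" "\<And>w. norm w < \<delta>1 \<Longrightarrow>
          morse_on n (perturb v' (h q) w) (perturb f' (g q) w) (\<Union>q\<in>Q'. ?S \<inter> cball q (r q))"
        by (rule morse_on_perturb[where h = "h q" and g = "g q", OF vf'(1) hq comp _ vf'(4)]) blast+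
      obtain \<delta>2 where \<delta>2: "\<delta>2 > 0" "\<And>w. norm w < \<delta>2 \<Longrightarrow> C1_close (\<epsilon> / 2) v' (perturb v' (h q) w)"
        by (rule C1_close_perturb[where h = "h q" and \<epsilon> = "\<epsilon> / 2",
              OF P_pair_Cinf(1)[OF vf'(1)] P_pair_Cinf(1)[OF hq]]) (use \<epsilon> in auto)
      obtain \<delta>3 where \<delta>3: "\<delta>3 > 0" "\<And>w. norm w < \<delta>3 \<Longrightarrow> C1_close (\<epsilon> / 2) f' (perturb f' (g q) w)"
        by (rule C1_close_perturb[where h = "g q" and \<epsilon> = "\<epsilon> / 2",
              OF P_pair_Cinf(2)[OF vf'(1)] P_pair_Cinf(2)[OF hq]]) (use \<epsilon> in auto)
      obtain w where w: "norm w < min \<delta>1 (min \<delta>2 \<delta>3)"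
        "morse_on n (perturb v' (h q) w) (perturb f' (g q) w) (?S \<inter> cball q (r q))"
        using loc(4)[OF qS vf'(1) C1_close_mono[OF vf'(2) e(3)] C1_close_mono[OF vf'(3) e(3)],
            of "min \<delta>1 (min \<delta>2 \<delta>3)"] \<delta>1(1) \<delta>2(1) \<delta>3(1) by auto
      have "C1_close (\<epsilon> / 2 + \<epsilon> / 2) v (perturb v' (h q) w)"
        using w(1) by (intro C1_close_trans[OF C1_close_mono[OF vf'(2) e(2)]] \<delta>2(2)) simp
      moreover have "C1_close (\<epsilon> / 2 + \<epsilon> / 2) f (perturb f' (g q) w)"
        using w(1) by (intro C1_close_trans[OF C1_close_mono[OF vf'(3) e(2)]] \<delta>3(2)) simp
      moreover have "morse_on n (perturb v' (h q) w) (perturb f' (g q) w) (\<Union>q\<in>insert q Q'. ?S \<inter> cball q (r q))"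
        using w \<delta>1(2)[of w] unfolding morse_on_def by auto
      ultimately show "\<exists>v' f'. P_pair n v' f' \<and> C1_close \<epsilon> v v' \<and> C1_close \<epsilon> f f' \<and>
          morse_on n v' f' (\<Union>q\<in>insert q Q'. ?S \<inter> cball q (r q))"
        using P_pair_perturb[OF vf'(1) hq] by (intro exI conjI) auto
    qed
  qed
  then obtain v' f' where vf': "P_pair n v' f'" "C1_close \<epsilon> v v'" "C1_close \<epsilon> f f'"
      "morse_on n v' f' (\<Union>q\<in>Q. ?S \<inter> cball q (r q))"
    using Q(1,2) \<epsilon> by meson
  have "morse_on n v' f' ?S"
    unfolding morse_on_def
  proof
    fix x assume "x \<in> ?S"
    then have "x \<in> (\<Union>q\<in>Q. ?S \<inter> cball q (r q))" using Q(3) by force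
    then show "(\<forall>b\<in>Basis. egrad n v' f' b x = 0) \<longrightarrow>
        (\<forall>u. norm u = 1 \<and> u \<bullet> x = 0 \<longrightarrow> (\<exists>w\<in>Basis. ehess n v' f' u w x \<noteq> 0))"
      using vf'(4) unfolding morse_on_def by blast
  qed
  then show ?thesis using that vf' by blast
qed

section \<open>Stability of critical points\<close>

text \<open>A trivial cokernel makes the adjoint injective, hence surjective, and a kernel vector is
  orthogonal to its range. This passes from the first slot of \<open>ehess\<close>, in which
  \<open>morse_on\<close> is stated, to the second, in place of symmetry of second
  derivatives.\<close>

lemma inj_if_trivial_cokernel:
  fixes A :: "'a::euclidean_space \<Rightarrow> 'a"
  assumes A: "linear A" and ck: "\<And>z. (\<And>w. z \<bullet> A w = 0) \<Longrightarrow> z = 0" and d: "A d = 0"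
  shows "d = 0"
proof -
  have adj: "z \<bullet> A w = adjoint A z \<bullet> w" for z w
    using adjoint_works[OF A] by (metis inner_commute)
  have lin: "linear (adjoint A)" by (rule adjoint_linear[OF A])
  have "inj (adjoint A)"
  proof (rule linear_injective_0[OF lin, THEN iffD2], intro allI impI)
    fix z assume "adjoint A z = 0"
    then show "z = 0" using adj by (intro ck) simp
  qed
  then have "surj (adjoint A)" by (rule linear_injective_imp_surjective[OF lin]) simp
  then obtain z where "d = adjoint A z" by (metis surjD)
  then have "d \<bullet> d = 0" using adj[of z d] d by simp
  then show ?thesis by simp
qed

lemma ehess_right_linear:
  assumes v: "Cinf_on (- {0}) (radial_ext v)" and f: "Cinf_on (- {0}) (radial_ext f)" and x: "x \<noteq> 0"
  shows "linear (\<lambda>w. ehess n v f u w x)"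
  by (rule has_derivative_linear[OF has_derivative_egrad[OF v f x]])

lemma morse_on_kernel:
  fixes v f :: "'a::euclidean_space \<Rightarrow> real"
  assumes v: "Cinf_on (- {0}) (radial_ext v)" and f: "Cinf_on (- {0}) (radial_ext f)"
    and good: "morse_on n v f (sphere 0 1)" and q: "norm q = 1" "\<And>b. b \<in> Basis \<Longrightarrow> egrad n v f b q = 0"
    and d: "d \<bullet> q = 0" "\<And>u. u \<in> Basis \<Longrightarrow> ehess n v f u d q = 0"
  shows "d = 0"
proof -
  have q0: "q \<noteq> 0" and qq: "q \<bullet> q = 1" using q(1) by (auto simp: norm_eq_1)
  \<comment> \<open>The radial term completes the tangential Hessian to an operator on the whole
    space.\<close>
  define A where "A w = (\<Sum>u\<in>Basis. ehess n v f u w q *\<^sub>R u) + (q \<bullet> w) *\<^sub>R q" for w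
  have zA: "z \<bullet> A w = ehess n v f z w q + (q \<bullet> w) * (z \<bullet> q)" for z w
    using ehess_expand_left[OF v f q0, of n z w]
    by (simp add: A_def inner_add_right inner_sum_right mult.commute)
  have linA: "linear A"
    unfolding A_def
    by (intro linear_compose_add linear_compose_sum ballI linear_compose_scale_right[OF ehess_right_linear[OF v f q0]])
      (auto intro!: linearI simp: ehess_right_linear[OF v f q0, THEN linear_add]
        ehess_right_linear[OF v f q0, THEN linear_scale] scaleR_add_left inner_add_right)
  have eu: "egrad n v f u q = 0" for u using egrad_expand[OF v f q0, of n u] q(2) by simp
  have radial: "ehess n v f u q q = 0" for u
  proof -
    have "pd q (egrad n v f u) q = (-1) * egrad n v f u q"
      by (rule euler_homogeneous[OF differentiableI[OF has_derivative_egrad[OF v f q0]]])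
        (simp add: egrad_scaleR[OF v f q0] powr_minus)
    then show ?thesis using eu pd_egrad[OF v f q0] by simp
  qed
  show ?thesis
  proof (rule inj_if_trivial_cokernel[OF linA])
    fix z assume z: "\<And>w. z \<bullet> A w = 0"
    have zq: "z \<bullet> q = 0" using z[of q] zA[of z q] radial[of z] qq by simp
    have e: "ehess n v f z w q = 0" for w using z[of w] zA[of z w] zq by simp
    show "z = 0"
    proof (rule ccontr)
      assume z0: "z \<noteq> 0"
      define u where "u = z /\<^sub>R norm z"
      have u: "norm u = 1" "u \<bullet> q = 0" using z0 zq by (auto simp: u_def)
      then obtain w where w: "w \<in> Basis" "ehess n v f u w q \<noteq> 0"
        using good q unfolding morse_on_def by (metis mem_sphere_0)
      have "ehess n v f u w q = inverse (norm z) * ehess n v f z w q"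
        unfolding ehess_expand_left[OF v f q0, of n u w] ehess_expand_left[OF v f q0, of n z w]
        by (simp add: u_def sum_distrib_left mult.assoc)
      then show False using w(2) e by simp
    qed
  next
    show "A d = 0" using d by (simp add: A_def inner_commute)
  qed
qed

lemma egrad_line:
  assumes v: "Cinf_on (- {0}) (radial_ext v)" and f: "Cinf_on (- {0}) (radial_ext f)"
    and h: "Cinf_on (- {0}) (radial_ext h)" and g: "Cinf_on (- {0}) (radial_ext g)" and x: "x \<noteq> 0"
  shows "egrad n (\<lambda>x. v x + t * h x) (\<lambda>x. f x + t * g x) u x =
     egrad n v f u x + t * (egrad n v g u x + egrad n h f u x) + t\<^sup>2 * egrad n h g u x"
proof -
  have th: "Cinf_on (- {0}) (radial_ext (\<lambda>x. t * h x))" and tg: "Cinf_on (- {0}) (radial_ext (\<lambda>x. t * g x))"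
    unfolding radial_ext_cmult by (rule Cinf_on_cmult[OF open_minus_zero h], rule Cinf_on_cmult[OF open_minus_zero g])
  have p: "pd u (radial_ext (\<lambda>x. v x + t * h x)) x = pd u (radial_ext v) x + t * pd u (radial_ext h) x"
    "pd u (radial_ext (\<lambda>x. f x + t * g x)) x = pd u (radial_ext f) x + t * pd u (radial_ext g) x"
    using pd_radial_ext_add[OF v th x] pd_radial_ext_add[OF f tg x] pd_radial_ext_cmult[OF h x]
      pd_radial_ext_cmult[OF g x] by simp_all
  have r: "radial_ext (\<lambda>x. v x + t * h x) x = radial_ext v x + t * radial_ext h x"
    "radial_ext (\<lambda>x. f x + t * g x) x = radial_ext f x + t * radial_ext g x"
    by (simp_all add: radial_ext_def)
  show ?thesis unfolding egrad_def p r by (simp add: algebra_simps power2_eq_square)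
qed

lemma difference_quotient_tendsto:
  fixes \<phi> :: "'a::euclidean_space \<Rightarrow> real"
  assumes \<phi>: "\<phi> differentiable at q" and x: "x \<longlonglongrightarrow> q" "\<And>k. x k \<noteq> q"
    and d: "(\<lambda>k. (x k - q) /\<^sub>R norm (x k - q)) \<longlonglongrightarrow> d"
  shows "(\<lambda>k. (\<phi> (x k) - \<phi> q) / norm (x k - q)) \<longlonglongrightarrow> pd d \<phi> q"
proof -
  have bl: "bounded_linear (\<lambda>h. pd h \<phi> q)" by (rule bounded_linear_pd[OF \<phi>])
  have "((\<lambda>y. (1 / norm (y - q)) *\<^sub>R (\<phi> y - (\<phi> q + pd (y - q) \<phi> q))) \<longlongrightarrow> 0) (at q)"
    using has_derivative_pd[OF \<phi>] by (simp add: has_derivative_within)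
  moreover have "filterlim x (at q) sequentially" using x by (simp add: filterlim_at)
  ultimately have 1: "(\<lambda>k. (1 / norm (x k - q)) *\<^sub>R (\<phi> (x k) - (\<phi> q + pd (x k - q) \<phi> q))) \<longlonglongrightarrow> 0"
    by (rule filterlim_compose)
  have 2: "(\<lambda>k. pd ((x k - q) /\<^sub>R norm (x k - q)) \<phi> q) \<longlonglongrightarrow> pd d \<phi> q"
    by (rule bounded_linear.tendsto[OF bl d])
  have "(\<phi> (x k) - \<phi> q) / norm (x k - q) = (1 / norm (x k - q)) *\<^sub>R (\<phi> (x k) - (\<phi> q + pd (x k - q) \<phi> q))
      + pd ((x k - q) /\<^sub>R norm (x k - q)) \<phi> q" for k
  proof -
    have "pd ((x k - q) /\<^sub>R norm (x k - q)) \<phi> q = inverse (norm (x k - q)) * pd (x k - q) \<phi> q"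
      by (rule pd_arg_scaleR[OF \<phi>])
    then show ?thesis by (simp only:) (simp add: divide_inverse algebra_simps)
  qed
  then show ?thesis using tendsto_add[OF 1 2] by simp
qed

text \<open>Unit secants from q subconverge to a tangent vector d. As \<open>egrad\<close> vanishes
  at both ends of each secant, dividing by its length puts d in the kernel of the Hessian, contrary
  to nondegeneracy. The vanishing perturbation t lets one argument serve both finiteness and
  stability.\<close>

lemma critical_points_isolated:
  fixes v f h g :: "'a::euclidean_space \<Rightarrow> real"
  assumes v: "Cinf_on (- {0}) (radial_ext v)" and f: "Cinf_on (- {0}) (radial_ext f)"
    and h: "Cinf_on (- {0}) (radial_ext h)" and g: "Cinf_on (- {0}) (radial_ext g)"
    and good: "morse_on n v f (sphere 0 1)" and q: "norm q = 1" "\<And>b. b \<in> Basis \<Longrightarrow> egrad n v f b q = 0"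
    and x: "x \<longlonglongrightarrow> q" "\<And>k. x k \<noteq> q" "\<And>k. norm (x k) = 1" and t: "t \<longlonglongrightarrow> 0"
    and e: "\<And>k b. b \<in> Basis \<Longrightarrow> egrad n (\<lambda>x. v x + t k * h x) (\<lambda>x. f x + t k * g x) b (x k) = 0"
    and eq: "\<And>k b. b \<in> Basis \<Longrightarrow> egrad n (\<lambda>x. v x + t k * h x) (\<lambda>x. f x + t k * g x) b q = 0"
  shows False
proof -
  have q0: "q \<noteq> 0" using q by auto
  define e where "e k = (x k - q) /\<^sub>R norm (x k - q)" for k
  have "\<forall>k. e k \<in> sphere 0 1" using x(2) by (simp add: e_def)
  then obtain d r where d: "d \<in> sphere 0 1" "strict_mono r" "(e \<circ> r) \<longlonglongrightarrow> d"
    using compact_sphere[of "0::'a" 1] unfolding compact_def by metis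
  have xr: "(\<lambda>k. x (r k)) \<longlonglongrightarrow> q" and tr: "(\<lambda>k. t (r k)) \<longlonglongrightarrow> 0"
    using LIMSEQ_subseq_LIMSEQ[OF x(1) d(2)] LIMSEQ_subseq_LIMSEQ[OF t d(2)] by (simp_all add: comp_def)
  have er: "(\<lambda>k. (x (r k) - q) /\<^sub>R norm (x (r k) - q)) \<longlonglongrightarrow> d"
    using d(3) by (simp add: comp_def e_def)
  have "d \<bullet> q = 0"
  proof -
    \<comment> \<open>On the sphere a secant is orthogonal to the sum of its endpoints; in the limit
      d is tangent at q.\<close>
    have "(x k - q) \<bullet> (x k + q) = 0" for k
      using x(3)[of k] q(1) 
      by (simp add: inner_diff_left inner_diff_right inner_add_left inner_add_right inner_commute norm_eq_1)
    then have z: "((x (r k) - q) /\<^sub>R norm (x (r k) - q)) \<bullet> (x (r k) + q) = 0" for k by simp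
    have "(\<lambda>k. ((x (r k) - q) /\<^sub>R norm (x (r k) - q)) \<bullet> (x (r k) + q)) \<longlonglongrightarrow> d \<bullet> (q + q)"
      by (intro tendsto_intros er xr)
    then have "d \<bullet> (q + q) = 0" unfolding z by (simp add: LIMSEQ_const_iff)
    then show ?thesis by (simp add: inner_add_right)
  qed
  moreover have "ehess n v f u d q = 0" if u: "u \<in> Basis" for u
  proof -
    define m where "m y = egrad n v g u y + egrad n h f u y" for y
    have de: "egrad n a b u differentiable at q"
      if "Cinf_on (- {0}) (radial_ext a)" "Cinf_on (- {0}) (radial_ext b)" for a b :: "'a \<Rightarrow> real"
      using has_derivative_egrad[OF that q0] differentiableI by blast
    have dm: "m differentiable at q" unfolding m_def[abs_def] by (intro differentiable_add de v f g h)
    define Q where "Q \<phi> k = (\<phi> (x (r k)) - \<phi> q) / norm (x (r k) - q)" for \<phi> :: "'a \<Rightarrow> real" and k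
    have Q: "(\<lambda>k. Q \<phi> k) \<longlonglongrightarrow> pd d \<phi> q" if "\<phi> differentiable at q" for \<phi>
      unfolding Q_def by (rule difference_quotient_tendsto[OF that xr x(2) er])
    have "Q (egrad n v f u) k + t (r k) * Q m k + (t (r k))\<^sup>2 * Q (egrad n h g u) k = 0" for k
    proof -
      have x0: "x (r k) \<noteq> 0" using x(3)[of "r k"] by auto
      have "egrad n v f u (x (r k)) + t (r k) * m (x (r k)) + (t (r k))\<^sup>2 * egrad n h g u (x (r k)) = 0"
        using assms(12)[OF u, of "r k"] egrad_line[OF v f h g x0] by (simp add: m_def)
      moreover have "egrad n v f u q + t (r k) * m q + (t (r k))\<^sup>2 * egrad n h g u q = 0"
        using eq[OF u, of "r k"] egrad_line[OF v f h g q0] by (simp add: m_def)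
      ultimately have "(egrad n v f u (x (r k)) - egrad n v f u q) + t (r k) * (m (x (r k)) - m q)
          + (t (r k))\<^sup>2 * (egrad n h g u (x (r k)) - egrad n h g u q) = 0" by (simp add: algebra_simps)
      then show ?thesis unfolding Q_def by (simp add: add_divide_distrib[symmetric])
    qed
    moreover have "(\<lambda>k. Q (egrad n v f u) k + t (r k) * Q m k + (t (r k))\<^sup>2 * Q (egrad n h g u) k)
        \<longlonglongrightarrow> pd d (egrad n v f u) q + 0 * pd d m q + 0\<^sup>2 * pd d (egrad n h g u) q"
      by (intro tendsto_intros Q tr de v f h g dm)
    ultimately have "pd d (egrad n v f u) q = 0" by (simp add: LIMSEQ_const_iff)
    then show ?thesis by (simp add: pd_egrad[OF v f q0])
  qed
  ultimately have "d = 0"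
    by (intro morse_on_kernel[OF v f good, of q d]) (use q in auto)
  then show False using d(1) by simp
qed

lemma egrad_continuous:
  assumes v: "Cinf_on (- {0}) (radial_ext v)" and f: "Cinf_on (- {0}) (radial_ext f)" and x: "x \<longlonglongrightarrow> q" "q \<noteq> 0"
  shows "(\<lambda>k. egrad n v f u (x k)) \<longlonglongrightarrow> egrad n v f u q"
  using has_derivative_continuous[OF has_derivative_egrad[OF v f x(2)]] x(1) isCont_tendsto_compose by blast

lemma critical_points_finite:
  fixes v f :: "'a::euclidean_space \<Rightarrow> real"
  assumes v: "Cinf_on (- {0}) (radial_ext v)" and f: "Cinf_on (- {0}) (radial_ext f)"
    and good: "morse_on n v f (sphere 0 1)"
  shows "finite {x \<in> sphere 0 1. \<forall>b\<in>Basis. egrad n v f b x = 0}" (is "finite ?Z")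
proof (rule ccontr)
  assume "infinite ?Z"
  then obtain q where q: "q \<in> sphere 0 1" "q islimpt ?Z"
    using compact_sphere[of "0::'a" 1] unfolding compact_eq_Bolzano_Weierstrass
    by (metis (no_types, lifting) mem_Collect_eq subsetI)
  then obtain x where x: "\<And>k. x k \<in> ?Z - {q}" "x \<longlonglongrightarrow> q" unfolding islimpt_sequential by blast
  have q1: "norm q = 1" and q0: "q \<noteq> 0" using q(1) by auto
  have eq: "egrad n v f b q = 0" if "b \<in> Basis" for b
    using egrad_continuous[OF v f x(2) q0, of n b] x(1) that by (simp add: LIMSEQ_const_iff)
  \<comment> \<open>The unperturbed case: t = 0, with v and f themselves filling the places of h and
    g.\<close>
  show False
    by (rule critical_points_isolated[OF v f v f good q1 eq x(2), of "\<lambda>k. 0"]) (use x(1) eq in auto)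
qed

text \<open>The perturbation vanishes to first order on Z, so these points stay critical. Further
  critical points for t -> 0 would accumulate, by compactness, at a point of Z, which
  \<open>critical_points_isolated\<close> forbids.\<close>

lemma critical_points_stable:
  fixes v f h g :: "'a::euclidean_space \<Rightarrow> real"
  assumes v: "Cinf_on (- {0}) (radial_ext v)" and f: "Cinf_on (- {0}) (radial_ext f)"
    and h: "Cinf_on (- {0}) (radial_ext h)" and g: "Cinf_on (- {0}) (radial_ext g)"
    and good: "morse_on n v f (sphere 0 1)"
  defines "Z \<equiv> {x \<in> sphere 0 1. \<forall>b\<in>Basis. egrad n v f b x = 0}"
  assumes hg: "\<And>p. p \<in> Z \<Longrightarrow> h p = 0" "\<And>p u. p \<in> Z \<Longrightarrow> pd u (radial_ext h) p = 0"
    "\<And>p. p \<in> Z \<Longrightarrow> g p = 0" "\<And>p u. p \<in> Z \<Longrightarrow> pd u (radial_ext g) p = 0"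
  shows "\<exists>\<delta>>0. \<forall>t. \<bar>t\<bar> < \<delta> \<longrightarrow>
    {x \<in> sphere 0 1. \<forall>b\<in>Basis. egrad n (\<lambda>x. v x + t * h x) (\<lambda>x. f x + t * g x) b x = 0} = Z"
proof -
  define ZT where "ZT t = {x \<in> sphere 0 1. \<forall>b\<in>Basis.
      egrad n (\<lambda>x. v x + t * h x) (\<lambda>x. f x + t * g x) b x = 0}" for t
  have ZD: "norm p = 1" "p \<noteq> 0" if "p \<in> Z" for p using that by (auto simp: Z_def)
  have keep: "egrad n (\<lambda>x. v x + t * h x) (\<lambda>x. f x + t * g x) b p = 0" if "p \<in> Z" "b \<in> Basis" for p b t
  proof -
    have "egrad n v g b p = 0" "egrad n h f b p = 0" "egrad n h g b p = 0"
      using hg that ZD by (auto simp: egrad_def)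
    then show ?thesis using that egrad_line[OF v f h g ZD(2)[OF that(1)]] by (simp add: Z_def)
  qed
  have "\<exists>\<delta>>0. \<forall>t. \<bar>t\<bar> < \<delta> \<longrightarrow> ZT t \<subseteq> Z"
  proof (rule ccontr)
    assume neg: "\<not> ?thesis"
    have "\<forall>k. \<exists>t x. \<bar>t\<bar> < inverse (real (Suc k)) \<and> x \<in> ZT t \<and> x \<notin> Z"
    proof
      fix k
      have "inverse (real (Suc k)) > 0" by simp
      then show "\<exists>t x. \<bar>t\<bar> < inverse (real (Suc k)) \<and> x \<in> ZT t \<and> x \<notin> Z" using neg by blast
    qed
    then obtain t x where tx: "\<And>k. \<bar>t k\<bar> < inverse (real (Suc k))" "\<And>k. x k \<in> ZT (t k)" "\<And>k. x k \<notin> Z" by metis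
    have "\<forall>k. x k \<in> sphere 0 1" using tx(2) by (auto simp: ZT_def)
    then obtain q r where q: "q \<in> sphere 0 1" "strict_mono r" "(x \<circ> r) \<longlonglongrightarrow> q"
      using compact_sphere[of "0::'a" 1] unfolding compact_def by metis
    have q1: "norm q = 1" and q0: "q \<noteq> 0" using q(1) by auto
    have t0: "t \<longlonglongrightarrow> 0"
      by (rule Lim_null_comparison[OF _ LIMSEQ_inverse_real_of_nat]) (use tx(1) in \<open>auto intro!: always_eventually less_imp_le\<close>)
    have xr: "(\<lambda>k. x (r k)) \<longlonglongrightarrow> q" and tr: "(\<lambda>k. t (r k)) \<longlonglongrightarrow> 0"
      using q(3) LIMSEQ_subseq_LIMSEQ[OF t0 q(2)] by (simp_all add: comp_def)
    have exr: "egrad n (\<lambda>x. v x + t (r k) * h x) (\<lambda>x. f x + t (r k) * g x) b (x (r k)) = 0" if "b \<in> Basis" for b k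
      using tx(2)[of "r k"] that by (auto simp: ZT_def)
    have x1: "norm (x (r k)) = 1" for k using tx(2)[of "r k"] by (auto simp: ZT_def)
    have qZ: "egrad n v f b q = 0" if b: "b \<in> Basis" for b
    proof -
      have "egrad n v f b (x (r k)) + t (r k) * (egrad n v g b (x (r k)) + egrad n h f b (x (r k)))
          + (t (r k))\<^sup>2 * egrad n h g b (x (r k)) = 0" for k
        using exr[OF b, of k] x1[of k] egrad_line[OF v f h g, of "x (r k)"] by fastforce
      moreover have "(\<lambda>k. egrad n v f b (x (r k)) + t (r k) * (egrad n v g b (x (r k)) + egrad n h f b (x (r k)))
          + (t (r k))\<^sup>2 * egrad n h g b (x (r k))) \<longlonglongrightarrow>
          egrad n v f b q + 0 * (egrad n v g b q + egrad n h f b q) + 0\<^sup>2 * egrad n h g b q"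
        by (intro tendsto_intros tr egrad_continuous[OF _ _ xr q0] v f h g)
      ultimately show ?thesis by (simp add: LIMSEQ_const_iff)
    qed
    then have "q \<in> Z" using q(1) by (simp add: Z_def)
    then show False
      using critical_points_isolated[OF v f h g good q1 qZ xr _ x1 tr exr keep] tx(3) by metis
  qed
  then obtain \<delta> where "\<delta> > 0" "\<And>t. \<bar>t\<bar> < \<delta> \<Longrightarrow> ZT t \<subseteq> Z" by blast
  moreover have "Z \<subseteq> ZT t" for t using keep ZD by (auto simp: ZT_def)
  ultimately show ?thesis unfolding ZT_def[symmetric] by (intro exI[of _ \<delta>]) blast
qed

text \<open>Only the Laplacian of f changes at p, by t f(p), so the trace of the Hessian form grows
  by t v f; divided by c v^n this is t K.\<close>

lemma sphere_lap_curv_line: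
  fixes v f h g :: "'a::euclidean_space \<Rightarrow> real"
  assumes vf: "P_pair n v f" and hg: "P_pair n h g" and c: "c > 0" and n: "n \<ge> 1"
    and pos: "\<forall>x\<in>sphere 0 1. v x > 0" "\<forall>x\<in>sphere 0 1. v x + t * h x > 0"
    and p: "p \<in> crit (curv n c v f)" "p \<in> crit (curv n c (\<lambda>x. v x + t * h x) (\<lambda>x. f x + t * g x))"
    and jet: "h p = 0" "\<And>u. pd u (radial_ext h) p = 0" "sphere_lap h p = 0"
      "g p = 0" "\<And>u. pd u (radial_ext g) p = 0" "sphere_lap g p = f p"
  shows "sphere_lap (curv n c (\<lambda>x. v x + t * h x) (\<lambda>x. f x + t * g x)) p
    = sphere_lap (curv n c v f) p + t * curv n c v f p"
proof -
  note C = P_pair_Cinf[OF vf] P_pair_Cinf[OF hg]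
  let ?v = "\<lambda>x. v x + t * h x" and ?f = "\<lambda>x. f x + t * g x"
  have P: "P_pair n ?v ?f" by (intro P_pair_add vf P_pair_cmult hg)
  note CP = P_pair_Cinf[OF P] and Ct = P_pair_Cinf[OF P_pair_cmult[OF hg, of t]]
  have p1: "norm p = 1" and p0: "p \<noteq> 0" using p(1) by (auto simp: crit_def)
  have V: "v p > 0" using pos(1) p1 by simp
  have pd: "pd u (radial_ext ?v) p = pd u (radial_ext v) p" "pd u (radial_ext ?f) p = pd u (radial_ext f) p" for u
    using pd_radial_ext_add[OF C(1) Ct(1) p0] pd_radial_ext_add[OF C(2) Ct(2) p0]
      pd_radial_ext_cmult[OF C(3) p0] pd_radial_ext_cmult[OF C(4) p0] jet by simp_all
  have lap: "(\<Sum>b\<in>Basis. pd b (pd b (radial_ext ?v)) p) = (\<Sum>b\<in>Basis. pd b (pd b (radial_ext v)) p)"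
    "(\<Sum>b\<in>Basis. pd b (pd b (radial_ext ?f)) p) = (\<Sum>b\<in>Basis. pd b (pd b (radial_ext f)) p) + t * f p"
    using sphere_lap_add[OF C(1) Ct(1) p0] sphere_lap_add[OF C(2) Ct(2) p0]
      sphere_lap_cmult[OF C(3) p0] sphere_lap_cmult[OF C(4) p0] jet by (simp_all add: sphere_lap_eq)
  have exp: "(\<Sum>b\<in>Basis. ehess n a b' b b p) = a p * (\<Sum>b\<in>Basis. pd b (pd b (radial_ext b')) p)
      - (real n - 1) * (b' p * (\<Sum>b\<in>Basis. pd b (pd b (radial_ext a)) p))
      + (\<Sum>b\<in>Basis. pd b (radial_ext a) p * pd b (radial_ext b') p
          - (real n - 1) * (pd b (radial_ext b') p * pd b (radial_ext a) p))" for a b'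
    unfolding ehess_def sum_distrib_left using p1
    by (subst sum_subtractf[symmetric], subst sum.distrib[symmetric], intro sum.cong refl)
      (simp add: algebra_simps)
  have "(\<Sum>b\<in>Basis. ehess n ?v ?f b b p) = (\<Sum>b\<in>Basis. ehess n v f b b p) + t * (v p * f p)"
    unfolding exp lap pd using jet by (simp add: algebra_simps)
  moreover have "sphere_lap (curv n c v f) p = (\<Sum>b\<in>Basis. ehess n v f b b p) * inverse (c * v p ^ n)"
    unfolding sphere_lap_def sphere_hess_curv[OF C(1,2) pos(1) c n p(1)] using p1 by (simp add: sum_distrib_right)
  moreover have "sphere_lap (curv n c ?v ?f) p = (\<Sum>b\<in>Basis. ehess n ?v ?f b b p) * inverse (c * v p ^ n)"
    unfolding sphere_lap_def sphere_hess_curv[OF CP pos(2) c n p(2)] using p1 jet by (simp add: sum_distrib_right)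
  moreover have "v p * f p * inverse (c * v p ^ n) = curv n c v f p"
    using V c n by (cases n) (auto simp: curv_def field_simps)
  ultimately show ?thesis by (simp add: algebra_simps)
qed

section \<open>Eigenvalues of symmetric matrices\<close>

lemma finite_eigenvalues:
  fixes A :: "real mat"
  assumes "A \<in> carrier_mat k k" shows "finite {e. eigenvalue A e}"
proof -
  have "char_poly A \<noteq> 0" using degree_monic_char_poly[OF assms] by auto
  then show ?thesis using eigenvalue_root_char_poly[OF assms] poly_roots_finite by simp
qed

text \<open>\<open>smallest_eigenvalue\<close> is a \<open>Min\<close>, meaningful only for a
  nonempty set. A complex eigenvalue exists, and it is real because the Hermitian form of a real
  symmetric matrix takes real values.\<close>

lemma symmetric_real_eigenvalue_exists:
  fixes A :: "real mat"
  assumes A: "A \<in> carrier_mat k k" and k: "k \<ge> 1"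
    and sym: "\<And>i j. i < k \<Longrightarrow> j < k \<Longrightarrow> A $$ (i, j) = A $$ (j, i)"
  shows "\<exists>e. eigenvalue A e"
proof -
  let ?A = "map_mat complex_of_real A"
  have cA: "?A \<in> carrier_mat k k" using A by simp
  have "degree (char_poly ?A) = k" using degree_monic_char_poly[OF cA] by blast
  then have "\<not> constant (poly (char_poly ?A))" using k by (simp add: constant_degree)
  then obtain z where z: "poly (char_poly ?A) z = 0" using fundamental_theorem_of_algebra by blast
  then have "eigenvalue ?A z" using eigenvalue_root_char_poly[OF cA] by simp
  then obtain v where v: "v \<in> carrier_vec k" "v \<noteq> 0\<^sub>v k" "?A *\<^sub>v v = z \<cdot>\<^sub>v v"
    using cA by (auto simp: eigenvalue_def eigenvector_def)
  define y where "y i = vec_index v i" for i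
  have row: "(\<Sum>j<k. of_real (A $$ (i, j)) * y j) = z * y i" if i: "i < k" for i
  proof -
    have "vec_index (?A *\<^sub>v v) i = (\<Sum>j<k. of_real (A $$ (i, j)) * y j)"
      using A v(1) i by (simp add: scalar_prod_def y_def atLeast0LessThan)
    then show ?thesis using v(1,3) i by (simp add: y_def)
  qed
  define s where "s = (\<Sum>i<k. \<Sum>j<k. of_real (A $$ (i, j)) * cnj (y i) * y j)"
  have "cnj s = (\<Sum>i<k. \<Sum>j<k. of_real (A $$ (i, j)) * y i * cnj (y j))"
    by (simp add: s_def)
  also have "\<dots> = (\<Sum>j<k. \<Sum>i<k. of_real (A $$ (i, j)) * y i * cnj (y j))" by (rule sum.swap)
  also have "\<dots> = s" unfolding s_def by (intro sum.cong refl) (simp add: sym mult_ac)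
  finally have s1: "cnj s = s" .
  have "s = (\<Sum>i<k. cnj (y i) * (z * y i))"
    unfolding s_def
  proof (intro sum.cong refl)
    fix i assume "i \<in> {..<k}"
    then have "z * y i = (\<Sum>j<k. of_real (A $$ (i, j)) * y j)" using row by simp
    then show "(\<Sum>j<k. of_real (A $$ (i, j)) * cnj (y i) * y j) = cnj (y i) * (z * y i)"
      by (simp add: sum_distrib_left mult_ac)
  qed
  also have "\<dots> = z * of_real (\<Sum>i<k. (norm (y i))\<^sup>2)"
    unfolding of_real_sum sum_distrib_left
    by (intro sum.cong refl) (simp add: complex_norm_square mult_ac del: of_real_power)
  finally have s2: "s = z * of_real (\<Sum>i<k. (norm (y i))\<^sup>2)" .
  obtain i where i: "i < k" "y i \<noteq> 0"
  proof -
    have "\<exists>i<k. y i \<noteq> 0"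
    proof (rule ccontr)
      assume "\<not> ?thesis"
      then have "v = 0\<^sub>v k" using v(1) by (intro eq_vecI) (auto simp: y_def)
      then show False using v(2) by simp
    qed
    then show ?thesis using that by blast
  qed
  have "(norm (y i))\<^sup>2 \<le> (\<Sum>i<k. (norm (y i))\<^sup>2)" using i by (intro member_le_sum) auto
  then have N: "(\<Sum>i<k. (norm (y i))\<^sup>2) > 0"
    using i(2) by (meson less_le_trans zero_less_norm_iff zero_less_power)
  have "cnj z = z" using s1 N unfolding s2 by (auto simp: complex_eq_iff)
  then obtain e where e: "z = of_real e" by (metis Reals_cases Reals_cnj_iff)
  have "poly (map_poly of_real (char_poly A)) (complex_of_real e) = 0"
    using z unfolding e of_real_hom.char_poly_hom[OF A] .
  then have "poly (char_poly A) e = 0" by (simp only: of_real_hom.poly_map_poly of_real_eq_0_iff)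
  then show ?thesis using eigenvalue_root_char_poly[OF A] by blast
qed

lemma eigenvalue_smallest_eigenvalue:
  fixes A :: "real mat"
  assumes "A \<in> carrier_mat k k" "k \<ge> 1" "\<And>i j. i < k \<Longrightarrow> j < k \<Longrightarrow> A $$ (i, j) = A $$ (j, i)"
  shows "eigenvalue A (smallest_eigenvalue A)"
  using Min_in[OF finite_eigenvalues[OF assms(1)]] symmetric_real_eigenvalue_exists[OF assms]
  by (auto simp: smallest_eigenvalue_def)

text \<open>A kernel vector of A - t D is an eigenvector of D^(-1) A for the eigenvalue t, and a
  matrix has finitely many eigenvalues.\<close>

lemma finite_singular_diagonal_shifts:
  fixes A :: "real mat" and d :: "nat \<Rightarrow> real"
  assumes A: "A \<in> carrier_mat k k" and d: "\<And>i. i < k \<Longrightarrow> d i \<noteq> 0"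
  shows "finite {t. eigenvalue (Matrix.mat k k (\<lambda>(i, j). if i = j then A $$ (i, i) - t * d i else A $$ (i, j))) 0}"
proof -
  define B where "B = Matrix.mat k k (\<lambda>(i, j). A $$ (i, j) / d i)"
  have B: "B \<in> carrier_mat k k" by (simp add: B_def)
  have "eigenvalue B t" if ev: "eigenvalue (Matrix.mat k k (\<lambda>(i, j). if i = j then A $$ (i, i) - t * d i else A $$ (i, j))) 0"
    (is "eigenvalue ?M 0") for t
  proof -
    obtain x where "eigenvector ?M x 0" using ev unfolding eigenvalue_def by blast
    then have x: "x \<in> carrier_vec k" "x \<noteq> 0\<^sub>v k" "?M *\<^sub>v x = 0 \<cdot>\<^sub>v x"
      unfolding eigenvector_def by simp_all
    have "B *\<^sub>v x = t \<cdot>\<^sub>v x"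
    proof (rule eq_vecI)
      fix i assume "i < dim_vec (t \<cdot>\<^sub>v x)"
      then have i: "i < k" using x(1) by simp
      have "vec_index (?M *\<^sub>v x) i = (\<Sum>j<k. (if i = j then A $$ (i, i) - t * d i else A $$ (i, j)) * vec_index x j)"
        using x(1) i by (simp add: scalar_prod_def atLeast0LessThan)
      also have "\<dots> = (\<Sum>j<k. A $$ (i, j) * vec_index x j - (if i = j then t * d i * vec_index x j else 0))"
        by (intro sum.cong refl) (auto simp: algebra_simps)
      also have "\<dots> = (\<Sum>j<k. A $$ (i, j) * vec_index x j) - t * d i * vec_index x i"
        using i by (simp add: sum_subtractf sum.delta)
      finally have "(\<Sum>j<k. A $$ (i, j) * vec_index x j) = t * d i * vec_index x i"
        using x(1,3) i by simp
      moreover have "vec_index (B *\<^sub>v x) i = (\<Sum>j<k. A $$ (i, j) * vec_index x j) / d i"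
        using x(1) i by (simp add: B_def scalar_prod_def atLeast0LessThan sum_divide_distrib)
      ultimately show "vec_index (B *\<^sub>v x) i = vec_index (t \<cdot>\<^sub>v x) i" using d[OF i] x(1) i by simp
    qed (use x(1) B in simp)
    then show ?thesis using x B by (auto simp: eigenvalue_def eigenvector_def)
  qed
  then show ?thesis by (intro finite_subset[OF _ finite_eigenvalues[OF B]]) blast
qed

section \<open>Perturbation into the class \<open>A\<close>\<close>

lemma G_fun_commute: "G_fun p q = G_fun q p"
  by (simp add: G_fun_def sphere_dist_def inner_commute)

lemma perturb_line: "perturb v (\<lambda>_. h) (t :: real) = (\<lambda>x. v x + t * h x)"
  by (simp add: perturb_def fun_eq_iff)

text \<open>The Morse perturbation has to come first: it makes the critical set finite, so that only
  finitely many values of t are forbidden afterwards.\<close>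

lemma A_set_perturbation:
  fixes v f :: "real ^ 'd \<Rightarrow> real"
  assumes n: "n \<ge> 3" and dim: "CARD('d) = n + 1" and vf: "P_pair n v f" and c: "c > 0"
    and pos: "\<forall>x\<in>sphere 0 1. v x > 0" "\<forall>x\<in>sphere 0 1. f x > 0" and \<epsilon>: "\<epsilon> > 0"
  obtains v' f' where "P_pair n v' f'" "\<And>x. norm x = 1 \<Longrightarrow> \<bar>v' x - v x\<bar> < \<epsilon>" "\<forall>x\<in>sphere 0 1. v' x > 0"
    "morse (curv n c v' f')" "curv n c v' f' \<in> A_set n \<sigma>"
proof -
  let ?S = "sphere (0 :: real ^ 'd) 1"
  have dim': "DIM(real ^ 'd) = n + 1" using dim by simp
  have csph: "continuous_on ?S g" if "Cinf_on (- {0}) (radial_ext g)" for g :: "real ^ 'd \<Rightarrow> real"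
    by (rule continuous_on_eq[OF continuous_on_subset[OF Cinf_on_continuous[OF that]]]) auto
  have ne: "?S \<noteq> {}" by simp
  obtain a where a: "a \<in> ?S" "\<And>x. x \<in> ?S \<Longrightarrow> v a \<le> v x"
    using continuous_attains_inf[OF compact_sphere ne csph[OF P_pair_Cinf(1)[OF vf]]] by blast
  obtain b where b: "b \<in> ?S" "\<And>x. x \<in> ?S \<Longrightarrow> f b \<le> f x"
    using continuous_attains_inf[OF compact_sphere ne csph[OF P_pair_Cinf(2)[OF vf]]] by blast
  \<comment> \<open>Each of the two perturbations costs at most e, so 2 e must not exceed \<epsilon>
    nor the minima of v and f.\<close>
  define e where "e = min (\<epsilon> / 2) (min (v a / 2) (f b / 2))"
  have e: "e > 0" "e \<le> \<epsilon> / 2" "e \<le> v a / 2" "e \<le> f b / 2"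
    using \<epsilon> pos a(1) b(1) by (auto simp: e_def)
  obtain v1 f1 where 1: "P_pair n v1 f1" "C1_close e v v1" "C1_close e f f1" "morse_on n v1 f1 ?S"
    by (rule morse_density[OF n vf pos(1) e(1)])
  note C1 = P_pair_Cinf[OF 1(1)]
  define Z where "Z = {x \<in> ?S. \<forall>b\<in>Basis. egrad n v1 f1 b x = 0}"
  have finZ: "finite Z" unfolding Z_def by (rule critical_points_finite[OF C1 1(4)])
  have Z1: "norm p = 1" if "p \<in> Z" for p using that by (simp add: Z_def)
  obtain h g where hg: "P_pair n h g"
    "\<And>p. p \<in> Z \<Longrightarrow> h p = 0" "\<And>p u. p \<in> Z \<Longrightarrow> pd u (radial_ext h) p = 0"
    "\<And>p. p \<in> Z \<Longrightarrow> sphere_lap h p = 0" "\<And>p. p \<in> Z \<Longrightarrow> g p = 0"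
    "\<And>p u. p \<in> Z \<Longrightarrow> pd u (radial_ext g) p = 0" "\<And>p. p \<in> Z \<Longrightarrow> sphere_lap g p = f1 p"
    by (rule jet_interpolation[OF n dim' finZ, of f1]) (erule Z1, blast)
  note Ch = P_pair_Cinf[OF hg(1)]
  have "\<exists>\<delta>>0. \<forall>t. \<bar>t\<bar> < \<delta> \<longrightarrow>
    {x \<in> ?S. \<forall>b\<in>Basis. egrad n (\<lambda>x. v1 x + t * h x) (\<lambda>x. f1 x + t * g x) b x = 0} = Z"
    unfolding Z_def by (rule critical_points_stable[OF C1 Ch 1(4)]) (use hg(2,3,5,6) in \<open>simp_all add: Z_def\<close>)
  then obtain \<delta>1 where \<delta>1: "\<delta>1 > 0" "\<And>t. \<bar>t\<bar> < \<delta>1 \<Longrightarrow>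
    {x \<in> ?S. \<forall>b\<in>Basis. egrad n (\<lambda>x. v1 x + t * h x) (\<lambda>x. f1 x + t * g x) b x = 0} = Z"
    by blast
  obtain \<delta>2 where \<delta>2: "\<delta>2 > 0" "\<And>t :: real. norm t < \<delta>2 \<Longrightarrow>
      morse_on n (perturb v1 (\<lambda>_. h) t) (perturb f1 (\<lambda>_. g) t) ?S"
    by (rule morse_on_perturb[where 'b = real and h = "\<lambda>_. h" and g = "\<lambda>_. g",
          OF 1(1) hg(1) compact_sphere order_refl 1(4)]) blast+
  note \<delta>2 = \<delta>2[unfolded perturb_line real_norm_def]
  obtain \<delta>3 where \<delta>3: "\<delta>3 > 0" "\<And>t :: real. norm t < \<delta>3 \<Longrightarrow> C1_close e v1 (perturb v1 (\<lambda>_. h) t)"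
    by (rule C1_close_perturb[where 'b = real and h = "\<lambda>_. h", OF C1(1) Ch(1) e(1)]) blast+
  note \<delta>3 = \<delta>3[unfolded perturb_line real_norm_def]
  obtain \<delta>4 where \<delta>4: "\<delta>4 > 0" "\<And>t :: real. norm t < \<delta>4 \<Longrightarrow> C1_close e f1 (perturb f1 (\<lambda>_. g) t)"
    by (rule C1_close_perturb[where 'b = real and h = "\<lambda>_. g", OF C1(2) Ch(2) e(1)]) blast+
  note \<delta>4 = \<delta>4[unfolded perturb_line real_norm_def]
  define \<delta> where "\<delta> = min (min \<delta>1 \<delta>2) (min \<delta>3 \<delta>4)"
  have \<delta>: "\<delta> > 0" using \<delta>1(1) \<delta>2(1) \<delta>3(1) \<delta>4(1) by (simp add: \<delta>_def)
  let ?K = "curv n c v1 f1"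
  have v1: "\<bar>v1 x - v x\<bar> < e" "\<bar>f1 x - f x\<bar> < e" if "norm x = 1" for x
    using C1_close_sphere[OF 1(2) that] C1_close_sphere[OF 1(3) that] by auto
  have v1pos: "v1 x > 0" "f1 x > 0" if "norm x = 1" for x
    using v1[OF that] a(2)[of x] b(2)[of x] e that by auto
  have Kpos: "?K p > 0" if "norm p = 1" for p
    unfolding curv_def using v1pos[OF that] c by simp
  \<comment> \<open>All lists of distinct points of Z are treated, since which of them have negative
    Laplacian depends on t.\<close>
  define Ls where "Ls = {qs. set qs \<subseteq> Z \<and> distinct qs}"
  have finL: "finite Ls"
  proof -
    have "Ls \<subseteq> {qs. set qs \<subseteq> Z \<and> length qs \<le> card Z}"
      using finZ by (auto simp: Ls_def) (metis card_mono distinct_card)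
    then show ?thesis using finite_lists_length_le[OF finZ] finite_subset by blast
  qed
  \<comment> \<open>Adding t K to the Laplacian lowers the diagonal entry of the matrix by t times
    this number. The other entries depend only on values of K, which stay fixed on Z.\<close>
  define dg where "dg qs i = ?K (qs ! i) / ?K (qs ! i) powr (real n / (2 * \<sigma>))" for qs i
  define M where "M qs t = Matrix.mat (length qs) (length qs) (\<lambda>(i, j). if i = j
      then M_matrix n \<sigma> ?K qs $$ (i, i) - t * dg qs i else M_matrix n \<sigma> ?K qs $$ (i, j))" for qs t
  \<comment> \<open>The second part collects the t at which some Laplacian becomes zero.\<close>
  define bad where "bad = (\<Union>qs\<in>Ls. {t. eigenvalue (M qs t) 0}) \<union> (\<lambda>p. - sphere_lap ?K p / ?K p) ` Z"
  have "finite bad"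
  proof -
    have "finite {t. eigenvalue (M qs t) 0}" if "qs \<in> Ls" for qs
    proof -
      have "dg qs i \<noteq> 0" if "i < length qs" for i
      proof -
        have "qs ! i \<in> Z" using that \<open>qs \<in> Ls\<close> by (auto simp: Ls_def)
        from Kpos[OF Z1[OF this]] show ?thesis by (simp add: dg_def)
      qed
      then show ?thesis unfolding M_def
        by (intro finite_singular_diagonal_shifts) (auto simp: M_matrix_def)
    qed
    then show ?thesis unfolding bad_def using finL finZ by auto
  qed
  then have "infinite ({0<..<\<delta>} - bad)" using \<delta> infinite_Ioo by (metis Diff_infinite_finite)
  then obtain t where t: "0 < t" "t < \<delta>" "t \<notin> bad"
    by (metis Diff_iff finite.emptyI greaterThanLessThan_iff equals0I)
  let ?v = "\<lambda>x. v1 x + t * h x" and ?f = "\<lambda>x. f1 x + t * g x"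
  let ?Kt = "curv n c ?v ?f"
  have P: "P_pair n ?v ?f" by (intro P_pair_add 1(1) P_pair_cmult hg(1))
  note CP = P_pair_Cinf[OF P]
  have tt: "\<bar>t\<bar> < \<delta>1" "\<bar>t\<bar> < \<delta>2" "\<bar>t\<bar> < \<delta>3" "\<bar>t\<bar> < \<delta>4" using t by (auto simp: \<delta>_def)
  have close: "\<bar>?v x - v x\<bar> < 2 * e" "\<bar>?f x - f x\<bar> < 2 * e" if "norm x = 1" for x
    using C1_close_sphere[OF \<delta>3(2)[OF tt(3)] that] C1_close_sphere[OF \<delta>4(2)[OF tt(4)] that] v1[OF that]
    by linarith+
  have vpos: "?v x > 0" "?f x > 0" if "norm x = 1" for x
    using close[OF that] a(2)[of x] b(2)[of x] e that by auto
  have vposS: "\<forall>x\<in>?S. ?v x > 0" "\<forall>x\<in>?S. v1 x > 0" using vpos v1pos by auto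
  have n1: "n \<ge> 1" using n by simp
  have crit: "crit ?Kt = Z"
    using crit_curv_iff[OF CP vposS(1) c n1] \<delta>1(2)[OF tt(1)] by auto
  have crit1: "crit ?K = Z"
    using crit_curv_iff[OF C1 vposS(2) c n1] by (auto simp: Z_def)
  have Kt: "?Kt p = ?K p" if "p \<in> Z" for p using hg(2,5) that by (simp add: curv_def)
  have lapKt: "sphere_lap ?Kt p = sphere_lap ?K p + t * ?K p" if "p \<in> Z" for p
    using that crit crit1
    by (intro sphere_lap_curv_line[OF 1(1) hg(1) c n1 vposS(2,1)] hg(2-7)) auto
  have morse: "morse ?Kt" by (rule morse_curv[OF CP vposS(1) c n1 \<delta>2(2)[OF tt(2)]])
  have "?Kt \<in> A_set n \<sigma>"
    unfolding A_set_def
  proof (intro CollectI conjI ballI allI impI)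
    show "?Kt \<in> C2_star"
      using morse vpos c by (auto simp: C2_star_def morse_def curv_def)
    show "sphere_lap ?Kt q \<noteq> 0" if "q \<in> crit ?Kt" for q
    proof
      assume "sphere_lap ?Kt q = 0"
      moreover have "q \<in> Z" using that crit by simp
      ultimately have "t = - sphere_lap ?K q / ?K q"
        using lapKt Kpos[OF Z1, of q] by (simp add: field_simps)
      then show False using t(3) \<open>q \<in> Z\<close> by (auto simp: bad_def)
    qed
    fix qs :: "(real ^ 'd) list"
    assume qs: "2 \<le> length qs \<and> distinct qs \<and> set qs \<subseteq> crit_minus ?Kt"
    then have L: "qs \<in> Ls" using crit by (auto simp: Ls_def crit_minus_def)
    then have qi: "qs ! i \<in> Z" if "i < length qs" for i using that by (auto simp: Ls_def)
    have M: "M_matrix n \<sigma> ?Kt qs = M qs t"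
    proof (rule eq_matI)
      fix i j assume "i < dim_row (M qs t)" "j < dim_col (M qs t)"
      then have "i < length qs" "j < length qs" by (simp_all add: M_def)
      then show "M_matrix n \<sigma> ?Kt qs $$ (i, j) = M qs t $$ (i, j)"
        using qi Kt lapKt
        by (auto simp: M_matrix_def M_def dg_def add_divide_distrib diff_divide_distrib)
    qed (auto simp: M_matrix_def M_def)
    have "eigenvalue (M_matrix n \<sigma> ?Kt qs) (smallest_eigenvalue (M_matrix n \<sigma> ?Kt qs))"
    proof (rule eigenvalue_smallest_eigenvalue)
      show "M_matrix n \<sigma> ?Kt qs \<in> carrier_mat (length qs) (length qs)" by (simp add: M_matrix_def)
      show "1 \<le> length qs" using qs by simp
      show "M_matrix n \<sigma> ?Kt qs $$ (i, j) = M_matrix n \<sigma> ?Kt qs $$ (j, i)"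
        if "i < length qs" "j < length qs" for i j
        using that by (simp add: M_matrix_def G_fun_commute[of "qs ! i" "qs ! j"] mult.commute)
    qed
    moreover have "\<not> eigenvalue (M_matrix n \<sigma> ?Kt qs) 0" using t(3) L unfolding M bad_def by auto
    ultimately show "smallest_eigenvalue (M_matrix n \<sigma> ?Kt qs) \<noteq> 0" by auto
  qed
  then show ?thesis using that[OF P _ vposS(1) morse] close e(2) by force
qed

section \<open>Zonal harmonics\<close>

text \<open>The Gegenbauer recurrence, homogenized; \<open>a\<close> is twice the Gegenbauer parameter.\<close>

fun zonal :: "real \<Rightarrow> 'a::real_inner \<Rightarrow> nat \<Rightarrow> 'a \<Rightarrow> real" where
  "zonal a q 0 x = 1"
| "zonal a q (Suc 0) x = a * (x \<bullet> q)"
| "zonal a q (Suc (Suc l)) x = inverse (real l + 2) *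
     ((2 * real l + 2 + a) * ((x \<bullet> q) * zonal a q (Suc l) x) - (real l + a) * ((x \<bullet> x) * zonal a q l x))"

lemma Cinf_inner: "Cinf_on S (\<lambda>x. x \<bullet> (q :: 'a::real_inner))"
  by (rule Cinf_on_bounded_linear[OF bounded_linear_inner_left])

lemma has_derivative_inner_self: "((\<lambda>x. x \<bullet> x) has_derivative (\<lambda>u. 2 * (x \<bullet> u))) (at (x :: 'a::real_inner))"
  by (auto intro!: derivative_eq_intros simp: inner_commute)

lemma Cinf_inner_self: "Cinf_on UNIV (\<lambda>x. x \<bullet> (x :: 'a::real_inner))"
proof -
  have "Ck_on k UNIV (\<lambda>x. x \<bullet> (x :: 'a))" for k
  proof (cases k)
    case 0
    then show ?thesis by (auto intro!: continuous_intros)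
  next
    case (Suc j)
    have "pd u (\<lambda>x. x \<bullet> (x :: 'a)) = (\<lambda>x. 2 * (x \<bullet> u))" for u
      by (rule ext, rule pd_eq[OF has_derivative_inner_self])
    moreover have "Ck_on j UNIV (\<lambda>x. 2 * (x \<bullet> (u :: 'a)))" for u
      by (intro Cinf_on_Ck_on Cinf_on_cmult Cinf_inner) simp
    moreover have "(\<lambda>x. x \<bullet> (x :: 'a)) differentiable_on UNIV"
      using has_derivative_inner_self differentiableI by (auto intro!: differentiable_at_imp_differentiable_on)
    ultimately show ?thesis by (simp add: Suc Ck_on_Suc)
  qed
  then show ?thesis by (simp add: Cinf_on_def)
qed

lemma pd_inner_self: "pd u (\<lambda>x. x \<bullet> x) x = 2 * (x \<bullet> (u :: 'a::real_inner))"
  by (rule pd_eq[OF has_derivative_inner_self])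

lemma pd_inner_mult:
  "Cinf_on UNIV H \<Longrightarrow> pd u (\<lambda>x. (x \<bullet> q) * H x) x = (x \<bullet> q) * pd u H x + (u \<bullet> q) * H x"
  for q :: "'a::real_inner"
  by (subst pd_mult) (auto simp: inner_differentiable Cinf_on_UNIV_differentiable pd_inner)

lemma pd_inner_self_mult:
  "Cinf_on UNIV H \<Longrightarrow> pd u (\<lambda>x. (x \<bullet> x) * H x) x = (x \<bullet> x) * pd u H x + 2 * (x \<bullet> u) * H x"
  for u :: "'a::real_inner"
  by (subst pd_mult) (auto simp: Cinf_on_UNIV_differentiable Cinf_inner_self pd_inner_self)

lemma lap_inner_mult:
  fixes q :: "'a::euclidean_space"
  assumes H: "Cinf_on UNIV H"
  shows "lap (\<lambda>x. (x \<bullet> q) * H x) x = (x \<bullet> q) * lap H x + 2 * pd q H x"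
proof -
  note d = Cinf_on_UNIV_differentiable
  have e: "pd b (\<lambda>x. (x \<bullet> q) * H x) = (\<lambda>x. (x \<bullet> q) * pd b H x + (b \<bullet> q) * H x)" for b
    by (rule ext, rule pd_inner_mult[OF H])
  have "pd b (pd b (\<lambda>x. (x \<bullet> q) * H x)) x = (x \<bullet> q) * pd b (pd b H) x + 2 * ((q \<bullet> b) * pd b H x)" for b
    unfolding e
    by (subst pd_add) (auto intro!: d Cinf_on_mult Cinf_on_cmult Cinf_inner Cinf_on_pd H
        simp: pd_inner_mult[OF Cinf_on_pd[OF H]] pd_cmult[OF d[OF H]] inner_commute)
  then show ?thesis
    unfolding lap_def pd_euclidean[OF d[OF H], of q] by (simp add: sum.distrib sum_distrib_left)
qed

lemma lap_inner_self_mult: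
  fixes H :: "'a::euclidean_space \<Rightarrow> real"
  assumes H: "Cinf_on UNIV H"
  shows "lap (\<lambda>x. (x \<bullet> x) * H x) x = (x \<bullet> x) * lap H x + 4 * pd x H x + 2 * real DIM('a) * H x"
proof -
  note d = Cinf_on_UNIV_differentiable
  have e: "pd b (\<lambda>x. (x \<bullet> x) * H x) = (\<lambda>x. (x \<bullet> x) * pd b H x + 2 * ((x \<bullet> b) * H x))" for b
    by (rule ext) (simp add: pd_inner_self_mult[OF H])
  have "pd b (pd b (\<lambda>x. (x \<bullet> x) * H x)) x
      = (x \<bullet> x) * pd b (pd b H) x + 4 * ((x \<bullet> b) * pd b H x) + 2 * ((b \<bullet> b) * H x)" for b
  proof -
    have "pd b (pd b (\<lambda>x. (x \<bullet> x) * H x)) x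
        = pd b (\<lambda>x. (x \<bullet> x) * pd b H x) x + pd b (\<lambda>x. 2 * ((x \<bullet> b) * H x)) x"
      unfolding e by (rule pd_add) (intro d Cinf_on_mult Cinf_on_cmult Cinf_inner Cinf_inner_self Cinf_on_pd H open_UNIV)+
    also have "pd b (\<lambda>x. 2 * ((x \<bullet> b) * H x)) x = 2 * pd b (\<lambda>x. (x \<bullet> b) * H x) x"
      by (rule pd_cmult) (intro d Cinf_on_mult Cinf_inner H open_UNIV)
    finally show ?thesis
      unfolding pd_inner_self_mult[OF Cinf_on_pd[OF H]] pd_inner_mult[OF H] by (simp add: algebra_simps)
  qed
  then have "lap (\<lambda>x. (x \<bullet> x) * H x) x = (\<Sum>b\<in>Basis. (x \<bullet> x) * pd b (pd b H) x)
      + (\<Sum>b\<in>Basis. 4 * ((x \<bullet> b) * pd b H x)) + (\<Sum>b\<in>(Basis::'a set). 2 * H x)"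
    unfolding lap_def by (simp add: sum.distrib)
  then show ?thesis
    unfolding lap_def pd_euclidean[OF d[OF H], of x] by (simp add: sum_distrib_left)
qed

text \<open>The Laplacian of (x . q) H contains twice the derivative of H in direction q. The
  identity \<open>pdq\<close> expresses this derivative for H of index k + 1 by the harmonic of
  index k, and the choice of a cancels it against the Laplacian of |x|^2 times that
  harmonic.\<close>

lemma solid_harm_zonal:
  fixes q :: "'a::euclidean_space"
  assumes q: "norm q = 1" and a: "a = real DIM('a) - 2"
  shows "solid_harm l (zonal a q l)"
proof -
  have qq: "q \<bullet> q = 1" using q by (simp add: norm_eq_1)
  have C: "Cinf_on UNIV (zonal a q l) \<and> Cinf_on UNIV (zonal a q (Suc l))" for l
  proof (induction l)
    case 0
    have "zonal a q 0 = (\<lambda>x. 1)" "zonal a q (Suc 0) = (\<lambda>x. a * (x \<bullet> q))" by auto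
    then show ?case by (simp add: Cinf_on_const Cinf_on_cmult Cinf_inner)
  next
    case (Suc l)
    have "zonal a q (Suc (Suc l)) = (\<lambda>x. inverse (real l + 2) *
     ((2 * real l + 2 + a) * ((x \<bullet> q) * zonal a q (Suc l) x) - (real l + a) * ((x \<bullet> x) * zonal a q l x)))" by auto
    moreover have "Cinf_on UNIV \<dots>"
      using Suc by (intro Cinf_on_cmult Cinf_on_minus Cinf_on_mult Cinf_inner Cinf_inner_self open_UNIV) auto
    ultimately show ?case using Suc by simp
  qed
  note C = conjunct1[OF C]
  have hom: "zonal a q l (t *\<^sub>R x) = t ^ l * zonal a q l x" for l t x
    by (induction a q l x rule: zonal.induct) (simp_all add: algebra_simps)
  have pd_rec: "pd u (zonal a q (Suc (Suc l))) x = inverse (real l + 2) *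
     ((2 * real l + 2 + a) * ((x \<bullet> q) * pd u (zonal a q (Suc l)) x + (u \<bullet> q) * zonal a q (Suc l) x)
      - (real l + a) * ((x \<bullet> x) * pd u (zonal a q l) x + 2 * (x \<bullet> u) * zonal a q l x))" for u l x
  proof -
    let ?F = "\<lambda>x. (2 * real l + 2 + a) * ((x \<bullet> q) * zonal a q (Suc l) x)"
    let ?G = "\<lambda>x. (real l + a) * ((x \<bullet> x) * zonal a q l x)"
    have FG: "Cinf_on UNIV ?F" "Cinf_on UNIV ?G"
      by (intro Cinf_on_cmult Cinf_on_mult Cinf_inner Cinf_inner_self C open_UNIV)+
    have FG': "Cinf_on UNIV (\<lambda>x. (x \<bullet> q) * zonal a q (Suc l) x)" "Cinf_on UNIV (\<lambda>x. (x \<bullet> x) * zonal a q l x)"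
      by (intro Cinf_on_mult Cinf_inner Cinf_inner_self C open_UNIV)+
    note d = Cinf_on_UNIV_differentiable
    have "zonal a q (Suc (Suc l)) = (\<lambda>x. inverse (real l + 2) * (?F x - ?G x))" by auto
    then have "pd u (zonal a q (Suc (Suc l))) x = inverse (real l + 2) * (pd u ?F x - pd u ?G x)"
      using d[OF FG(1), of x] d[OF FG(2), of x] by (simp add: pd_cmult pd_diff)
    then show ?thesis
      by (simp only: pd_cmult[OF d[OF FG'(1)]] pd_cmult[OF d[OF FG'(2)]] pd_inner_mult[OF C] pd_inner_self_mult[OF C])
  qed
  have pdq: "pd q (zonal a q (Suc l)) x = (real l + a) * zonal a q l x" for l x
  proof (induction l rule: less_induct)
    case (less l)
    have z0: "zonal a q 0 = (\<lambda>x. 1)" and z1: "zonal a q (Suc 0) = (\<lambda>x. a * (x \<bullet> q))" by auto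
    have p1: "pd q (zonal a q (Suc 0)) x = a"
      unfolding z1 by (subst pd_cmult[OF inner_differentiable]) (simp add: pd_inner qq)
    consider "l = 0" | "l = Suc 0" | k where "l = Suc (Suc k)" by (metis not0_implies_Suc)
    then show ?case
    proof cases
      case 1
      then show ?thesis using p1 by (simp del: zonal.simps(2))
    next
      case 2
      have zx: "zonal a q (Suc 0) x = a * (x \<bullet> q)" by simp
      have "pd q (zonal a q (Suc (Suc 0))) x = inverse 2 * ((2 + a) * ((x \<bullet> q) * a + a * (x \<bullet> q)) - a * (2 * (x \<bullet> q)))"
        unfolding pd_rec using p1 by (simp add: qq z0 del: zonal.simps(2)) simp
      then show ?thesis unfolding 2 zx by (simp add: field_simps del: zonal.simps)
    next
      case 3
      have 1: "pd q (zonal a q (Suc l)) x = inverse (real (Suc k) + 2) *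
         ((2 * real (Suc k) + 2 + a) * ((x \<bullet> q) * ((real (Suc k) + a) * zonal a q (Suc k) x) + zonal a q l x)
          - (real (Suc k) + a) * ((x \<bullet> x) * ((real k + a) * zonal a q k x) + 2 * (x \<bullet> q) * zonal a q (Suc k) x))"
        unfolding 3 pd_rec[of q "Suc k" x] using less[of "Suc k"] less[of k] 3 by (simp add: qq del: zonal.simps)
      have 2: "(real k + 2) * zonal a q l x = (2 * real k + 2 + a) * ((x \<bullet> q) * zonal a q (Suc k) x)
          - (real k + a) * ((x \<bullet> x) * zonal a q k x)"
        unfolding 3 by simp
      have "(real k + 3) * pd q (zonal a q (Suc l)) x = (2 * real k + 4 + a) * zonal a q l x
          + (real k + 1 + a) * ((2 * real k + 2 + a) * ((x \<bullet> q) * zonal a q (Suc k) x)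
          - (real k + a) * ((x \<bullet> x) * zonal a q k x))"
        unfolding 1 by (simp add: field_simps)
      also have "\<dots> = (real k + 3) * ((real l + a) * zonal a q l x)"
        unfolding 2[symmetric] 3 by (simp add: algebra_simps)
      finally show ?thesis by simp
    qed
  qed
  have "lap (zonal a q l) x = 0" for x
  proof (induction l rule: less_induct)
    case (less l)
    consider "l = 0" | "l = Suc 0" | k where "l = Suc (Suc k)" by (metis not0_implies_Suc)
    then show ?case
    proof cases
      case 1
      have "zonal a q 0 = (\<lambda>x. 1)" by auto
      then show ?thesis using 1 by (simp add: lap_def)
    next
      case 2
      have "zonal a q (Suc 0) = (\<lambda>x. a * (x \<bullet> q))" by auto
      moreover have "pd b (\<lambda>x. a * (x \<bullet> q)) = (\<lambda>x. a * (b \<bullet> q))" for b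
        by (rule ext, subst pd_cmult[OF inner_differentiable]) (simp add: pd_inner)
      ultimately show ?thesis using 2 by (simp add: lap_def)
    next
      case 3
      let ?F = "\<lambda>x. (x \<bullet> q) * zonal a q (Suc k) x" and ?G = "\<lambda>x. (x \<bullet> x) * zonal a q k x"
      have FG: "Cinf_on UNIV ?F" "Cinf_on UNIV ?G"
        by (intro Cinf_on_mult Cinf_inner Cinf_inner_self C open_UNIV)+
      have "zonal a q l = (\<lambda>x. (inverse (real k + 2) * (2 * real k + 2 + a)) * ?F x
          + (- inverse (real k + 2) * (real k + a)) * ?G x)"
        unfolding 3 by (auto simp: algebra_simps)
      then have "lap (zonal a q l) x = (inverse (real k + 2) * (2 * real k + 2 + a)) * lap ?F x
          + (- inverse (real k + 2) * (real k + a)) * lap ?G x"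
        using FG by (simp only: lap_add lap_cmult Cinf_on_cmult open_UNIV)
      also have "lap ?F x = 2 * ((real k + a) * zonal a q k x)"
        unfolding lap_inner_mult[OF C] pdq using less[of "Suc k"] 3 by simp
      also have "lap ?G x = (4 * real k + 2 * (a + 2)) * zonal a q k x"
      proof -
        have px: "pd x (zonal a q k) x = real k * zonal a q k x"
          by (rule euler_homogeneous) (auto simp: Cinf_on_UNIV_differentiable C hom powr_realpow)
        have a': "real DIM('a) = a + 2" using a by simp
        show ?thesis
          unfolding lap_inner_self_mult[OF C] px a' using less[of k] 3 by (simp add: algebra_simps)
      qed
      finally show ?thesis by (simp add: algebra_simps)
    qed
  qed
  then show ?thesis using C hom by (simp add: solid_harm_def)
qed

lemma P_eig_Suc: "n \<ge> 2 \<Longrightarrow> (real l + 1) * P_eig n (Suc l) = (real l + real n - 1) * P_eig n l"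
  using pochhammer_rec[of "real l + 1" "n - 2"] pochhammer_rec'[of "real l + 1" "n - 2"]
  by (simp add: P_eig_def of_nat_diff algebra_simps)

lemma P_eig_pos: "P_eig n l > 0"
  unfolding P_eig_def by (intro pochhammer_pos) simp

text \<open>For the parameter n - 1 the value (n - 1)_l / l! at the pole is proportional to
  \<open>P_eig n l\<close>. Dividing the coefficients by \<open>P_eig\<close> therefore leaves a
  plain geometric series at the pole, which makes the concentration of v explicit.\<close>

lemma zonal_pole:
  fixes q :: "'a::real_inner"
  assumes n: "n \<ge> 2" and q: "norm q = 1"
  shows "zonal (real n - 1) q l q = P_eig n l / P_eig n 0"
proof (induction l rule: less_induct)
  case (less l)
  have qq: "q \<bullet> q = 1" using q by (simp add: norm_eq_1)
  have S: "P_eig n (Suc l) = (real l + real n - 1) * P_eig n l / (real l + 1)" for l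
    using P_eig_Suc[OF n, of l] by (simp add: field_simps)
  have P0: "P_eig n 0 \<noteq> 0" using P_eig_pos[of n 0] by simp
  consider "l = 0" | "l = Suc 0" | k where "l = Suc (Suc k)" by (metis not0_implies_Suc)
  then show ?case
  proof cases
    case 1
    then show ?thesis using P0 by simp
  next
    case 2
    then show ?thesis using S[of 0] P0 by (simp add: qq)
  next
    case 3
    have "zonal (real n - 1) q l q = inverse (real k + 2) *
     ((2 * real k + 2 + (real n - 1)) * (P_eig n (Suc k) / P_eig n 0) - (real k + (real n - 1)) * (P_eig n k / P_eig n 0))"
      using less[of "Suc k"] less[of k] by (simp add: 3 qq)
    also have "(real k + (real n - 1)) * (P_eig n k / P_eig n 0) = (real k + 1) * (P_eig n (Suc k) / P_eig n 0)"
      using P_eig_Suc[OF n, of k] by (simp add: field_simps)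
    also have "inverse (real k + 2) * ((2 * real k + 2 + (real n - 1)) * (P_eig n (Suc k) / P_eig n 0)
        - (real k + 1) * (P_eig n (Suc k) / P_eig n 0))
        = ((real k + real n) * P_eig n (Suc k) / (real k + 2)) / P_eig n 0"
      by (simp add: divide_inverse algebra_simps)
    also have "(real k + real n) * P_eig n (Suc k) / (real k + 2) = P_eig n l"
      using S[of "Suc k"] by (simp add: 3 add.commute)
    finally show ?thesis .
  qed
qed

text \<open>Expansion of \<open>(1 - 2 \<tau> s + \<tau>\<^sup>2)\<^sup>-\<^sup>\<lambda> = \<bar>1 - \<tau> e\<bar>\<^sup>-\<^sup>2\<^sup>\<lambda>\<close>, where \<open>e\<close> has modulus \<open>1\<close> and real part \<open>s\<close>,
  as the Cauchy product of two binomial series.\<close>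

definition binom_coeff :: "real \<Rightarrow> nat \<Rightarrow> real" where
  "binom_coeff \<beta> j = pochhammer \<beta> j / fact j"

lemma binom_coeff_Suc: "(real j + 1) * binom_coeff \<beta> (Suc j) = (\<beta> + real j) * binom_coeff \<beta> j"
proof -
  have "binom_coeff \<beta> (Suc j) = (\<beta> + real j) * pochhammer \<beta> j / ((real j + 1) * fact j)"
    by (simp add: binom_coeff_def pochhammer_Suc mult.commute add.commute)
  moreover have "real j + 1 \<noteq> 0" by simp
  ultimately show ?thesis by (simp add: binom_coeff_def)
qed

lemma binom_coeff_nonneg: "\<beta> > 0 \<Longrightarrow> binom_coeff \<beta> j \<ge> 0"
  by (simp add: binom_coeff_def pochhammer_pos less_imp_le)

lemma binom_coeff_sums:
  fixes z :: complex
  assumes "norm z < 1"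
  shows "(\<lambda>j. of_real (binom_coeff \<beta> j) * z ^ j) sums ((1 - z) powr of_real (- \<beta>))"
proof -
  have "(\<lambda>j. (of_real (- \<beta>) gchoose j) * (- z) ^ j) sums (1 + - z) powr of_real (- \<beta>)"
    by (rule gen_binomial_complex) (use assms in simp)
  moreover have "(of_real (- \<beta>) gchoose j) * (- z) ^ j = of_real (binom_coeff \<beta> j) * z ^ j" for j
  proof -
    have "(of_real (- \<beta>) gchoose j :: complex) = (-1) ^ j * pochhammer (of_real \<beta>) j / fact j"
      by (simp add: gbinomial_pochhammer)
    then have "(of_real (- \<beta>) gchoose j) * (- z) ^ j
        = ((-1) ^ j * (-1) ^ j) * (pochhammer (of_real \<beta>) j / fact j * z ^ j)"
      unfolding power_minus[of z] by (simp only: mult_ac times_divide_eq_right times_divide_eq_left)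
    also have "(-1) ^ j * (-1) ^ j = (1 :: complex)" by (rule minus_one_mult_self)
    also have "pochhammer (of_real \<beta>) j / fact j = (of_real (binom_coeff \<beta> j) :: complex)"
      by (simp add: binom_coeff_def pochhammer_of_real)
    finally show ?thesis by simp
  qed
  ultimately show ?thesis by simp
qed

definition cos_sum :: "real \<Rightarrow> complex \<Rightarrow> nat \<Rightarrow> complex" where
  "cos_sum \<beta> e l = (\<Sum>j\<le>l. (of_real (binom_coeff \<beta> j) * e ^ j) * (of_real (binom_coeff \<beta> (l - j)) * cnj e ^ (l - j)))"

text \<open>To be read with B1 = (1 - E X)^(-b), B2 = (1 - F X)^(-b) and their derivatives D1, D2:
  the hypotheses are the equations of the binomial series, the conclusion that of their
  product.\<close>

lemma product_ode:
  fixes E F X :: "'a::comm_ring_1"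
  assumes "(1 - E * X) * D1 = b * E * B1" "(1 - F * X) * D2 = b * F * B2"
  shows "(1 - (E + F) * X + E * F * X\<^sup>2) * (B1 * D2 + D1 * B2) = b * ((E + F) - 2 * (E * F) * X) * (B1 * B2)"
proof -
  have "1 - (E + F) * X + E * F * X\<^sup>2 = (1 - E * X) * (1 - F * X)"
    by (simp add: algebra_simps power2_eq_square)
  then have "(1 - (E + F) * X + E * F * X\<^sup>2) * (B1 * D2 + D1 * B2)
      = ((1 - E * X) * D1) * ((1 - F * X) * B2) + ((1 - F * X) * D2) * ((1 - E * X) * B1)"
    by (simp only: distrib_left mult_ac add.commute)
  then show ?thesis unfolding assms by (simp add: algebra_simps)
qed

text \<open>As a formal power series the generating function satisfies (1 - 2 s X + X^2) G' = 2
  \<beta> (s - X) G with s = Re e; comparing coefficients gives the recurrence of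
  \<open>zonal\<close>.\<close>

lemma zonal_eq_cos_sum:
  fixes q x :: "'a::real_inner"
  assumes e: "norm e = 1" and x: "norm x = 1" "x \<bullet> q = Re e"
  shows "of_real (zonal (2 * \<beta>) q l x) = cos_sum \<beta> e l"
proof -
  define B where "B e = Abs_fps (\<lambda>j. of_real (binom_coeff \<beta> j) * e ^ j)" for e :: complex
  define G where "G = B e * B (cnj e)"
  have G_nth: "fps_nth G l = cos_sum \<beta> e l" for l
    by (simp add: G_def B_def cos_sum_def fps_mult_nth atLeast0AtMost)
  have B': "(1 - fps_const e * fps_X) * fps_deriv (B e) = fps_const (of_real \<beta> * e) * B e" for e
  proof (rule fps_ext)
    fix j
    have 1: "of_nat (Suc j) * (of_real (binom_coeff \<beta> (Suc j)) :: complex) = of_real ((\<beta> + real j) * binom_coeff \<beta> j)"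
      using binom_coeff_Suc[of j \<beta>] by (metis of_nat_Suc of_real_add of_real_mult of_real_of_nat_eq of_real_1 add.commute)
    have "fps_nth ((1 - fps_const e * fps_X) * fps_deriv (B e)) j
        = of_nat (Suc j) * of_real (binom_coeff \<beta> (Suc j)) * e ^ Suc j - of_nat j * of_real (binom_coeff \<beta> j) * e ^ Suc j"
    proof -
      have "(1 - fps_const e * fps_X) * fps_deriv (B e) = fps_deriv (B e) - fps_const e * (fps_X * fps_deriv (B e))"
        by (simp only: left_diff_distrib mult_1 mult.assoc)
      then show ?thesis by (cases j) (simp_all add: B_def mult_ac)
    qed
    also have "\<dots> = fps_nth (fps_const (of_real \<beta> * e) * B e) j"
      unfolding 1 by (simp add: B_def algebra_simps)
    finally show "fps_nth ((1 - fps_const e * fps_X) * fps_deriv (B e)) j = fps_nth (fps_const (of_real \<beta> * e) * B e) j" .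
  qed
  have ee: "e * cnj e = 1" using e by (simp add: complex_norm_square[symmetric])
  have es: "e + cnj e = of_real (2 * Re e)" by (simp add: complex_eq_iff)
  let ?s = "of_real (Re e) :: complex"
  have Gd: "fps_deriv G = B e * fps_deriv (B (cnj e)) + fps_deriv (B e) * B (cnj e)"
    by (simp add: G_def)
  have S: "fps_const e + fps_const (cnj e) = fps_const (2 * ?s)" using es by simp
  have E: "fps_const e * fps_const (cnj e) = 1" using ee by simp
  have B'': "(1 - fps_const e * fps_X) * fps_deriv (B e) = fps_const (of_real \<beta>) * fps_const e * B e" for e
    using B'[of e] by simp
  have ode: "(1 - fps_const (2 * ?s) * fps_X + 1 * fps_X\<^sup>2) * fps_deriv G
      = fps_const (of_real \<beta>) * (fps_const (2 * ?s) - 2 * 1 * fps_X) * G"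
    using product_ode[OF B''[of e] B''[of "cnj e"]] unfolding S E Gd[symmetric] G_def[symmetric] .
  have rec: "of_nat (l + 2) * fps_nth G (l + 2)
      = of_real (2 * real l + 2 + 2 * \<beta>) * ?s * fps_nth G (Suc l) - of_real (real l + 2 * \<beta>) * fps_nth G l" for l
  proof -
    let ?D = "fps_deriv G"
    have e1: "(1 - fps_const (2 * ?s) * fps_X + 1 * fps_X\<^sup>2) * ?D
        = ?D - fps_const (2 * ?s) * (fps_X * ?D) + fps_X * (fps_X * ?D)"
      by (simp only: left_diff_distrib distrib_right mult_1 mult.assoc power2_eq_square)
    have e2: "fps_nth (?D - fps_const (2 * ?s) * (fps_X * ?D) + fps_X * (fps_X * ?D)) (Suc l)
        = fps_nth ?D (Suc l) - 2 * ?s * fps_nth ?D l + (if l = 0 then 0 else fps_nth ?D (l - 1))"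
      by (cases l) (simp_all only: fps_add_nth fps_sub_nth fps_mult_left_const_nth fps_X_mult_nth, simp_all)
    have e3: "(if l = 0 then 0 else fps_nth ?D (l - 1)) = of_nat l * fps_nth G l"
      by (cases l) simp_all
    have e4: "fps_const (of_real \<beta>) * (fps_const (2 * ?s) - 2 * 1 * fps_X) * G
        = fps_const (of_real \<beta>) * (fps_const (2 * ?s) * G - fps_const 2 * (fps_X * G))"
      by (simp only: left_diff_distrib mult_1_right mult.assoc numeral_fps_const)
    have e5: "fps_nth (fps_const (of_real \<beta>) * (fps_const (2 * ?s) * G - fps_const 2 * (fps_X * G))) (Suc l)
        = of_real \<beta> * (2 * ?s * fps_nth G (Suc l) - 2 * fps_nth G l)"
      by (simp only: fps_sub_nth fps_mult_left_const_nth fps_X_mult_nth) simp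
    have "fps_nth ?D (Suc l) - 2 * ?s * fps_nth ?D l + of_nat l * fps_nth G l
        = of_real \<beta> * (2 * ?s * fps_nth G (Suc l) - 2 * fps_nth G l)"
      using arg_cong[OF ode, of "\<lambda>F. fps_nth F (Suc l)"] unfolding e1 e2 e3 e4 e5 .
    then show ?thesis by (simp add: algebra_simps)
  qed
  have xx: "x \<bullet> x = 1" using x(1) by (simp add: norm_eq_1)
  have G0: "fps_nth G 0 = 1" by (simp add: G_nth cos_sum_def binom_coeff_def)
  have G1: "fps_nth G (Suc 0) = of_real (2 * \<beta>) * ?s"
    using es by (simp add: G_nth cos_sum_def binom_coeff_def algebra_simps)
      (simp add: complex_eq_iff)
  have "of_real (zonal (2 * \<beta>) q l x) = fps_nth G l"
  proof (induction l rule: less_induct)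
    case (less l)
    consider "l = 0" | "l = Suc 0" | k where "l = Suc (Suc k)" by (metis not0_implies_Suc)
    then show ?case
    proof cases
      case 3
      have nz: "(of_nat (k + 2) :: complex) \<noteq> 0" by (metis add_2_eq_Suc' of_nat_neq_0)
      have "of_nat (k + 2) * (of_real (zonal (2 * \<beta>) q l x) :: complex)
          = of_real ((real k + 2) * zonal (2 * \<beta>) q l x)" by simp
      also have "(real k + 2) * zonal (2 * \<beta>) q l x = (2 * real k + 2 + 2 * \<beta>) * (Re e * zonal (2 * \<beta>) q (Suc k) x)
          - (real k + 2 * \<beta>) * zonal (2 * \<beta>) q k x" by (simp add: 3 x xx)
      also have "of_real \<dots> = of_real (2 * real k + 2 + 2 * \<beta>) * ?s * fps_nth G (Suc k) - of_real (real k + 2 * \<beta>) * fps_nth G k"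
        using less[of "Suc k"] less[of k] 3 by (simp add: algebra_simps)
      also have "\<dots> = of_nat (k + 2) * fps_nth G l" unfolding rec[symmetric] by (simp add: 3)
      finally show ?thesis using nz by (metis mult_left_cancel)
    qed (use G0 G1 x in \<open>simp_all\<close>)
  qed
  then show ?thesis by (simp add: G_nth)
qed

lemma binom_coeff_summable:
  assumes "0 \<le> \<rho>" "\<rho> < 1"
  shows "summable (\<lambda>j. binom_coeff \<beta> j * \<rho> ^ j)"
proof -
  have "summable (\<lambda>j. of_real (binom_coeff \<beta> j) * complex_of_real \<rho> ^ j)"
    using binom_coeff_sums[of "of_real \<rho>" \<beta>] assms by (auto simp: sums_iff)
  then have "summable (\<lambda>j. complex_of_real (binom_coeff \<beta> j * \<rho> ^ j))" by simp
  then show ?thesis by (simp only: summable_complex_of_real)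
qed

lemma norm_powr_of_real: "z \<noteq> 0 \<Longrightarrow> norm (z powr complex_of_real r) = norm z powr r"
  by (simp add: powr_def norm_exp_eq_Re)

text \<open>The two binomial series are complex conjugates, so their product is the squared modulus
  of one of them.\<close>

lemma cos_sum_sums:
  assumes e: "norm e = 1" and \<tau>: "0 \<le> \<tau>" "\<tau> < 1" and \<beta>: "\<beta> > 0"
  shows "(\<lambda>l. cos_sum \<beta> e l * of_real (\<tau> ^ l)) sums of_real (norm (1 - e * of_real \<tau>) powr (- (2 * \<beta>)))"
proof -
  define A where "A e j = of_real (binom_coeff \<beta> j) * (e * of_real \<tau>) ^ j" for e :: complex and j
  have z: "norm (e * of_real \<tau>) < 1" "norm (cnj e * of_real \<tau>) < 1"
    using e \<tau> by (simp_all add: norm_mult)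
  have sA: "A e sums ((1 - e * of_real \<tau>) powr of_real (- \<beta>))"
    unfolding A_def by (rule binom_coeff_sums[OF z(1)])
  have "(\<lambda>j. cnj (A e j)) sums cnj ((1 - e * of_real \<tau>) powr of_real (- \<beta>))"
    by (subst sums_cnj) (rule sA)
  moreover have "(\<lambda>j. cnj (A e j)) = A (cnj e)" by (simp add: A_def fun_eq_iff)
  ultimately have sA': "A (cnj e) sums cnj ((1 - e * of_real \<tau>) powr of_real (- \<beta>))" by simp
  have n: "summable (\<lambda>j. norm (A e' j))" if "norm e' = 1" for e'
  proof -
    have "norm (A e' j) = binom_coeff \<beta> j * \<tau> ^ j" for j
      using that \<tau> binom_coeff_nonneg[OF \<beta>] by (simp add: A_def norm_mult norm_power)
    then show ?thesis using binom_coeff_summable[OF \<tau>] by simp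
  qed
  have "(\<lambda>l. \<Sum>j\<le>l. A e j * A (cnj e) (l - j)) sums ((\<Sum>j. A e j) * (\<Sum>j. A (cnj e) j))"
    by (rule Cauchy_product_sums[OF n n]) (use e in simp_all)
  moreover have "(\<Sum>j\<le>l. A e j * A (cnj e) (l - j)) = cos_sum \<beta> e l * of_real (\<tau> ^ l)" for l
  proof -
    have "A e j * A (cnj e) (l - j) = (of_real (binom_coeff \<beta> j) * e ^ j)
        * (of_real (binom_coeff \<beta> (l - j)) * cnj e ^ (l - j)) * of_real (\<tau> ^ l)" if "j \<le> l" for j
    proof -
      have "\<tau> ^ l = \<tau> ^ j * \<tau> ^ (l - j)" using that by (simp add: power_add[symmetric])
      then show ?thesis by (simp add: A_def power_mult_distrib mult_ac)
    qed
    then show ?thesis unfolding cos_sum_def sum_distrib_right by (intro sum.cong) auto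
  qed
  moreover have "(\<Sum>j. A e j) * (\<Sum>j. A (cnj e) j) = of_real (norm (1 - e * of_real \<tau>) powr (- (2 * \<beta>)))"
  proof -
    have "e * of_real \<tau> \<noteq> 1" using z(1) by (metis norm_one less_irrefl)
    then have nz: "1 - e * of_real \<tau> \<noteq> 0" by simp
    have "(\<Sum>j. A e j) * (\<Sum>j. A (cnj e) j) = of_real ((norm ((1 - e * of_real \<tau>) powr of_real (- \<beta>)))\<^sup>2)"
      using sums_unique[OF sA] sums_unique[OF sA'] by (simp only: complex_norm_square)
    also have "norm ((1 - e * of_real \<tau>) powr of_real (- \<beta>)) = norm (1 - e * of_real \<tau>) powr (- \<beta>)"
      by (rule norm_powr_of_real[OF nz])
    also have "(norm (1 - e * of_real \<tau>) powr (- \<beta>))\<^sup>2 = norm (1 - e * of_real \<tau>) powr (- (2 * \<beta>))"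
      by (simp add: power2_eq_square powr_add[symmetric])
    finally show ?thesis .
  qed
  ultimately show ?thesis by simp
qed

text \<open>The binomial coefficients are nonnegative, so e = 1 is the extreme case; it supplies the
  majorant for uniform convergence.\<close>

lemma norm_cos_sum_le:
  assumes "norm e = 1" "\<beta> > 0" shows "norm (cos_sum \<beta> e l) \<le> Re (cos_sum \<beta> 1 l)"
proof -
  have "norm (cos_sum \<beta> e l) \<le> (\<Sum>j\<le>l. binom_coeff \<beta> j * binom_coeff \<beta> (l - j))"
    unfolding cos_sum_def
    by (rule sum_norm_le) (use assms binom_coeff_nonneg[OF assms(2)] in \<open>simp add: norm_mult norm_power\<close>)
  also have "\<dots> = Re (cos_sum \<beta> 1 l)" by (simp add: cos_sum_def)
  finally show ?thesis .
qed

text \<open>Weierstrass test: the values for e = 1 at the largest radius \<rho> dominate all terms,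
  so one N serves every x and every smaller radius.\<close>

lemma zonal_partial_sums:
  fixes q :: "'a::real_inner"
  assumes \<beta>: "\<beta> > 0" and \<rho>: "0 \<le> \<rho>" "\<rho> < 1" and q: "norm q = 1" and \<delta>: "\<delta> > 0"
  shows "\<exists>N. \<forall>L\<ge>N. \<forall>\<tau> x. 0 \<le> \<tau> \<longrightarrow> \<tau> \<le> \<rho> \<longrightarrow> norm x = 1 \<longrightarrow>
    \<bar>(\<Sum>l\<le>L. zonal (2 * \<beta>) q l x * \<tau> ^ l) - (1 - 2 * \<tau> * (x \<bullet> q) + \<tau>\<^sup>2) powr (- \<beta>)\<bar> < \<delta>"
proof -
  define c where "c l = Re (cos_sum \<beta> 1 l)" for l
  have "(\<lambda>l. Re (cos_sum \<beta> 1 l * of_real (\<rho> ^ l))) sums Re (of_real (norm (1 - 1 * of_real \<rho> :: complex) powr (- (2 * \<beta>))))"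
    by (rule sums_Re[OF cos_sum_sums]) (use \<rho> \<beta> in auto)
  then have sc: "summable (\<lambda>l. c l * \<rho> ^ l)" unfolding c_def by (auto simp: sums_iff simp del: of_real_power)
  obtain N where N: "\<And>n. n \<ge> N \<Longrightarrow> norm (\<Sum>i. c (i + n) * \<rho> ^ (i + n)) < \<delta>"
    using suminf_exist_split[OF \<delta> sc] by blast
  show ?thesis
  proof (intro exI[of _ N] allI impI)
    fix L \<tau> and x :: 'a assume L: "N \<le> L" and \<tau>: "0 \<le> \<tau>" "\<tau> \<le> \<rho>" and x: "norm x = 1"
    let ?s = "x \<bullet> q"
    have s1: "\<bar>?s\<bar> \<le> 1" using Cauchy_Schwarz_ineq2[of x q] x q by simp
    then have s2: "?s\<^sup>2 \<le> 1" by (simp add: abs_square_le_1)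
    \<comment> \<open>The point of the upper unit circle with real part x . q; then |1 - \<tau> e|
      equals the distance from x to \<tau> q.\<close>
    define e where "e = Complex ?s (sqrt (1 - ?s\<^sup>2))"
    have e: "norm e = 1" "Re e = ?s" using s2 by (simp_all add: e_def cmod_def)
    have \<tau>1: "\<tau> < 1" using \<tau> \<rho> by simp
    have z: "zonal (2 * \<beta>) q l x = Re (cos_sum \<beta> e l)" for l
      using zonal_eq_cos_sum[OF e(1) x e(2)[symmetric], of \<beta> l] by (metis Re_complex_of_real)
    have n2: "(norm (1 - e * of_real \<tau>))\<^sup>2 = 1 - 2 * \<tau> * ?s + \<tau>\<^sup>2"
    proof -
      have "(norm (1 - e * of_real \<tau>))\<^sup>2 = (1 - ?s * \<tau>)\<^sup>2 + (sqrt (1 - ?s\<^sup>2))\<^sup>2 * \<tau>\<^sup>2"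
        by (simp add: cmod_power2 e_def power_mult_distrib)
      also have "(sqrt (1 - ?s\<^sup>2))\<^sup>2 = 1 - ?s\<^sup>2" using s2 by simp
      finally show ?thesis by (simp add: power2_eq_square algebra_simps)
    qed
    have pw: "norm (1 - e * of_real \<tau>) powr (- (2 * \<beta>)) = (1 - 2 * \<tau> * ?s + \<tau>\<^sup>2) powr (- \<beta>)"
    proof -
      have "y\<^sup>2 powr (- \<beta>) = y powr (- (2 * \<beta>))" if "y \<ge> 0" for y :: real
      proof (cases "y = 0")
        case False
        then have "y\<^sup>2 = y powr 2" using that by (simp add: powr_numeral)
        then show ?thesis by (simp only: powr_powr) simp
      qed simp
      then have "(norm (1 - e * of_real \<tau>))\<^sup>2 powr (- \<beta>) = norm (1 - e * of_real \<tau>) powr (- (2 * \<beta>))"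
        by simp
      then show ?thesis using n2 by simp
    qed
    let ?h = "\<lambda>l. zonal (2 * \<beta>) q l x * \<tau> ^ l"
    have "(\<lambda>l. Re (cos_sum \<beta> e l * of_real (\<tau> ^ l))) sums Re (of_real (norm (1 - e * of_real \<tau>) powr (- (2 * \<beta>))))"
      by (rule sums_Re[OF cos_sum_sums[OF e(1) \<tau>(1) \<tau>1 \<beta>]])
    then have hs: "?h sums ((1 - 2 * \<tau> * ?s + \<tau>\<^sup>2) powr (- \<beta>))"
      unfolding z pw by (simp del: of_real_power)
    have hb: "norm (?h l) \<le> c l * \<rho> ^ l" for l
    proof -
      have "\<bar>zonal (2 * \<beta>) q l x\<bar> \<le> c l"
        unfolding z c_def using abs_Re_le_cmod norm_cos_sum_le[OF e(1) \<beta>] order_trans by blast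
      then show ?thesis using \<tau> by (simp add: abs_mult mult_mono power_mono)
    qed
    have split: "(1 - 2 * \<tau> * ?s + \<tau>\<^sup>2) powr (- \<beta>) = (\<Sum>i. ?h (i + Suc L)) + (\<Sum>l<Suc L. ?h l)"
      using suminf_split_initial_segment[OF sums_summable[OF hs], of "Suc L"] sums_unique[OF hs] by simp
    have sc': "summable (\<lambda>i. c (i + Suc L) * \<rho> ^ (i + Suc L))"
      using sc by (simp only: summable_iff_shift[of "\<lambda>l. c l * \<rho> ^ l" "Suc L"])
    have "norm (\<Sum>i. ?h (i + Suc L)) \<le> (\<Sum>i. c (i + Suc L) * \<rho> ^ (i + Suc L))"
      by (rule norm_suminf_le[OF hb sc'])
    also have "\<dots> < \<delta>" using N[of "Suc L"] L by simp
    finally have "\<bar>\<Sum>i. ?h (i + Suc L)\<bar> < \<delta>" by simp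
    then show "\<bar>(\<Sum>l\<le>L. ?h l) - (1 - 2 * \<tau> * ?s + \<tau>\<^sup>2) powr (- \<beta>)\<bar> < \<delta>"
      unfolding split lessThan_Suc_atMost by simp
  qed
qed

text \<open>Dividing the coefficient of \<open>t\<^sup>l\<close> by \<open>l + j\<close> is the averaging operator \<open>t\<^sup>-\<^sup>j \<integral>\<^sub>0\<^sup>t u\<^sup>j\<^sup>-\<^sup>1 p(u) du\<close>,
  which preserves positivity; so \<open>P\<^sub>\<sigma>\<close> has a positive inverse.\<close>

lemma P_eig_inverse_nonneg:
  assumes "\<And>t. 0 \<le> t \<Longrightarrow> t \<le> 1 \<Longrightarrow> (\<Sum>l\<le>L. c l * t ^ l) \<ge> (0 :: real)"
  shows "(\<Sum>l\<le>L. c l / P_eig n l) \<ge> 0"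
proof -
  have "(\<Sum>l\<le>L. c l / pochhammer (real l + 1) k * t ^ l) \<ge> 0" if "0 \<le> t" "t \<le> 1" for k t
    using that
  proof (induction k arbitrary: t)
    case 0
    then show ?case using assms by simp
  next
    case (Suc k)
    define a where "a l = c l / pochhammer (real l + 1) k" for l
    have IH: "(\<Sum>l\<le>L. a l * t ^ l) \<ge> 0" if "0 \<le> t" "t \<le> 1" for t
      using Suc.IH[OF that] by (simp add: a_def)
    have e: "c l / pochhammer (real l + 1) (Suc k) = a l / (real l + 1 + real k)" for l
      by (simp add: a_def pochhammer_Suc)
    show ?case
    proof (cases "t = 0")
      case True
      have "(\<Sum>l\<le>L. x l * (0::real) ^ l) = x 0" for x :: "nat \<Rightarrow> real"
        by (subst sum.atMost_shift) simp
      then show ?thesis using IH[of 0] by (simp add: e True)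
    next
      case False
      \<comment> \<open>The primitive of u^k times the polynomial of the previous step; it starts at
        0 and cannot decrease. Cancelling t^(k + 1) requires t > 0, hence the separate case.\<close>
      define R where "R t = (\<Sum>l\<le>L. a l / (real l + 1 + real k) * t ^ (l + k + 1))" for t
      have "R 0 \<le> R t"
      proof (rule DERIV_nonneg_imp_nondecreasing[of 0 t R])
        show "0 \<le> t" using Suc.prems by simp
        fix u assume u: "0 \<le> u" "u \<le> t"
        have "(R has_real_derivative (\<Sum>l\<le>L. a l / (real l + 1 + real k) * (real (l + k + 1) * u ^ (l + k)))) (at u)"
          unfolding R_def
        proof (intro DERIV_sum DERIV_cmult)
          fix l show "((\<lambda>t. t ^ (l + k + 1)) has_real_derivative real (l + k + 1) * u ^ (l + k)) (at u)"
            using DERIV_pow[of "l + k + 1" u UNIV] by simp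
        qed
        also have "(\<Sum>l\<le>L. a l / (real l + 1 + real k) * (real (l + k + 1) * u ^ (l + k)))
            = u ^ k * (\<Sum>l\<le>L. a l * u ^ l)"
          unfolding sum_distrib_left by (intro sum.cong refl) (simp add: power_add field_simps)
        finally show "\<exists>y. (R has_real_derivative y) (at u) \<and> 0 \<le> y"
          using IH[of u] u Suc.prems by (intro exI[of _ "u ^ k * (\<Sum>l\<le>L. a l * u ^ l)"]) simp
      qed
      moreover have "R 0 = 0" by (simp add: R_def)
      moreover have "R t = t ^ (k + 1) * (\<Sum>l\<le>L. a l / (real l + 1 + real k) * t ^ l)"
        unfolding R_def sum_distrib_left by (intro sum.cong refl) (simp add: power_add mult_ac)
      ultimately have "0 \<le> t ^ (k + 1) * (\<Sum>l\<le>L. a l / (real l + 1 + real k) * t ^ l)" by simp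
      moreover have "t ^ (k + 1) > 0" using False Suc.prems by simp
      ultimately have "0 \<le> (\<Sum>l\<le>L. a l / (real l + 1 + real k) * t ^ l)"
        using zero_le_mult_iff not_le by metis
      then show ?thesis unfolding e .
    qed
  qed
  from this[of 1 "n - 2"] show ?thesis by (simp add: P_eig_def)
qed

text \<open>The constant m sits in degree 0, where the inverse divides by \<open>P_eig n 0\<close>;
  subtracting it reduces the claim to positivity.\<close>

lemma P_eig_inverse_lower:
  assumes "\<And>t. 0 \<le> t \<Longrightarrow> t \<le> 1 \<Longrightarrow> m \<le> (\<Sum>l\<le>L. c l * t ^ l)"
  shows "m / P_eig n 0 \<le> (\<Sum>l\<le>L. c l / P_eig n l)"
proof -
  have s: "(\<Sum>l\<le>L. (c l - (if l = 0 then m else 0)) * y l) = (\<Sum>l\<le>L. c l * y l) - m * y 0" for y :: "nat \<Rightarrow> real"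
    by (simp add: left_diff_distrib sum_subtractf if_distrib[of "\<lambda>z. z * _"] cong: if_cong)
  have "0 \<le> (\<Sum>l\<le>L. (c l - (if l = 0 then m else 0)) / P_eig n l)"
    by (rule P_eig_inverse_nonneg) (use assms s in simp)
  then show ?thesis using s[of "\<lambda>l. inverse (P_eig n l)"] by (simp add: divide_inverse)
qed

lemma P_eig_inverse_upper:
  assumes "\<And>t. 0 \<le> t \<Longrightarrow> t \<le> 1 \<Longrightarrow> (\<Sum>l\<le>L. c l * t ^ l) \<le> m"
  shows "(\<Sum>l\<le>L. c l / P_eig n l) \<le> m / P_eig n 0"
  using P_eig_inverse_lower[where m = "- m" and c = "\<lambda>l. - c l" and L = L and n = n] assms by (simp add: sum_negf)

section \<open>Concentrating solutions\<close>

text \<open>Truncations of the expansion of the Newton kernel with pole near \<open>q\<close> serve as \<open>P\<^sub>\<sigma> v\<close>.\<close>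

lemma concentrated_pair:
  fixes q :: "'a::euclidean_space"
  assumes n: "n \<ge> 3" and dim: "DIM('a) = n + 1" and q: "norm q = 1"
  obtains v f where "P_pair n v f" "\<forall>x\<in>sphere 0 1. v x > 0" "\<forall>x\<in>sphere 0 1. f x > 0" "v q \<ge> B"
    "\<And>\<eta> x. 0 < \<eta> \<Longrightarrow> \<eta> \<le> 1 \<Longrightarrow> norm x = 1 \<Longrightarrow> x \<bullet> q \<le> 1 - \<eta> \<Longrightarrow> v x \<le> \<eta> powr (- ((real n - 1) / 2)) + 1"
proof -
  \<comment> \<open>Then 2 \<beta> = n - 1 is the exponent of the Newton kernel in dimension n +
    1.\<close>
  define \<beta> where "\<beta> = (real n - 1) / 2"
  have \<beta>: "\<beta> > 0" "2 * \<beta> = real n - 1" "real DIM('a) - 2 = 2 * \<beta>" using n dim by (auto simp: \<beta>_def)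
  have P0: "P_eig n 0 \<ge> 1"
    by (simp add: P_eig_def pochhammer_fact[symmetric])
  obtain M :: nat where M: "real M \<ge> B * P_eig n 0" using real_arch_simple by blast
  \<comment> \<open>Chosen so that the geometric series at the pole sums to M + 2, which leaves room
    for its truncation to exceed M.\<close>
  define \<rho> where "\<rho> = 1 - 1 / (real M + 2)"
  have \<rho>: "0 \<le> \<rho>" "\<rho> < 1" "1 / (1 - \<rho>) = real M + 2" by (auto simp: \<rho>_def field_simps)
  \<comment> \<open>The kernel is at least 4^(-\<beta>) \<ge> 2 \<delta>, since squared distances
    are at most 4; an error below \<delta> keeps the truncation above \<delta>.\<close>
  define \<delta> where "\<delta> = (1 / 2) ^ n / (2 :: real)"
  have \<delta>: "\<delta> > 0" "\<delta> < 1" using power_le_one[of "1 / 2 :: real" n] by (auto simp: \<delta>_def)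
  obtain N where N: "\<And>L \<tau> x. N \<le> L \<Longrightarrow> 0 \<le> \<tau> \<Longrightarrow> \<tau> \<le> \<rho> \<Longrightarrow> norm x = 1 \<Longrightarrow>
    \<bar>(\<Sum>l\<le>L. zonal (2 * \<beta>) q l x * \<tau> ^ l) - (1 - 2 * \<tau> * (x \<bullet> q) + \<tau>\<^sup>2) powr (- \<beta>)\<bar> < \<delta>"
    using zonal_partial_sums[OF \<beta>(1) \<rho>(1,2) q \<delta>(1)] by blast
  have "(\<lambda>l. \<rho> ^ l) sums (real M + 2)" using geometric_sums[of \<rho>] \<rho> by simp
  then have "(\<lambda>n. \<Sum>l\<le>n. \<rho> ^ l) \<longlonglongrightarrow> real M + 2" by (simp add: sums_def_le)
  then have "\<forall>\<^sub>F n in sequentially. real M < (\<Sum>l\<le>n. \<rho> ^ l)" by (rule order_tendstoD) simp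
  then obtain N' where N': "\<And>L. L \<ge> N' \<Longrightarrow> real M < (\<Sum>l\<le>L. \<rho> ^ l)" by (auto simp: eventually_sequentially)
  define L where "L = max N N'"
  define Y where "Y l x = (\<rho> ^ l / P_eig n l) * zonal (2 * \<beta>) q l x" for l x
  define v where "v x = (\<Sum>l\<le>L. Y l x)" for x
  define f where "f x = (\<Sum>l\<le>L. P_eig n l * Y l x)" for x
  have P: "P_pair n v f"
    unfolding P_pair_def v_def[abs_def] f_def[abs_def]
    by (intro exI[of _ L] exI[of _ Y] conjI allI refl)
      (unfold Y_def[abs_def], intro solid_harm_cmult solid_harm_zonal[OF q \<beta>(3)[symmetric]])
  \<comment> \<open>\<open>S x t\<close> is the truncated kernel with pole t \<rho> q. The value v x
    arises from t -> \<open>S x t\<close> by dividing its coefficients by \<open>P_eig\<close>, so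
    bounds valid for all t in the unit interval pass to v.\<close>
  define S where "S x t = (\<Sum>l\<le>L. (zonal (2 * \<beta>) q l x * \<rho> ^ l) * t ^ l)" for x t
  have v_eq: "v x = (\<Sum>l\<le>L. (zonal (2 * \<beta>) q l x * \<rho> ^ l) / P_eig n l)" for x
    by (simp add: v_def Y_def mult.commute)
  have f_eq: "f x = S x 1" for x
    using P_eig_pos[of n] by (auto simp: f_def S_def Y_def less_imp_neq[symmetric] intro!: sum.cong)
  have S: "\<bar>S x t - (1 - 2 * (t * \<rho>) * (x \<bullet> q) + (t * \<rho>)\<^sup>2) powr (- \<beta>)\<bar> < \<delta>"
    if "0 \<le> t" "t \<le> 1" "norm x = 1" for x t
  proof -
    have "t * \<rho> \<le> \<rho>" using that \<rho> by (simp add: mult_left_le_one_le)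
    moreover have "S x t = (\<Sum>l\<le>L. zonal (2 * \<beta>) q l x * (t * \<rho>) ^ l)"
      by (simp add: S_def power_mult_distrib mult_ac)
    ultimately show ?thesis using N[of L "t * \<rho>" x] that \<rho> by (simp add: L_def)
  qed
  have low: "\<delta> \<le> S x t" if t: "0 \<le> t" "t \<le> 1" and x: "norm x = 1" for x t
  proof -
    have s: "\<bar>x \<bullet> q\<bar> \<le> 1" using Cauchy_Schwarz_ineq2[of x q] x q by simp
    have \<tau>: "0 \<le> t * \<rho>" "t * \<rho> < 1"
      using t \<rho> mult_left_le_one_le[of \<rho> t] by (auto intro: le_less_trans)
    let ?A = "1 - 2 * (t * \<rho>) * (x \<bullet> q) + (t * \<rho>)\<^sup>2"
    have "(t * \<rho>) * (x \<bullet> q) \<le> (t * \<rho>) * 1" using s \<tau> by (intro mult_left_mono) auto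
    then have A1: "?A \<ge> (1 - t * \<rho>)\<^sup>2" by (simp add: power2_eq_square algebra_simps)
    then have A0: "?A > 0" using \<tau> by (meson less_le_trans zero_less_power diff_gt_0_iff_gt)
    have "(t * \<rho>) * (- (x \<bullet> q)) \<le> (t * \<rho>) * 1" using s \<tau> by (intro mult_left_mono) auto
    moreover have "(t * \<rho>)\<^sup>2 \<le> 1" using \<tau> by (simp add: power_le_one)
    ultimately have A4: "?A \<le> 4" using \<tau>(2) by simp
    have "2 * \<delta> = inverse (2 ^ n)" by (simp add: \<delta>_def power_one_over inverse_eq_divide)
    also have "\<dots> = 2 powr (- real n)" using powr_realpow[of 2 n] by (simp only: powr_minus zero_less_numeral)
    also have "\<dots> \<le> 2 powr (- (2 * \<beta>))" using \<beta>(2) by (intro powr_mono) auto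
    also have "\<dots> = 4 powr (- \<beta>)" using powr_powr[of 2 2 "- \<beta>"] by simp
    also have "\<dots> \<le> ?A powr (- \<beta>)" using A0 A4 \<beta>(1) by (intro powr_mono2') auto
    finally show ?thesis using S[OF t x] by linarith
  qed
  have vpos: "\<forall>x\<in>sphere 0 1. v x > 0"
  proof
    fix x :: 'a assume "x \<in> sphere 0 1"
    then have x: "norm x = 1" by simp
    have "\<delta> / P_eig n 0 \<le> v x"
      unfolding v_eq by (rule P_eig_inverse_lower) (use low[OF _ _ x] in \<open>simp add: S_def\<close>)
    moreover have "0 < \<delta> / P_eig n 0" using \<delta>(1) P0 by (intro divide_pos_pos) auto
    ultimately show "v x > 0" by linarith
  qed
  have fpos: "\<forall>x\<in>sphere 0 1. f x > 0"
  proof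
    fix x :: 'a assume "x \<in> sphere 0 1"
    then show "f x > 0" using low[of 1 x] \<delta>(1) by (simp add: f_eq)
  qed
  have vq: "v q \<ge> B"
  proof -
    have "v q = (\<Sum>l\<le>L. \<rho> ^ l) / P_eig n 0"
      unfolding v_eq \<beta>(2) sum_divide_distrib
      using zonal_pole[of n q] n q P_eig_pos[of n] by (intro sum.cong refl) (simp add: less_imp_neq[symmetric])
    moreover have "B * P_eig n 0 \<le> (\<Sum>l\<le>L. \<rho> ^ l)" using M N'[of L] by (simp add: L_def)
    ultimately show ?thesis using P_eig_pos[of n 0] by (simp add: pos_le_divide_eq)
  qed
  show ?thesis
  proof (rule that[OF P vpos fpos vq])
    fix \<eta> :: real and x :: 'a assume \<eta>: "0 < \<eta>" "\<eta> \<le> 1" and x: "norm x = 1" "x \<bullet> q \<le> 1 - \<eta>"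
    have up: "S x t \<le> \<eta> powr (- \<beta>) + 1" if t: "0 \<le> t" "t \<le> 1" for t
    proof -
      let ?\<tau> = "t * \<rho>"
      let ?A = "1 - 2 * ?\<tau> * (x \<bullet> q) + ?\<tau>\<^sup>2"
      have \<tau>: "0 \<le> ?\<tau>" using t \<rho> by simp
      have "?\<tau> * (x \<bullet> q) \<le> ?\<tau> * (1 - \<eta>)" using x(2) \<tau> by (intro mult_left_mono)
      \<comment> \<open>Completing the square bounds the squared distance from x to the pole below
        by \<eta> for every position of the pole on the segment; hence the upper bound on v does not
        involve \<open>B\<close>.\<close>
      then have "?A \<ge> (?\<tau> - (1 - \<eta>))\<^sup>2 + (1 - (1 - \<eta>)\<^sup>2)" by (simp add: power2_eq_square algebra_simps)
      moreover have "1 - (1 - \<eta>)\<^sup>2 \<ge> \<eta>"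
        using mult_right_mono[OF \<eta>(2), of \<eta>] \<eta>(1) by (simp add: power2_eq_square algebra_simps)
      ultimately have "?A \<ge> \<eta>" using zero_le_power2[of "?\<tau> - (1 - \<eta>)"] by linarith
      then have "?A powr (- \<beta>) \<le> \<eta> powr (- \<beta>)" using \<eta> \<beta>(1) by (intro powr_mono2') auto
      then show ?thesis using S[OF t x(1)] \<delta>(2) by linarith
    qed
    have "v x \<le> (\<eta> powr (- \<beta>) + 1) / P_eig n 0"
      unfolding v_eq by (rule P_eig_inverse_upper) (use up in \<open>simp add: S_def\<close>)
    also have "\<dots> \<le> \<eta> powr (- \<beta>) + 1"
      using P0 divide_left_mono[of 1 "P_eig n 0" "\<eta> powr (- \<beta>) + 1"] by simp
    finally show "v x \<le> \<eta> powr (- ((real n - 1) / 2)) + 1" by (simp add: \<beta>_def)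
  qed
qed

lemma inner_less_one:
  assumes "norm x = 1" "norm y = 1" "x \<noteq> y" shows "x \<bullet> y < (1 :: real)"
proof -
  have "0 < (x - y) \<bullet> (x - y)" using assms(3) by simp
  also have "\<dots> = 2 - 2 * (x \<bullet> y)"
    using assms(1,2) by (simp add: inner_diff_left inner_diff_right inner_commute norm_eq_1)
  finally show ?thesis by simp
qed

theorem corollary1p2:
  fixes m n k :: nat and \<sigma> :: real and qs :: "(real ^ 'd) list"
  assumes "m \<ge> 1"
    and "\<sigma> = 1 + real m / 2"
    and "real n = 2 * \<sigma> + 2"
    and "CARD('d) = n + 1"
    and "k \<ge> 1"
    and "length qs = k" and "distinct qs" and "set qs \<subseteq> sphere 0 1"
  shows "\<exists>(K :: nat \<Rightarrow> real ^ 'd \<Rightarrow> real) (v :: nat \<Rightarrow> real ^ 'd \<Rightarrow> real).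
    (\<forall>i. morse (K i) \<and> K i \<in> A_set n \<sigma> \<and> v i \<in> solutions n \<sigma> (K i)) \<and>
    blow_up_points v = set qs"
proof -
  let ?S = "sphere (0 :: real ^ 'd) 1" and ?c = "c_const n \<sigma>"
  have n: "n \<ge> 3" using assms(1-3) by simp
  have dim: "DIM(real ^ 'd) = n + 1" using assms(4) by simp
  have c: "?c > 0" using c_const_pos[of n \<sigma>] n assms(3) by simp
  have ne: "set qs \<noteq> {}" using assms(5,6) by auto
  have q1: "norm q = 1" if "q \<in> set qs" for q using that assms(8) by auto
  \<comment> \<open>This bound away from a pole is free of i, whereas the height at the pole is at
    least i.\<close>
  let ?C = "\<lambda>\<eta>. \<eta> powr (- ((real n - 1) / 2)) + 1"
  define good where "good q i v f \<longleftrightarrow> P_pair n v f \<and> (\<forall>x\<in>?S. v x > 0) \<and> (\<forall>x\<in>?S. f x > 0) \<and> v q \<ge> real i \<and>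
    (\<forall>\<eta> x. 0 < \<eta> \<longrightarrow> \<eta> \<le> 1 \<longrightarrow> norm x = 1 \<longrightarrow> x \<bullet> q \<le> 1 - \<eta> \<longrightarrow> v x \<le> ?C \<eta>)"
    for q and i :: nat and v f :: "real ^ 'd \<Rightarrow> real"
  have "\<exists>v f. good q i v f" if "q \<in> set qs" for q i
    unfolding good_def by (rule concentrated_pair[OF n dim q1[OF that], of "real i"]) blast
  then obtain w g where "\<And>q i. q \<in> set qs \<Longrightarrow> good q i (w q i) (g q i)" by metis
  then have wg: "\<And>q i. q \<in> set qs \<Longrightarrow> P_pair n (w q i) (g q i)"
    "\<And>q i x. q \<in> set qs \<Longrightarrow> norm x = 1 \<Longrightarrow> w q i x > 0" "\<And>q i x. q \<in> set qs \<Longrightarrow> norm x = 1 \<Longrightarrow> g q i x > 0"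
    "\<And>q i. q \<in> set qs \<Longrightarrow> w q i q \<ge> real i"
    "\<And>q i \<eta> x. q \<in> set qs \<Longrightarrow> 0 < \<eta> \<Longrightarrow> \<eta> \<le> 1 \<Longrightarrow> norm x = 1 \<Longrightarrow> x \<bullet> q \<le> 1 - \<eta> \<Longrightarrow> w q i x \<le> ?C \<eta>"
    by (auto simp: good_def)
  define v0 where "v0 i = (\<lambda>x. \<Sum>q\<in>set qs. w q i x)" for i
  define f0 where "f0 i = (\<lambda>x. \<Sum>q\<in>set qs. g q i x)" for i
  have P0: "P_pair n (v0 i) (f0 i)" for i unfolding v0_def f0_def by (intro P_pair_sum wg)
  have pos0: "\<forall>x\<in>?S. v0 i x > 0" "\<forall>x\<in>?S. f0 i x > 0" for i
    unfolding v0_def f0_def using ne wg(2,3) by (auto intro!: sum_pos)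
  \<comment> \<open>Accuracy 1 is enough: a bounded change affects neither the growth at the
    prescribed points nor the boundedness elsewhere.\<close>
  have "\<exists>v f. P_pair n v f \<and> (\<forall>x. norm x = 1 \<longrightarrow> \<bar>v x - v0 i x\<bar> < 1) \<and> (\<forall>x\<in>?S. v x > 0) \<and>
      morse (curv n ?c v f) \<and> curv n ?c v f \<in> A_set n \<sigma>" for i
    by (rule A_set_perturbation[where \<epsilon> = 1 and \<sigma> = \<sigma>, OF n assms(4) P0[of i] c pos0(1)[of i] pos0(2)[of i]]) auto
  then obtain v f where vf: "\<And>i. P_pair n (v i) (f i)" "\<And>i x. norm x = 1 \<Longrightarrow> \<bar>v i x - v0 i x\<bar> < 1"
    "\<And>i. \<forall>x\<in>?S. v i x > 0" "\<And>i. morse (curv n ?c (v i) (f i))" "\<And>i. curv n ?c (v i) (f i) \<in> A_set n \<sigma>"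
    by metis
  have sol: "v i \<in> solutions n \<sigma> (curv n ?c (v i) (f i))" for i
    using curv_solutions[OF _ assms(3) dim vf(1)] vf(3) n by auto
  have "blow_up_points v = set qs"
  proof (intro equalityI subsetI)
    fix q assume q: "q \<in> set qs"
    have "real i - 1 \<le> v i q" for i
    proof -
      have "w q i q \<le> v0 i q"
        unfolding v0_def using q wg(2)[OF _ q1[OF q]] by (intro member_le_sum) (auto intro: less_imp_le)
      then show ?thesis using wg(4)[OF q, of i] vf(2)[OF q1[OF q], of i] by linarith
    qed
    moreover have "filterlim (\<lambda>i. real i - 1) at_top sequentially"
      using filterlim_tendsto_add_at_top[OF tendsto_const[of "- 1 :: real"] filterlim_real_sequentially] by simp
    ultimately have "filterlim (\<lambda>i. v i q) at_top sequentially"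
      by (blast intro: filterlim_at_top_mono always_eventually)
    then show "q \<in> blow_up_points v"
      unfolding blow_up_points_def using q assms(8) by (intro CollectI conjI exI[of _ "\<lambda>i. q"]) auto
  next
    fix x assume "x \<in> blow_up_points v"
    then obtain y where y: "x \<in> ?S" "\<And>i. y i \<in> ?S" "y \<longlonglongrightarrow> x" "filterlim (\<lambda>i. v i (y i)) at_top sequentially"
      by (auto simp: blow_up_points_def)
    show "x \<in> set qs"
    proof (rule ccontr)
      assume "x \<notin> set qs"
      \<comment> \<open>Half of the gap 1 - x . q: the limit x satisfies the cap condition strictly,
        so the points y i satisfy it eventually.\<close>
      define \<eta> where "\<eta> q = (1 - x \<bullet> q) / 2" for q
      have \<eta>: "0 < \<eta> q" "\<eta> q \<le> 1" if "q \<in> set qs" for q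
      proof -
        show "0 < \<eta> q" using inner_less_one[of x q] y(1) q1[OF that] that \<open>x \<notin> set qs\<close> by (auto simp: \<eta>_def)
        show "\<eta> q \<le> 1" using Cauchy_Schwarz_ineq2[of x q] y(1) q1[OF that] by (auto simp: \<eta>_def)
      qed
      have "\<forall>\<^sub>F i in sequentially. \<forall>q\<in>set qs. y i \<bullet> q \<le> 1 - \<eta> q"
      proof (rule eventually_ball_finite, simp, rule ballI)
        fix q assume q: "q \<in> set qs"
        have "(\<lambda>i. y i \<bullet> q) \<longlonglongrightarrow> x \<bullet> q" by (intro tendsto_intros y(3))
        moreover have "x \<bullet> q < 1 - \<eta> q" using \<eta>(1)[OF q] by (simp add: \<eta>_def field_simps)
        ultimately have "\<forall>\<^sub>F i in sequentially. y i \<bullet> q < 1 - \<eta> q" by (rule order_tendstoD)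
        then show "\<forall>\<^sub>F i in sequentially. y i \<bullet> q \<le> 1 - \<eta> q" by (rule eventually_mono) simp
      qed
      moreover have "\<forall>\<^sub>F i in sequentially. v i (y i) > (\<Sum>q\<in>set qs. ?C (\<eta> q)) + 1"
        using y(4) by (simp add: filterlim_at_top_dense)
      ultimately have "\<forall>\<^sub>F i in sequentially. False"
      proof eventually_elim
        case (elim i)
        have yi: "norm (y i) = 1" using y(2) by simp
        have "v0 i (y i) \<le> (\<Sum>q\<in>set qs. ?C (\<eta> q))"
          unfolding v0_def using elim(1) \<eta> yi by (intro sum_mono wg(5)) auto
        then show False using vf(2)[OF yi, of i] elim(2) by linarith
      qed
      then show False by simp
    qed
  qed
  then show ?thesis using vf(4,5) sol by (intro exI[of _ "\<lambda>i. curv n ?c (v i) (f i)"] exI[of _ v]) auto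
qed

end
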